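(* Let $m\geq 1$, and let $A$, the offline coefficients $A_i^T$, the weights $\mu_i^T$, the correctors $\mathcal{C}_{m,T}(\cdot)$ and the bilinear forms $\mathfrak{b}$, $\tilde{\mathfrak{b}}$ be as in the context (it is not required that $A|_{U_m(T)}=\sum_{i=0}^N\mu_i^TA_i^T$). Write $\bar A^T=\sum_{i=0}^N\mu_i^TA_i^T$ and define for every $T\in\mathcal{T}_H$ the number $E_T\ge 0$ by $$E_T^2=\max_{v}\ \frac{\bigl\|(A^{1/2}-A^{-1/2}\bar A^T)\chi_T\nabla v-\sum_{i=0}^N\mu_i^T(A^{1/2}-A^{-1/2}A_i^T)\nabla(\mathcal{C}_{m,T}(A_i^T)v)\bigr\|_{L^2(U_m(T))}^2}{\|v\|_{A,T}^2},$$ where the maximum is over all $v\in V_H$ with $\|v\|_{A,T}\neq0$ (the quotient depends only on $v|_T$). Then there is a constant $C>0$ depending only on $d$, $D$ and the regularity (shape regularity and quasi-uniformity) of the mesh $\mathcal{T}_H$ such that for all $v,w\in V_H$ $$|(\tilde{\mathfrak{b}}-\mathfrak{b})(v,w)|\leq C\,m^{d/2}\,\Bigl(\max_{T\in\mathcal{T}_H}E_T\Bigr)\,\|v\|_A\,\|w\|_A .$$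
   Context: **Domain, coefficient, norms.** $D=[0,1]^d$, regarded as a torus (periodic boundary conditions). $A\in L^\infty(D,\mathbb{R})$ satisfies $0<\operatorname{ess\,inf}_DA$ and $\operatorname{ess\,sup}_DA<\infty$. $\mathfrak{a}(u,v)=\int_DA\nabla u\cdot\nabla v\,dx$, $\|v\|_A=\mathfrak{a}(v,v)^{1/2}$, and for $S\subset D$, $\|v\|_{A,S}^2=\int_SA|\nabla v|^2dx$. $\chi_S$ denotes the characteristic function of $S$. **Meshes and spaces.** $H^1_{\#,0}(D)=\{v\in H^1(D): v\text{ periodic},\ \int_Dv=0\}$. $\mathcal{T}_H$ is a shape regular, quasi-uniform, conforming quadrilateral mesh of $D$ that is also conforming as a mesh of the torus, with mesh size $H$; it is compatible with the $\varepsilon$-periodicity introduced below (mesh size an integer multiple of $\varepsilon$, so that the elements are translates of each other by vectors in $\varepsilon\mathbb{Z}^d$). $V_H=H^1_{\#,0}(D)\cap\mathcal{Q}_1(\mathcal{T}_H)$, where $\mathcal{Q}_1(\mathcal{T}_H)$ denotes (possibly discontinuous) $\mathcal{T}_H$-piecewise polynomials of coordinate degree at most $1$. $V$ is either $H^1_{\#,0}(D)$ or a conforming finite element space $V_h\subset H^1_{\#,0}(D)$ on a conforming shape regular quadrilateral refinement $\mathcal{T}_h$ of $\mathcal{T}_H$ (also conforming on the torus) that resolves the variations of the coefficients, with $V_H\subset V$. **Patches.** For $S\subset D$: $U_0(S)=S$, $U_{m+1}(S)=\bigcup\{T\in\mathcal{T}_H:\overline{U_m(S)}\cap\overline T\ne\emptyset\}$,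 with $\mathcal{T}_H$ understood as a mesh of the torus. **Interpolation and fine-scale spaces.** $I_H:V\to V_H$ is a bounded local linear projection ($I_H\circ I_H=I_H$) satisfying $H^{-1}\|v-I_Hv\|_{L^2(T)}+\|\nabla I_Hv\|_{L^2(T)}\le C_I\|\nabla v\|_{L^2(U_1(T))}$ for all $v\in V$, $T\in\mathcal{T}_H$, where $C_I$ depends only on mesh regularity, $D$ and $d$. $V^{\mathrm f}=\ker I_H$ and $V^{\mathrm f}(U_m(T))=\{v\in V^{\mathrm f}: v|_{D\setminus U_m(T)}=0\}$. **Correctors.** For a coefficient $a\in L^\infty(U_m(T))$ bounded below by a positive constant, and $v\in V_H$, $\mathcal{C}_{m,T}(a)v\in V^{\mathrm f}(U_m(T))$ is the unique solution of $$\int_{U_m(T)}a\nabla(\mathcal{C}_{m,T}(a)v)\cdot\nabla v^{\mathrm f}\,dx=\int_Ta\nabla v\cdot\nabla v^{\mathrm f}\,dx\quad\text{for all }v^{\mathrm f}\in V^{\mathrm f}(U_m(T)).$$ **Bilinear forms.** For such $a$ set $\mathfrak{b}_T[a](v,w)=\int_{U_m(T)}a\,(\chi_T\nabla v-\nabla(\mathcal{C}_{m,T}(a)v))\cdot\nabla w\,dx$, and $\mathfrak{b}(v,w)=\sum_{T\in\mathcal{T}_H}\mathfrak{b}_T[A|_{U_m(T)}](v,w)$. **Offline coefficients and combined form.** Let $\varepsilon=1/n$, $n\in\mathbb{N}$; $A_\varepsilon(x)=A_{\mathrm{per}}(x/\varepsilon)$, $B_\varepsilon(x)=B_{\mathrm{per}}(x/\varepsilon)$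 with $A_{\mathrm{per}},B_{\mathrm{per}}\in L^\infty(\mathbb{R}^d)$ real-valued and $1$-periodic in each coordinate and, for some $0<\alpha\le\beta<\infty$, $\alpha\le A_{\mathrm{per}}\le\beta$ and $\alpha\le A_{\mathrm{per}}+B_{\mathrm{per}}\le\beta$ a.e. Let $Q\subseteq[0,1]^d$ be measurable with positive measure. For $T\in\mathcal{T}_H$ let $J_T=\{k\in\mathbb{Z}^d:\varepsilon(k+Q)\subset U_m(T)\}$, $N=\operatorname{card}J_T$, and let $\sigma_T:\{1,\dots,N\}\to J_T$ be a bijection. Put $A_0^T=A_\varepsilon|_{U_m(T)}$ and $A_i^T=A_\varepsilon|_{U_m(T)}+\chi_{\varepsilon(\sigma_T(i)+Q)}B_\varepsilon$ for $i=1,\dots,N$ (by periodicity these are, up to translation on the torus, the same for all $T$). For each $T$ let $\mu_0^T,\dots,\mu_N^T\in\mathbb{R}$ be given weights. Then $$\tilde{\mathfrak{b}}(v,w)=\sum_{T\in\mathcal{T}_H}\sum_{i=0}^N\mu_i^T\,\mathfrak{b}_T[A_i^T](v,w).$$ *)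

theory Defs
  imports "HOL-Analysis.Analysis"
begin

text \<open>
  The torus is modelled through its universal cover: functions on it are functions on
  \<open>real ^ 'd\<close> that are periodic up to null sets, and \<open>d\<close> is \<open>CARD('d)\<close>.  Functions represent
  their almost-everywhere classes.  Mesh elements and patches are subsets of the fundamental cell;
  only adjacency is understood modulo integer translations.
\<close>

definition unit_cell :: "(real ^ 'd) set" where
  "unit_cell = cbox 0 1"

definition int_vecs :: "(real ^ 'd) set" where
  "int_vecs = {k. \<forall>j. k $ j \<in> \<int>}"

definition translate :: "real ^ 'd \<Rightarrow> (real ^ 'd) set \<Rightarrow> (real ^ 'd) set" where
  "translate k S = (\<lambda>x. x + k) ` S"

definition ae_periodic :: "(real ^ 'd \<Rightarrow> real) \<Rightarrow> bool" where
  "ae_periodic v \<longleftrightarrow> (\<forall>k\<in>int_vecs. AE x in lebesgue. v (x + k) = v x)"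

definition locally_integrable :: "(real ^ 'd \<Rightarrow> 'b :: euclidean_space) \<Rightarrow> bool" where
  "locally_integrable f \<longleftrightarrow>
     f \<in> borel_measurable lebesgue \<and> (\<forall>K. compact K \<longrightarrow> set_integrable lebesgue K f)"

text \<open>Distributional gradient, tested with continuously differentiable functions of compact
  support (for first derivatives this gives the same notion as smooth test functions).\<close>

definition is_weak_grad :: "(real ^ 'd \<Rightarrow> real) \<Rightarrow> (real ^ 'd \<Rightarrow> real ^ 'd) \<Rightarrow> bool" where
  "is_weak_grad v g \<longleftrightarrow> locally_integrable v \<and> locally_integrable g \<and>
     (\<forall>\<phi> \<psi>. (\<forall>x. GDERIV \<phi> x :> \<psi> x) \<and> continuous_on UNIV \<psi> \<and>
            (\<exists>K. compact K \<and> (\<forall>x. x \<notin> K \<longrightarrow> \<phi> x = 0)) \<longrightarrow>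
        (LINT x|lebesgue. v x *\<^sub>R \<psi> x) = - (LINT x|lebesgue. \<phi> x *\<^sub>R g x))"

definition weak_grad :: "(real ^ 'd \<Rightarrow> real) \<Rightarrow> real ^ 'd \<Rightarrow> real ^ 'd" where
  "weak_grad v = (SOME g. is_weak_grad v g)"

definition square_integrable_on :: "(real ^ 'd \<Rightarrow> 'b :: euclidean_space) \<Rightarrow> (real ^ 'd) set \<Rightarrow> bool" where
  "square_integrable_on f S \<longleftrightarrow>
     f \<in> borel_measurable lebesgue \<and> set_integrable lebesgue S (\<lambda>x. (norm (f x))\<^sup>2)"

definition L2_norm :: "(real ^ 'd) set \<Rightarrow> (real ^ 'd \<Rightarrow> 'b :: euclidean_space) \<Rightarrow> real" where
  "L2_norm S f = sqrt (LINT x:S|lebesgue. (norm (f x))\<^sup>2)"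

definition H1_per0 :: "(real ^ 'd \<Rightarrow> real) set" where
  "H1_per0 = {v. ae_periodic v \<and> square_integrable_on v unit_cell \<and>
     (\<exists>g. is_weak_grad v g \<and> square_integrable_on g unit_cell) \<and>
     (LINT x:unit_cell|lebesgue. v x) = 0}"

definition energy_norm :: "(real ^ 'd \<Rightarrow> real) \<Rightarrow> (real ^ 'd) set \<Rightarrow> (real ^ 'd \<Rightarrow> real) \<Rightarrow> real" where
  "energy_norm A S v = sqrt (LINT x:S|lebesgue. A x * (norm (weak_grad v x))\<^sup>2)"

definition coord_poly :: "nat \<Rightarrow> (real ^ 'd \<Rightarrow> real) \<Rightarrow> bool" where
  "coord_poly p f \<longleftrightarrow>
     (\<exists>c. \<forall>x. f x = (\<Sum>\<alpha> \<in> {\<alpha> :: 'd \<Rightarrow> nat. \<forall>j. \<alpha> j \<le> p}. c \<alpha> * (\<Prod>j\<in>UNIV. x $ j ^ \<alpha> j)))"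

definition piecewise_Q :: "nat \<Rightarrow> (real ^ 'd) set set \<Rightarrow> (real ^ 'd \<Rightarrow> real) set" where
  "piecewise_Q p \<T> = {v. \<forall>T\<in>\<T>. \<exists>f. coord_poly p f \<and> (AE x in lebesgue. x \<in> T \<longrightarrow> v x = f x)}"

text \<open>A quadrilateral element is the image of the reference cube under an injective multi-affine
  map; its proper faces are the images of the proper faces of the cube.\<close>

definition quad_map :: "(real ^ 'd \<Rightarrow> real ^ 'd) \<Rightarrow> (real ^ 'd) set \<Rightarrow> bool" where
  "quad_map F T \<longleftrightarrow>
     (\<forall>j. coord_poly 1 (\<lambda>x. F x $ j)) \<and> inj_on F unit_cell \<and> T = F ` unit_cell"

definition quadrilateral :: "(real ^ 'd) set \<Rightarrow> bool" where
  "quadrilateral T \<longleftrightarrow> (\<exists>F. quad_map F T)"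

definition cube_face :: "(real ^ 'd) set \<Rightarrow> bool" where
  "cube_face f \<longleftrightarrow> (\<exists>J0 J1. J0 \<inter> J1 = {} \<and> J0 \<union> J1 \<noteq> {} \<and>
     f = {x \<in> unit_cell. (\<forall>j\<in>J0. x $ j = 0) \<and> (\<forall>j\<in>J1. x $ j = 1)})"

definition quad_face :: "(real ^ 'd) set \<Rightarrow> (real ^ 'd) set \<Rightarrow> bool" where
  "quad_face S T \<longleftrightarrow> (\<exists>F f. quad_map F T \<and> cube_face f \<and> S = F ` f)"

text \<open>In the last clause, \<open>k = 0\<close> is conformity of the mesh in the cell, and general \<open>k\<close> is
  conformity on the torus.\<close>

definition quad_mesh :: "(real ^ 'd) set set \<Rightarrow> bool" where
  "quad_mesh \<T> \<longleftrightarrow> finite \<T> \<and> (\<forall>T\<in>\<T>. quadrilateral T) \<and> \<Union>\<T> = unit_cell \<and>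
     (\<forall>T\<in>\<T>. \<forall>T'\<in>\<T>. \<forall>k\<in>int_vecs. T \<noteq> translate k T' \<and> T \<inter> translate k T' \<noteq> {} \<longrightarrow>
        quad_face (T \<inter> translate k T') T \<and> quad_face (T \<inter> translate k T') (translate k T'))"

text \<open>Element sizes are measured in the maximum norm, so that a Cartesian mesh has mesh size equal
  to its edge length; in the Euclidean norm, commensurability of the mesh size with the period would
  exclude cubes in most dimensions.\<close>

definition elem_size :: "(real ^ 'd) set \<Rightarrow> real" where
  "elem_size T = (SUP (x, y)\<in>T \<times> T. infnorm (x - y))"

definition mesh_size :: "(real ^ 'd) set set \<Rightarrow> real" where
  "mesh_size \<T> = (MAX T\<in>\<T>. elem_size T)"

definition shape_regular :: "real \<Rightarrow> (real ^ 'd) set set \<Rightarrow> bool" where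
  "shape_regular \<gamma> \<T> \<longleftrightarrow> (\<forall>T\<in>\<T>. \<exists>x. ball x (\<gamma> * diameter T) \<subseteq> T)"

definition quasi_uniform :: "real \<Rightarrow> (real ^ 'd) set set \<Rightarrow> bool" where
  "quasi_uniform \<kappa> \<T> \<longleftrightarrow> (\<forall>T\<in>\<T>. \<kappa> * mesh_size \<T> \<le> elem_size T)"

definition period_compatible :: "real \<Rightarrow> (real ^ 'd) set set \<Rightarrow> bool" where
  "period_compatible \<epsilon> \<T> \<longleftrightarrow> (\<exists>p::nat. p \<ge> 1 \<and> mesh_size \<T> = real p * \<epsilon>) \<and>
     (\<forall>T\<in>\<T>. \<forall>T'\<in>\<T>. \<exists>k\<in>int_vecs. T' = translate (\<epsilon> *\<^sub>R k) T)"

definition refines :: "(real ^ 'd) set set \<Rightarrow> (real ^ 'd) set set \<Rightarrow> bool" where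
  "refines \<S> \<T> \<longleftrightarrow> (\<forall>T\<in>\<T>. \<exists>\<R>\<subseteq>\<S>. T = \<Union>\<R>)"

primrec patch :: "(real ^ 'd) set set \<Rightarrow> nat \<Rightarrow> (real ^ 'd) set \<Rightarrow> (real ^ 'd) set" where
  "patch \<T> 0 S = S"
| "patch \<T> (Suc m) S =
     \<Union>{T \<in> \<T>. \<exists>k\<in>int_vecs. closure (patch \<T> m S) \<inter> translate k (closure T) \<noteq> {}}"

definition coarse_space :: "(real ^ 'd) set set \<Rightarrow> (real ^ 'd \<Rightarrow> real) set" where
  "coarse_space \<T> = H1_per0 \<inter> piecewise_Q 1 \<T>"

definition fe_space :: "(real ^ 'd) set set \<Rightarrow> (real ^ 'd \<Rightarrow> real) set \<Rightarrow> bool" where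
  "fe_space \<T> V \<longleftrightarrow> (\<exists>\<S> p \<gamma>. quad_mesh \<S> \<and> \<gamma> > 0 \<and> shape_regular \<gamma> \<S> \<and> refines \<S> \<T> \<and>
     V \<subseteq> H1_per0 \<inter> piecewise_Q p \<S> \<and> (\<lambda>x. 0) \<in> V \<and>
     (\<forall>u\<in>V. \<forall>v\<in>V. (\<lambda>x. u x + v x) \<in> V) \<and> (\<forall>s. \<forall>v\<in>V. (\<lambda>x. s * v x) \<in> V) \<and>
     (\<forall>u\<in>V. \<forall>v\<in>H1_per0. (AE x in lebesgue. u x = v x) \<longrightarrow> v \<in> V))"

definition ansatz_space :: "(real ^ 'd) set set \<Rightarrow> (real ^ 'd \<Rightarrow> real) set \<Rightarrow> bool" where
  "ansatz_space \<T> V \<longleftrightarrow> (V = H1_per0 \<or> fe_space \<T> V) \<and> coarse_space \<T> \<subseteq> V"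

text \<open>The first clause says that the map acts on almost-everywhere classes.\<close>

definition interpolation ::
  "(real ^ 'd) set set \<Rightarrow> (real ^ 'd \<Rightarrow> real) set \<Rightarrow> real \<Rightarrow>
   ((real ^ 'd \<Rightarrow> real) \<Rightarrow> (real ^ 'd \<Rightarrow> real)) \<Rightarrow> bool" where
  "interpolation \<T> V C\<^sub>I I \<longleftrightarrow>
     (\<forall>u\<in>V. \<forall>v\<in>V. (AE x in lebesgue. u x = v x) \<longrightarrow> (AE x in lebesgue. I u x = I v x)) \<and>
     (\<forall>v\<in>V. I v \<in> coarse_space \<T>) \<and>
     (\<forall>u\<in>V. \<forall>v\<in>V. AE x in lebesgue. I (\<lambda>y. u y + v y) x = I u x + I v x) \<and>
     (\<forall>s. \<forall>v\<in>V. AE x in lebesgue. I (\<lambda>y. s * v y) x = s * I v x) \<and>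
     (\<forall>v\<in>V. AE x in lebesgue. I (I v) x = I v x) \<and>
     (\<forall>v\<in>V. \<forall>T\<in>\<T>.
        L2_norm T (\<lambda>x. v x - I v x) / mesh_size \<T> + L2_norm T (weak_grad (I v))
          \<le> C\<^sub>I * L2_norm (patch \<T> 1 T) (weak_grad v))"

definition fine_space ::
  "(real ^ 'd \<Rightarrow> real) set \<Rightarrow> ((real ^ 'd \<Rightarrow> real) \<Rightarrow> (real ^ 'd \<Rightarrow> real)) \<Rightarrow>
   (real ^ 'd \<Rightarrow> real) set" where
  "fine_space V I = {v \<in> V. AE x in lebesgue. I v x = 0}"

definition fine_space_on ::
  "(real ^ 'd \<Rightarrow> real) set \<Rightarrow> ((real ^ 'd \<Rightarrow> real) \<Rightarrow> (real ^ 'd \<Rightarrow> real)) \<Rightarrow> (real ^ 'd) set \<Rightarrow>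
   (real ^ 'd \<Rightarrow> real) set" where
  "fine_space_on V I S = {v \<in> fine_space V I. AE x in lebesgue. x \<in> unit_cell - S \<longrightarrow> v x = 0}"

text \<open>The solution of the corrector problem is unique as an almost-everywhere class only, hence
  \<open>SOME\<close> instead of \<open>THE\<close>.\<close>

definition corrector ::
  "(real ^ 'd) set set \<Rightarrow> (real ^ 'd \<Rightarrow> real) set \<Rightarrow> ((real ^ 'd \<Rightarrow> real) \<Rightarrow> (real ^ 'd \<Rightarrow> real)) \<Rightarrow>
   nat \<Rightarrow> (real ^ 'd) set \<Rightarrow> (real ^ 'd \<Rightarrow> real) \<Rightarrow> (real ^ 'd \<Rightarrow> real) \<Rightarrow> (real ^ 'd \<Rightarrow> real)" where
  "corrector \<T> V I m T a v = (SOME \<phi>. \<phi> \<in> fine_space_on V I (patch \<T> m T) \<and>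
     (\<forall>w\<in>fine_space_on V I (patch \<T> m T).
        (LINT x:patch \<T> m T|lebesgue. a x * (weak_grad \<phi> x \<bullet> weak_grad w x))
          = (LINT x:T|lebesgue. a x * (weak_grad v x \<bullet> weak_grad w x))))"

definition elem_form ::
  "(real ^ 'd) set set \<Rightarrow> (real ^ 'd \<Rightarrow> real) set \<Rightarrow> ((real ^ 'd \<Rightarrow> real) \<Rightarrow> (real ^ 'd \<Rightarrow> real)) \<Rightarrow>
   nat \<Rightarrow> (real ^ 'd) set \<Rightarrow> (real ^ 'd \<Rightarrow> real) \<Rightarrow> (real ^ 'd \<Rightarrow> real) \<Rightarrow> (real ^ 'd \<Rightarrow> real) \<Rightarrow> real" where
  "elem_form \<T> V I m T a v w = (LINT x:patch \<T> m T|lebesgue.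
     a x * ((indicator T x *\<^sub>R weak_grad v x - weak_grad (corrector \<T> V I m T a v) x)
            \<bullet> weak_grad w x))"

definition exact_form ::
  "(real ^ 'd) set set \<Rightarrow> (real ^ 'd \<Rightarrow> real) set \<Rightarrow> ((real ^ 'd \<Rightarrow> real) \<Rightarrow> (real ^ 'd \<Rightarrow> real)) \<Rightarrow>
   nat \<Rightarrow> (real ^ 'd \<Rightarrow> real) \<Rightarrow> (real ^ 'd \<Rightarrow> real) \<Rightarrow> (real ^ 'd \<Rightarrow> real) \<Rightarrow> real" where
  "exact_form \<T> V I m A v w = (\<Sum>T\<in>\<T>. elem_form \<T> V I m T A v w)"

text \<open>\<open>Ac T i\<close> are the offline coefficients, \<open>\<mu> T i\<close> the weights, \<open>0 \<le> i \<le> N T\<close>.\<close>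

definition combined_form ::
  "(real ^ 'd) set set \<Rightarrow> (real ^ 'd \<Rightarrow> real) set \<Rightarrow> ((real ^ 'd \<Rightarrow> real) \<Rightarrow> (real ^ 'd \<Rightarrow> real)) \<Rightarrow>
   nat \<Rightarrow> ((real ^ 'd) set \<Rightarrow> nat) \<Rightarrow> ((real ^ 'd) set \<Rightarrow> nat \<Rightarrow> real) \<Rightarrow>
   ((real ^ 'd) set \<Rightarrow> nat \<Rightarrow> real ^ 'd \<Rightarrow> real) \<Rightarrow>
   (real ^ 'd \<Rightarrow> real) \<Rightarrow> (real ^ 'd \<Rightarrow> real) \<Rightarrow> real" where
  "combined_form \<T> V I m N \<mu> Ac v w =
     (\<Sum>T\<in>\<T>. \<Sum>i=0..N T. \<mu> T i * elem_form \<T> V I m T (Ac T i) v w)"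

definition admissible_coeff :: "(real ^ 'd \<Rightarrow> real) \<Rightarrow> bool" where
  "admissible_coeff A \<longleftrightarrow> A \<in> borel_measurable (lebesgue_on unit_cell) \<and>
     (\<exists>c>0. AE x in lebesgue_on unit_cell. c \<le> A x) \<and> (\<exists>M. AE x in lebesgue_on unit_cell. A x \<le> M)"

definition periodic_data ::
  "real \<Rightarrow> real \<Rightarrow> (real ^ 'd \<Rightarrow> real) \<Rightarrow> (real ^ 'd \<Rightarrow> real) \<Rightarrow> bool" where
  "periodic_data \<alpha> \<beta> Aper Bper \<longleftrightarrow> 0 < \<alpha> \<and> \<alpha> \<le> \<beta> \<and>
     Aper \<in> borel_measurable lebesgue \<and> Bper \<in> borel_measurable lebesgue \<and>
     ae_periodic Aper \<and> ae_periodic Bper \<and>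
     (AE x in lebesgue. \<alpha> \<le> Aper x \<and> Aper x \<le> \<beta>) \<and>
     (AE x in lebesgue. \<alpha> \<le> Aper x + Bper x \<and> Aper x + Bper x \<le> \<beta>)"

definition defect_set :: "real \<Rightarrow> (real ^ 'd) set \<Rightarrow> real ^ 'd \<Rightarrow> (real ^ 'd) set" where
  "defect_set \<epsilon> Q k = (\<lambda>q. \<epsilon> *\<^sub>R (k + q)) ` Q"

definition defect_sites ::
  "(real ^ 'd) set set \<Rightarrow> nat \<Rightarrow> real \<Rightarrow> (real ^ 'd) set \<Rightarrow> (real ^ 'd) set \<Rightarrow> (real ^ 'd) set" where
  "defect_sites \<T> m \<epsilon> Q T = {k \<in> int_vecs. defect_set \<epsilon> Q k \<subseteq> patch \<T> m T}"

definition offline_coeff ::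
  "real \<Rightarrow> (real ^ 'd \<Rightarrow> real) \<Rightarrow> (real ^ 'd \<Rightarrow> real) \<Rightarrow> (real ^ 'd) set \<Rightarrow>
   ((real ^ 'd) set \<Rightarrow> nat \<Rightarrow> real ^ 'd) \<Rightarrow> (real ^ 'd) set \<Rightarrow> nat \<Rightarrow> real ^ 'd \<Rightarrow> real" where
  "offline_coeff \<epsilon> Aper Bper Q \<sigma> T i x =
     (if i = 0 then Aper (x /\<^sub>R \<epsilon>)
      else Aper (x /\<^sub>R \<epsilon>) + indicator (defect_set \<epsilon> Q (\<sigma> T i)) x * Bper (x /\<^sub>R \<epsilon>))"

definition indicator_quotient ::
  "(real ^ 'd) set set \<Rightarrow> (real ^ 'd \<Rightarrow> real) set \<Rightarrow> ((real ^ 'd \<Rightarrow> real) \<Rightarrow> (real ^ 'd \<Rightarrow> real)) \<Rightarrow>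
   nat \<Rightarrow> (real ^ 'd \<Rightarrow> real) \<Rightarrow> nat \<Rightarrow> (nat \<Rightarrow> real) \<Rightarrow> (nat \<Rightarrow> real ^ 'd \<Rightarrow> real) \<Rightarrow>
   (real ^ 'd) set \<Rightarrow> (real ^ 'd \<Rightarrow> real) \<Rightarrow> real" where
  "indicator_quotient \<T> V I m A N \<mu> Ac T v =
     (L2_norm (patch \<T> m T) (\<lambda>x.
        ((sqrt (A x) - (\<Sum>i=0..N. \<mu> i * Ac i x) / sqrt (A x)) * indicator T x) *\<^sub>R weak_grad v x
        - (\<Sum>i=0..N. (\<mu> i * (sqrt (A x) - Ac i x / sqrt (A x)))
              *\<^sub>R weak_grad (corrector \<T> V I m T (Ac i) v) x)))\<^sup>2
     / (energy_norm A T v)\<^sup>2"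

text \<open>\<open>GREATEST\<close> is the maximum of the (infinite) set of quotients; a maximum over the empty set,
  which occurs only for degenerate coarse spaces, is read as 0.\<close>

definition error_indicator ::
  "(real ^ 'd) set set \<Rightarrow> (real ^ 'd \<Rightarrow> real) set \<Rightarrow> ((real ^ 'd \<Rightarrow> real) \<Rightarrow> (real ^ 'd \<Rightarrow> real)) \<Rightarrow>
   nat \<Rightarrow> (real ^ 'd \<Rightarrow> real) \<Rightarrow> nat \<Rightarrow> (nat \<Rightarrow> real) \<Rightarrow> (nat \<Rightarrow> real ^ 'd \<Rightarrow> real) \<Rightarrow>
   (real ^ 'd) set \<Rightarrow> real" where
  "error_indicator \<T> V I m A N \<mu> Ac T =
     (let quotients = indicator_quotient \<T> V I m A N \<mu> Ac T
                        ` {v \<in> coarse_space \<T>. energy_norm A T v \<noteq> 0}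
      in if quotients = {} then 0 else sqrt (GREATEST q. q \<in> quotients))"

end

theory Submission
  imports Defs
begin

text \<open>
  Fix an element \<open>T\<close> with patch \<open>U\<close> and coarse functions \<open>v\<close>, \<open>w\<close>. Let \<open>\<phi>\<close> and \<open>\<phi>\<^sub>i\<close> be the correctors of \<open>v\<close>
  for the coefficients \<open>A\<close> and \<open>A\<^sub>i\<close>, and let \<open>r\<close> be the field whose norm is the numerator in the
  definition of the error indicator. Since \<open>sqrt A * r\<close> contains no roots any more, a direct computation
  (\<open>residual_load_eq\<close>) gives, with \<open>z = \<phi> - (\<Sum>i. \<mu>\<^sub>i \<phi>\<^sub>i)\<close>, that the difference of the two element forms at
  \<open>(v, w)\<close> is \<open>\<integral>\<^sub>U A \<nabla>z \<bullet> \<nabla>w - \<integral>\<^sub>U sqrt A (r \<bullet> \<nabla>w)\<close>. The function \<open>z\<close> is itself a fine-scale function on the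
  patch, and the corrector equations say precisely that every element form vanishes there. Testing with
  \<open>w = z\<close> therefore bounds the energy norm of \<open>z\<close> by the norm of \<open>r\<close>, and the difference is at most
  \<open>2 E\<^sub>T\<close> times the energy norms of \<open>v\<close> on \<open>T\<close> and of \<open>w\<close> on \<open>U\<close> (\<open>element_error\<close>). The Cauchy-Schwarz
  inequality over the elements leaves the number of patches that contain a given point, which is at most
  a multiple of \<open>m ^ d\<close>, because translates of the corresponding elements are essentially disjoint and lie
  in a ball whose radius is \<open>m + 1\<close> element diameters (\<open>patch_overlap\<close>).

  Two facts that are implicit in the definitions need proof. First, the correctors exist
  (\<open>corrector_exists\<close>). In the full Sobolev space this is the Riesz representation theorem: on the
  kernel of the interpolation operator the interpolation estimate is a Poincare inequality, and
  completeness follows from pointwise limits of rapidly converging sequences together with the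
  fundamental lemma of the calculus of variations, which makes weak gradients unique and local. In a
  finite element space existence is linear algebra. Second, the maximum in the definition of \<open>E\<^sub>T\<close> is
  attained and bounds every quotient (\<open>error_indicator_bound\<close>): numerator and denominator are
  semidefinite quadratic forms on a finite-dimensional space, and the first vanishes wherever the
  second does.
\<close>

section \<open>Semidefinite forms on spaces of functions\<close>

text \<open>Every Cauchy-Schwarz inequality below is the statement that a nonnegative quadratic polynomial has
  nonpositive discriminant.\<close>

lemma discriminant_le:
  fixes F G X :: real
  assumes nn: "\<And>t. 0 \<le> F - 2 * t * X + t\<^sup>2 * G" and G: "0 \<le> G"
  shows "X\<^sup>2 \<le> F * G"
proof (cases "G = 0")
  case True
  have "X = 0"
  proof (rule ccontr)
    assume nz: "X \<noteq> 0"
    define t where "t = (F + 1) / (2 * X)"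
    have "t * X = (F + 1) / 2" using nz by (simp add: t_def)
    then show False using nn[of t] True by simp
  qed
  then show ?thesis by (simp add: True)
next
  case False
  then have p: "G > 0" using G by simp
  have "0 \<le> F - 2 * (X / G) * X + (X / G)\<^sup>2 * G" by (rule nn)
  also have "\<dots> = F - X\<^sup>2 / G" using p by (simp add: power2_eq_square field_simps)
  finally show ?thesis using p by (simp add: field_simps)
qed

text \<open>Functions are not identified when they agree almost everywhere, so that the forms below are only
  semidefinite.\<close>

locale psd_form =
  fixes W :: "('a \<Rightarrow> real) set" and B :: "('a \<Rightarrow> real) \<Rightarrow> ('a \<Rightarrow> real) \<Rightarrow> real"
  assumes zero_mem: "(\<lambda>x. 0) \<in> W"
    and add_mem: "u \<in> W \<Longrightarrow> v \<in> W \<Longrightarrow> (\<lambda>x. u x + v x) \<in> W"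
    and scale_mem: "v \<in> W \<Longrightarrow> (\<lambda>x. s * v x) \<in> W"
    and sym: "u \<in> W \<Longrightarrow> v \<in> W \<Longrightarrow> B u v = B v u"
    and add_left: "u \<in> W \<Longrightarrow> v \<in> W \<Longrightarrow> w \<in> W \<Longrightarrow> B (\<lambda>x. u x + v x) w = B u w + B v w"
    and scale_left: "v \<in> W \<Longrightarrow> w \<in> W \<Longrightarrow> B (\<lambda>x. s * v x) w = s * B v w"
    and nonneg: "v \<in> W \<Longrightarrow> 0 \<le> B v v"
begin

lemma diff_mem: "u \<in> W \<Longrightarrow> v \<in> W \<Longrightarrow> (\<lambda>x. u x - s * v x) \<in> W"
  using add_mem[of u "\<lambda>x. (- s) * v x"] scale_mem[of v "- s"] by simp

lemma diff_left:
  "u \<in> W \<Longrightarrow> v \<in> W \<Longrightarrow> w \<in> W \<Longrightarrow> B (\<lambda>x. u x - s * v x) w = B u w - s * B v w"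
  using add_left[of u "\<lambda>x. (- s) * v x" w] scale_mem[of v "- s"] scale_left[of v w "- s"] by simp

lemma diff_right:
  "u \<in> W \<Longrightarrow> v \<in> W \<Longrightarrow> w \<in> W \<Longrightarrow> B w (\<lambda>x. u x - s * v x) = B w u - s * B w v"
  by (simp add: diff_left diff_mem sym[of w])

lemma diff_diff:
  assumes "u \<in> W" "v \<in> W"
  shows "B (\<lambda>x. u x - s * v x) (\<lambda>x. u x - s * v x) = B u u - 2 * s * B u v + s\<^sup>2 * B v v"
proof -
  have "B (\<lambda>x. u x - s * v x) (\<lambda>x. u x - s * v x)
    = B u (\<lambda>x. u x - s * v x) - s * B v (\<lambda>x. u x - s * v x)"
    by (rule diff_left[OF assms diff_mem[OF assms]])
  also have "\<dots> = B u u - s * B u v - s * (B v u - s * B v v)"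
    by (simp add: diff_right assms)
  finally show ?thesis
    using sym[OF assms] by (simp add: algebra_simps power2_eq_square)
qed

lemma comb_mem:
  "finite F \<Longrightarrow> (\<And>i. i \<in> F \<Longrightarrow> e i \<in> W) \<Longrightarrow> (\<lambda>x. \<Sum>i\<in>F. c i * e i x) \<in> W"
proof (induction F rule: finite_induct)
  case (insert i F)
  have "(\<lambda>x. c i * e i x + (\<Sum>i\<in>F. c i * e i x)) \<in> W"
    by (rule add_mem[OF scale_mem insert.IH]) (use insert.prems in auto)
  then show ?case using insert by simp
qed (simp add: zero_mem)

lemma zero_left: "w \<in> W \<Longrightarrow> B (\<lambda>x. 0) w = 0"
  using scale_left[OF zero_mem, of w 0] by simp

lemma comb_left:
  "finite F \<Longrightarrow> (\<And>i. i \<in> F \<Longrightarrow> e i \<in> W) \<Longrightarrow> w \<in> W \<Longrightarrow>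
     B (\<lambda>x. \<Sum>i\<in>F. c i * e i x) w = (\<Sum>i\<in>F. c i * B (e i) w)"
proof (induction F rule: finite_induct)
  case empty
  then show ?case by (simp add: zero_left)
next
  case (insert i F)
  have "B (\<lambda>x. c i * e i x + (\<Sum>i\<in>F. c i * e i x)) w
      = B (\<lambda>x. c i * e i x) w + B (\<lambda>x. \<Sum>i\<in>F. c i * e i x) w"
    using insert by (intro add_left scale_mem comb_mem) auto
  then show ?case using insert by (simp add: scale_left)
qed

lemma Cauchy_Schwarz:
  assumes "u \<in> W" "v \<in> W"
  shows "(B u v)\<^sup>2 \<le> B u u * B v v"
proof (rule discriminant_le)
  show "0 \<le> B u u - 2 * t * B u v + t\<^sup>2 * B v v" for t
    using nonneg[OF diff_mem[OF assms, of t]] diff_diff[OF assms, of t] by linarith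
qed (rule nonneg[OF assms(2)])

lemma null_left: "u \<in> W \<Longrightarrow> v \<in> W \<Longrightarrow> B u u = 0 \<Longrightarrow> B u v = 0"
  using Cauchy_Schwarz[of u v] by simp

lemma null_diff:
  "u \<in> W \<Longrightarrow> v \<in> W \<Longrightarrow> B u u = 0 \<Longrightarrow> B v v = 0 \<Longrightarrow>
     B (\<lambda>x. u x - s * v x) (\<lambda>x. u x - s * v x) = 0"
  by (simp add: diff_diff null_left)

lemma sqrt_triangle:
  assumes "u \<in> W" "v \<in> W"
  shows "sqrt (B (\<lambda>x. u x + v x) (\<lambda>x. u x + v x)) \<le> sqrt (B u u) + sqrt (B v v)"
proof (rule real_le_lsqrt)
  show "0 \<le> sqrt (B u u) + sqrt (B v v)" by (simp add: assms nonneg)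
  have "B u v \<le> sqrt (B u u) * sqrt (B v v)"
    using Cauchy_Schwarz[OF assms] by (metis real_le_rsqrt real_sqrt_mult)
  moreover have "B (\<lambda>x. u x + v x) (\<lambda>x. u x + v x) = B u u + 2 * B u v + B v v"
    using diff_diff[OF assms, of "-1"] by simp
  ultimately show "B (\<lambda>x. u x + v x) (\<lambda>x. u x + v x) \<le> (sqrt (B u u) + sqrt (B v v))\<^sup>2"
    by (simp add: power2_sum nonneg assms)
qed

lemma sqrt_scale:
  assumes "v \<in> W"
  shows "sqrt (B (\<lambda>x. s * v x) (\<lambda>x. s * v x)) = \<bar>s\<bar> * sqrt (B v v)"
proof -
  have "B (\<lambda>x. s * v x) (\<lambda>x. s * v x) = s\<^sup>2 * B v v"
    using assms sym[of "\<lambda>x. s * v x" v] by (simp add: scale_left scale_mem power2_eq_square)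
  then show ?thesis by (simp add: real_sqrt_mult)
qed

lemma sqrt_comb:
  "finite F \<Longrightarrow> (\<And>i. i \<in> F \<Longrightarrow> e i \<in> W) \<Longrightarrow>
     sqrt (B (\<lambda>x. \<Sum>i\<in>F. c i * e i x) (\<lambda>x. \<Sum>i\<in>F. c i * e i x))
       \<le> (\<Sum>i\<in>F. \<bar>c i\<bar> * sqrt (B (e i) (e i)))"
proof (induction F rule: finite_induct)
  case empty
  then show ?case using zero_left[OF zero_mem] by simp
next
  case (insert i F)
  have "sqrt (B (\<lambda>x. c i * e i x + (\<Sum>i\<in>F. c i * e i x)) (\<lambda>x. c i * e i x + (\<Sum>i\<in>F. c i * e i x)))
      \<le> sqrt (B (\<lambda>x. c i * e i x) (\<lambda>x. c i * e i x))
        + sqrt (B (\<lambda>x. \<Sum>i\<in>F. c i * e i x) (\<lambda>x. \<Sum>i\<in>F. c i * e i x))"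
    using insert by (intro sqrt_triangle scale_mem comb_mem) auto
  then show ?case using insert sqrt_scale[of "e i" "c i"] by simp
qed

lemma subspace:
  assumes "W' \<subseteq> W" "(\<lambda>x. 0) \<in> W'"
    "\<And>u v. u \<in> W' \<Longrightarrow> v \<in> W' \<Longrightarrow> (\<lambda>x. u x + v x) \<in> W'"
    "\<And>s v. v \<in> W' \<Longrightarrow> (\<lambda>x. s * v x) \<in> W'"
  shows "psd_form W' B"
proof unfold_locales
  have *: "\<And>v. v \<in> W' \<Longrightarrow> v \<in> W" using assms(1) by blast
  show "B u v = B v u" if "u \<in> W'" "v \<in> W'" for u v
    by (rule sym[OF that[THEN *]])
  show "B (\<lambda>x. u x + v x) w = B u w + B v w" if "u \<in> W'" "v \<in> W'" "w \<in> W'" for u v w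
    by (rule add_left[OF that[THEN *]])
  show "B (\<lambda>x. s * v x) w = s * B v w" if "v \<in> W'" "w \<in> W'" for s v w
    by (rule scale_left[OF that[THEN *]])
  show "0 \<le> B v v" if "v \<in> W'" for v
    by (rule nonneg[OF that[THEN *]])
qed (rule assms; assumption)+

end

text \<open>Finite dimension modulo null sets. The spanning functions need not belong to the space under
  consideration, so that all subspaces inherit the property.\<close>

definition ae_span :: "'a measure \<Rightarrow> ('i \<Rightarrow> 'a \<Rightarrow> real) \<Rightarrow> 'i set \<Rightarrow> ('a \<Rightarrow> real) set" where
  "ae_span M p F = {w. \<exists>c. AE x in M. w x = (\<Sum>i\<in>F. c i * p i x)}"

lemma ae_span_zero: "(\<lambda>x. 0) \<in> ae_span M p F"
  unfolding ae_span_def by (rule CollectI, rule exI[of _ "\<lambda>_. 0"]) simp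

lemma ae_span_add:
  assumes "u \<in> ae_span M p F" "v \<in> ae_span M p F"
  shows "(\<lambda>x. u x + v x) \<in> ae_span M p F"
proof -
  obtain c d where "AE x in M. u x = (\<Sum>i\<in>F. c i * p i x)" "AE x in M. v x = (\<Sum>i\<in>F. d i * p i x)"
    using assms by (auto simp: ae_span_def)
  then have "AE x in M. u x + v x = (\<Sum>i\<in>F. (c i + d i) * p i x)"
    by eventually_elim (simp add: sum.distrib algebra_simps)
  then show ?thesis by (auto simp: ae_span_def intro!: exI[of _ "\<lambda>i. c i + d i"])
qed

lemma ae_span_scale:
  assumes "v \<in> ae_span M p F"
  shows "(\<lambda>x. s * v x) \<in> ae_span M p F"
proof -
  obtain c where "AE x in M. v x = (\<Sum>i\<in>F. c i * p i x)"
    using assms by (auto simp: ae_span_def)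
  then have "AE x in M. s * v x = (\<Sum>i\<in>F. (s * c i) * p i x)"
    by eventually_elim (simp add: sum_distrib_left algebra_simps)
  then show ?thesis by (auto simp: ae_span_def intro!: exI[of _ "\<lambda>i. s * c i"])
qed

text \<open>Vectors of length zero are invisible to the form, hence expansions hold up to such vectors only.\<close>

definition (in psd_form) orthonormal_basis :: "(nat \<Rightarrow> 'a \<Rightarrow> real) \<Rightarrow> nat \<Rightarrow> bool" where
  "orthonormal_basis e k \<longleftrightarrow> (\<forall>i<k. e i \<in> W) \<and>
     (\<forall>i<k. \<forall>j<k. B (e i) (e j) = (if i = j then 1 else 0)) \<and>
     (\<forall>v\<in>W. \<exists>c. B (\<lambda>x. v x - (\<Sum>i<k. c i * e i x)) (\<lambda>x. v x - (\<Sum>i<k. c i * e i x)) = 0)"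

lemma (in psd_form) basis_coeff:
  assumes e: "orthonormal_basis e k" and v: "v \<in> W" and i: "i < k"
    and c: "B (\<lambda>x. v x - (\<Sum>i<k. c i * e i x)) (\<lambda>x. v x - (\<Sum>i<k. c i * e i x)) = 0"
  shows "B v (e i) = c i"
proof -
  have eW: "\<And>j. j < k \<Longrightarrow> e j \<in> W" using e by (auto simp: orthonormal_basis_def)
  have S: "(\<lambda>x. \<Sum>i<k. c i * e i x) \<in> W" using eW by (intro comb_mem) auto
  have "0 = B (\<lambda>x. v x - 1 * (\<Sum>i<k. c i * e i x)) (e i)"
    using null_left[OF diff_mem[OF v S, of 1] eW[OF i]] c by simp
  also have "\<dots> = B v (e i) - (\<Sum>j<k. c j * B (e j) (e i))"
    using diff_left[OF v S eW[OF i], of 1] comb_left[of "{..<k}" e "e i" c] eW i by simp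
  also have "(\<Sum>j<k. c j * B (e j) (e i)) = (\<Sum>j<k. if j = i then c j else 0)"
    using e i by (intro sum.cong) (auto simp: orthonormal_basis_def)
  also have "\<dots> = c i" using i by simp
  finally show ?thesis by simp
qed

text \<open>Gram-Schmidt, by induction on the number of spanning functions. If some \<open>b\<close> in the space involves the
  function \<open>p i\<close>, then every element becomes free of \<open>p i\<close> after subtraction of a multiple of \<open>b\<close>, so that
  \<open>b\<close> and the smaller space generate everything. The part of \<open>b\<close> that is orthogonal to the basis of the smaller
  space is either null or, normalised, the missing basis vector.\<close>

lemma orthonormal_basis_exists:
  assumes "finite F" and "psd_form W B" and "W \<subseteq> ae_span M p F"
    and "\<And>w. w \<in> W \<Longrightarrow> (AE x in M. w x = 0) \<Longrightarrow> B w w = 0"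
  shows "\<exists>e k. psd_form.orthonormal_basis W B e k"
  using assms
proof (induction F arbitrary: W rule: finite_induct)
  case empty
  interpret psd_form W B by fact
  have "orthonormal_basis (\<lambda>_ _. 0) 0"
    using empty by (auto simp: orthonormal_basis_def ae_span_def)
  then show ?case by blast
next
  case (insert i F)
  interpret psd_form W B by fact
  show ?case
  proof (cases "W \<subseteq> ae_span M p F")
    case True
    then show ?thesis using insert by blast
  next
    case False
    then obtain b where b: "b \<in> W" "b \<notin> ae_span M p F" by blast
    obtain cb where cb: "AE x in M. b x = (\<Sum>j\<in>insert i F. cb j * p j x)"
      using b(1) insert.prems(2) by (auto simp: ae_span_def)
    have cbi: "cb i \<noteq> 0"
    proof
      assume "cb i = 0"
      then have "AE x in M. b x = (\<Sum>j\<in>F. cb j * p j x)"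
        using cb insert.hyps by simp
      then show False using b(2) by (auto simp: ae_span_def)
    qed
    define W' where "W' = W \<inter> ae_span M p F"
    have W': "psd_form W' B"
      unfolding W'_def
      by (rule subspace) (simp_all add: zero_mem add_mem scale_mem ae_span_zero ae_span_add ae_span_scale)
    obtain e k where "psd_form.orthonormal_basis W' B e k"
      using insert.IH[OF W'] insert.prems(3) by (auto simp: W'_def)
    note ek = this[unfolded psd_form.orthonormal_basis_def[OF W']]
    have eW': "\<And>j. j < k \<Longrightarrow> e j \<in> W'" and eW: "\<And>j. j < k \<Longrightarrow> e j \<in> W"
      and on: "\<And>j l. j < k \<Longrightarrow> l < k \<Longrightarrow> B (e j) (e l) = (if j = l then 1 else 0)"
      using ek by (auto simp: W'_def)
    define P where "P = (\<lambda>x. \<Sum>j<k. B b (e j) * e j x)"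
    have PW': "P \<in> W'"
      unfolding P_def by (rule psd_form.comb_mem[OF W']) (auto intro: eW')
    then have PW: "P \<in> W" by (simp add: W'_def)
    define b' where "b' = (\<lambda>x. b x - 1 * P x)"
    have b'W: "b' \<in> W" unfolding b'_def using diff_mem[OF b(1) PW] .
    have orth: "B b' (e j) = 0" if "j < k" for j
    proof -
      have "B b' (e j) = B b (e j) - B P (e j)"
        unfolding b'_def using diff_left[OF b(1) PW eW[OF that], of 1] by simp
      also have "B P (e j) = (\<Sum>l<k. B b (e l) * B (e l) (e j))"
        unfolding P_def by (rule comb_left) (auto intro: eW that)
      also have "\<dots> = (\<Sum>l<k. if l = j then B b (e l) else 0)"
        using on that by (intro sum.cong) auto
      also have "\<dots> = B b (e j)" using that by simp
      finally show ?thesis by simp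
    qed
    have decomp: "\<exists>s c. (\<lambda>x. v x - s * b' x - (\<Sum>j<k. c j * e j x)) \<in> W \<and>
       B (\<lambda>x. v x - s * b' x - (\<Sum>j<k. c j * e j x)) (\<lambda>x. v x - s * b' x - (\<Sum>j<k. c j * e j x)) = 0"
      if v: "v \<in> W" for v
    proof -
      obtain cv where cv: "AE x in M. v x = (\<Sum>j\<in>insert i F. cv j * p j x)"
        using v insert.prems(2) by (auto simp: ae_span_def)
      \<comment> \<open>the multiple of \<open>b\<close> that eliminates \<open>p i\<close>\<close>
      define s where "s = cv i / cb i"
      have "AE x in M. v x - s * b x = (\<Sum>j\<in>F. (cv j - s * cb j) * p j x)"
        using cv cb
      proof eventually_elim
        case (elim x)
        then show ?case using insert.hyps cbi
          by (simp add: s_def sum_subtractf sum_distrib_left algebra_simps)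
      qed
      then have "(\<lambda>x. v x - s * b x) \<in> W'"
        using diff_mem[OF v b(1)]
        by (auto simp: W'_def ae_span_def intro!: exI[of _ "\<lambda>j. cv j - s * cb j"])
      then have "(\<lambda>x. (v x - s * b x) + s * P x) \<in> W'"
        by (rule psd_form.add_mem[OF W' _ psd_form.scale_mem[OF W' PW']])
      then have vW': "(\<lambda>x. v x - s * b' x) \<in> W'"
        by (simp add: b'_def algebra_simps)
      then obtain c where c: "B (\<lambda>x. (v x - s * b' x) - (\<Sum>j<k. c j * e j x))
           (\<lambda>x. (v x - s * b' x) - (\<Sum>j<k. c j * e j x)) = 0"
        using ek by auto
      have "(\<lambda>x. \<Sum>j<k. c j * e j x) \<in> W" using eW by (intro comb_mem) auto
      then have "(\<lambda>x. (v x - s * b' x) - 1 * (\<Sum>j<k. c j * e j x)) \<in> W"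
        by (intro diff_mem[of "\<lambda>x. v x - s * b' x"]) (use vW' in \<open>simp_all add: W'_def\<close>)
      then show ?thesis using c by (intro exI[of _ s] exI[of _ c]) simp
    qed
    show ?thesis
    proof (cases "B b' b' = 0")
      case True
      have "orthonormal_basis e k"
        unfolding orthonormal_basis_def
      proof (intro conjI allI impI ballI)
        fix v assume "v \<in> W"
        then obtain s c where sc: "(\<lambda>x. v x - s * b' x - (\<Sum>j<k. c j * e j x)) \<in> W"
           "B (\<lambda>x. v x - s * b' x - (\<Sum>j<k. c j * e j x)) (\<lambda>x. v x - s * b' x - (\<Sum>j<k. c j * e j x)) = 0"
          using decomp by blast
        from null_diff[OF sc(1) b'W sc(2) True, of "-s"]
        show "\<exists>c. B (\<lambda>x. v x - (\<Sum>i<k. c i * e i x)) (\<lambda>x. v x - (\<Sum>i<k. c i * e i x)) = 0"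
          by (intro exI[of _ c]) (simp add: algebra_simps)
      qed (auto simp: eW on)
      then show ?thesis by blast
    next
      case False
      then have bp: "B b' b' > 0" using nonneg[OF b'W] by simp
      define r where "r = sqrt (B b' b')"
      have r: "r > 0" "r * r = B b' b'" using bp by (auto simp: r_def)
      define e' where "e' = e(k := (\<lambda>x. inverse r * b' x))"
      have e'k: "e' k = (\<lambda>x. inverse r * b' x)" and e'j: "\<And>j. j < k \<Longrightarrow> e' j = e j"
        by (auto simp: e'_def)
      have e'kW: "e' k \<in> W" unfolding e'k using scale_mem[OF b'W] .
      have o1: "B (e' k) (e j) = 0" if "j < k" for j
        unfolding e'k using scale_left[OF b'W eW[OF that]] orth[OF that] by simp
      have o2: "B (e j) (e' k) = 0" if "j < k" for j
        using o1[OF that] sym[OF e'kW eW[OF that]] by simp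
      have "B b' (e' k) = inverse r * B b' b'"
        using scale_left[OF b'W b'W, of "inverse r"] sym[OF b'W e'kW] by (simp add: e'k)
      moreover have "B (e' k) (e' k) = inverse r * B b' (e' k)"
        using scale_left[OF b'W e'kW, of "inverse r"] by (simp only: e'k[symmetric])
      ultimately have "B (e' k) (e' k) = inverse r * (inverse r * (r * r))"
        by (simp only: r(2))
      then have o3: "B (e' k) (e' k) = 1" using r(1) by (simp add: field_simps)
      have "orthonormal_basis e' (Suc k)"
        unfolding orthonormal_basis_def
      proof (intro conjI allI impI ballI)
        show "e' j \<in> W" if "j < Suc k" for j
          using that e'kW eW e'j by (auto simp: less_Suc_eq)
        show "B (e' j) (e' l) = (if j = l then 1 else 0)" if "j < Suc k" "l < Suc k" for j l
          using that o1 o2 o3 on e'j by (auto simp: less_Suc_eq)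
        fix v assume "v \<in> W"
        then obtain s c where sc:
           "B (\<lambda>x. v x - s * b' x - (\<Sum>j<k. c j * e j x)) (\<lambda>x. v x - s * b' x - (\<Sum>j<k. c j * e j x)) = 0"
          using decomp by blast
        define c' where "c' = c(k := s * r)"
        have "(\<Sum>j<Suc k. c' j * e' j x) = (\<Sum>j<k. c j * e j x) + s * b' x" for x
          using r(1) by (simp add: c'_def e'_def)
        then show "\<exists>c. B (\<lambda>x. v x - (\<Sum>j<Suc k. c j * e' j x)) (\<lambda>x. v x - (\<Sum>j<Suc k. c j * e' j x)) = 0"
          using sc by (intro exI[of _ c']) (simp add: algebra_simps)
      qed
      then show ?thesis by blast
    qed
  qed
qed

text \<open>A functional is represented by the vector whose coordinates are its values on an orthonormal basis.\<close>

lemma (in psd_form) Galerkin_solution: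
  assumes e: "orthonormal_basis e k"
    and L: "\<And>u v. u \<in> W \<Longrightarrow> v \<in> W \<Longrightarrow> L (\<lambda>x. u x + v x) = L u + L v"
      "\<And>s v. v \<in> W \<Longrightarrow> L (\<lambda>x. s * v x) = s * L v"
      "\<And>v. v \<in> W \<Longrightarrow> B v v = 0 \<Longrightarrow> L v = (0::real)"
  shows "\<exists>\<phi>\<in>W. \<forall>w\<in>W. B \<phi> w = L w"
proof (intro bexI ballI)
  have eW: "\<And>j. j < k \<Longrightarrow> e j \<in> W" using e by (auto simp: orthonormal_basis_def)
  have Lcomb: "L (\<lambda>x. \<Sum>i\<in>F. c i * e i x) = (\<Sum>i\<in>F. c i * L (e i))"
    if "finite F" "F \<subseteq> {..<k}" for F and c :: "nat \<Rightarrow> real"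
    using that
  proof (induction F rule: finite_induct)
    case empty
    then show ?case using L(2)[OF zero_mem, of 0] by simp
  next
    case (insert i F)
    have "L (\<lambda>x. c i * e i x + (\<Sum>i\<in>F. c i * e i x))
      = L (\<lambda>x. c i * e i x) + L (\<lambda>x. \<Sum>i\<in>F. c i * e i x)"
      using insert by (intro L(1) scale_mem comb_mem eW) auto
    then show ?case using insert L(2)[OF eW] by simp
  qed
  let ?\<phi> = "\<lambda>x. \<Sum>i<k. L (e i) * e i x"
  show "?\<phi> \<in> W" using eW by (intro comb_mem) auto
  fix w assume w: "w \<in> W"
  obtain c where c: "B (\<lambda>x. w x - (\<Sum>i<k. c i * e i x)) (\<lambda>x. w x - (\<Sum>i<k. c i * e i x)) = 0"
    using e w by (auto simp: orthonormal_basis_def)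
  have S: "(\<lambda>x. \<Sum>i<k. c i * e i x) \<in> W" using eW by (intro comb_mem) auto
  have D: "(\<lambda>x. w x - (\<Sum>i<k. c i * e i x)) \<in> W"
    using diff_mem[OF w S, of 1] by simp
  have "L w = L (\<lambda>x. w x - (\<Sum>i<k. c i * e i x)) + L (\<lambda>x. \<Sum>i<k. c i * e i x)"
    using L(1)[OF D S] by simp
  also have "\<dots> = (\<Sum>i<k. c i * L (e i))"
    using L(3)[OF D c] Lcomb[of "{..<k}" c] by simp
  also have "\<dots> = (\<Sum>i<k. L (e i) * B (e i) w)"
    using basis_coeff[OF e w _ c] sym[OF w eW] by (intro sum.cong) (auto simp: mult.commute)
  also have "\<dots> = B ?\<phi> w"
    using comb_left[of "{..<k}" e w "\<lambda>i. L (e i)"] eW w by simp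
  finally show "B ?\<phi> w = L w" by simp
qed

text \<open>The norm comparison on finite-dimensional spaces, in a form that tolerates null vectors.\<close>

lemma dominated_form:
  assumes P: "psd_form W P" and B: "psd_form W B" and e: "psd_form.orthonormal_basis W B e k"
    and null: "\<And>v. v \<in> W \<Longrightarrow> B v v = 0 \<Longrightarrow> P v v = 0"
  shows "\<exists>K>0. \<forall>v\<in>W. P v v \<le> K * B v v"
proof -
  interpret P: psd_form W P by fact
  interpret B: psd_form W B by fact
  have eW: "\<And>j. j < k \<Longrightarrow> e j \<in> W"
    and on: "\<And>j l. j < k \<Longrightarrow> l < k \<Longrightarrow> B (e j) (e l) = (if j = l then 1 else 0)"
    using e by (auto simp: B.orthonormal_basis_def)
  define K where "K = (\<Sum>i<k. sqrt (P (e i) (e i)))\<^sup>2 + 1"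
  have "P v v \<le> K * B v v" if v: "v \<in> W" for v
  proof -
    obtain c where c: "B (\<lambda>x. v x - (\<Sum>i<k. c i * e i x)) (\<lambda>x. v x - (\<Sum>i<k. c i * e i x)) = 0"
      using e v by (auto simp: B.orthonormal_basis_def)
    let ?S = "\<lambda>x. \<Sum>i<k. c i * e i x"
    have S: "?S \<in> W" using eW by (intro B.comb_mem) auto
    have D: "(\<lambda>x. v x - ?S x) \<in> W" using B.diff_mem[OF v S, of 1] by simp
    have "sqrt (P v v) \<le> sqrt (P (\<lambda>x. v x - ?S x) (\<lambda>x. v x - ?S x)) + sqrt (P ?S ?S)"
      using P.sqrt_triangle[OF D S] by simp
    also have "\<dots> \<le> (\<Sum>i<k. \<bar>c i\<bar> * sqrt (P (e i) (e i)))"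
      using null[OF D c] P.sqrt_comb[of "{..<k}" e c] eW by simp
    also have "\<dots> \<le> (\<Sum>i<k. sqrt (B v v) * sqrt (P (e i) (e i)))"
    proof (intro sum_mono mult_right_mono)
      fix i assume "i \<in> {..<k}"
      then have i: "i < k" by simp
      have "(c i)\<^sup>2 \<le> B v v"
        using B.Cauchy_Schwarz[OF v eW[OF i]] B.basis_coeff[OF e v i c] on[OF i i] by simp
      then show "\<bar>c i\<bar> \<le> sqrt (B v v)" using real_sqrt_le_mono by fastforce
    qed (auto intro: P.nonneg eW)
    also have "\<dots> = sqrt (B v v) * (\<Sum>i<k. sqrt (P (e i) (e i)))" by (simp add: sum_distrib_left)
    finally have "(sqrt (P v v))\<^sup>2 \<le> (sqrt (B v v) * (\<Sum>i<k. sqrt (P (e i) (e i))))\<^sup>2"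
      using P.nonneg[OF v] by (intro power_mono) auto
    then show ?thesis
      using P.nonneg[OF v] B.nonneg[OF v] by (simp add: K_def power_mult_distrib algebra_simps)
  qed
  moreover have "K > 0" unfolding K_def by (smt (verit) zero_le_power2)
  ultimately show ?thesis by blast
qed

text \<open>If the supremum \<open>lam\<close> of the quotients were not attained, then \<open>lam P - Q\<close> would be semidefinite and
  vanish only where \<open>P\<close> does. By comparison of norms it would dominate a positive multiple of \<open>P\<close>, which
  bounds all quotients by a number smaller than \<open>lam\<close>.\<close>

lemma Rayleigh_quotient_attains_max:
  fixes p :: "'i \<Rightarrow> 'a \<Rightarrow> real"
  assumes P: "psd_form W P" and Q: "psd_form W Q"
    and fin: "finite F" "W \<subseteq> ae_span M p F"
    and nullP: "\<And>w. w \<in> W \<Longrightarrow> (AE x in M. w x = 0) \<Longrightarrow> P w w = 0"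
    and nullQ: "\<And>w. w \<in> W \<Longrightarrow> P w w = 0 \<Longrightarrow> Q w w = 0"
    and ne: "v\<^sub>0 \<in> W" "P v\<^sub>0 v\<^sub>0 \<noteq> 0"
  shows "\<exists>v\<in>W. P v v \<noteq> 0 \<and> (\<forall>w\<in>W. P w w \<noteq> 0 \<longrightarrow> Q w w / P w w \<le> Q v v / P v v)"
proof (rule ccontr)
  assume no: "\<not> ?thesis"
  interpret P: psd_form W P by fact
  interpret Q: psd_form W Q by fact
  obtain e k where "P.orthonormal_basis e k"
    using orthonormal_basis_exists[OF fin(1) P fin(2) nullP] by blast
  from dominated_form[OF Q P this nullQ]
  obtain K where K: "\<And>v. v \<in> W \<Longrightarrow> Q v v \<le> K * P v v" by blast
  define R where "R = (\<lambda>v. Q v v / P v v) ` {v \<in> W. P v v \<noteq> 0}"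
  define lam where "lam = Sup R"
  have R: "R \<noteq> {}" "bdd_above R"
  proof -
    show "R \<noteq> {}" using ne by (auto simp: R_def)
    show "bdd_above R"
      unfolding R_def
    proof (rule bdd_aboveI2)
      fix v assume "v \<in> {v \<in> W. P v v \<noteq> 0}"
      then have v: "v \<in> W" "P v v > 0" using P.nonneg[of v] by auto
      show "Q v v / P v v \<le> K" using K[OF v(1)] v(2) by (simp add: field_simps)
    qed
  qed
  have le: "Q v v \<le> lam * P v v" if v: "v \<in> W" for v
  proof (cases "P v v = 0")
    case True
    then show ?thesis using nullQ v by simp
  next
    case False
    then have "Q v v / P v v \<le> lam"
      unfolding lam_def using v R by (intro cSup_upper) (auto simp: R_def)
    moreover have "P v v > 0" using False P.nonneg[OF v] by simp
    ultimately show ?thesis by (simp add: field_simps)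
  qed
  have lt: "Q v v \<noteq> lam * P v v" if v: "v \<in> W" "P v v \<noteq> 0" for v
  proof
    assume "Q v v = lam * P v v"
    then have "Q v v / P v v = lam" using v by simp
    moreover have "Q w w / P w w \<le> lam" if "w \<in> W" "P w w \<noteq> 0" for w
      unfolding lam_def using that R by (intro cSup_upper) (auto simp: R_def)
    ultimately show False using no v by auto
  qed
  define B where "B = (\<lambda>u v. lam * P u v - Q u v)"
  have B: "psd_form W B"
  proof unfold_locales
    show "0 \<le> B v v" if "v \<in> W" for v using le[OF that] by (simp add: B_def)
    show "B u v = B v u" if "u \<in> W" "v \<in> W" for u v
      using P.sym[OF that] Q.sym[OF that] by (simp add: B_def)
  qed (simp_all add: B_def P.zero_mem P.add_mem P.scale_mem P.add_left P.scale_left Q.add_left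
        Q.scale_left algebra_simps)
  have nullB: "P v v = 0" if "v \<in> W" "B v v = 0" for v
    using lt[OF that(1)] that by (auto simp: B_def)
  have "\<And>w. w \<in> W \<Longrightarrow> AE x in M. w x = 0 \<Longrightarrow> B w w = 0"
    by (simp add: B_def nullP nullQ)
  from orthonormal_basis_exists[OF fin(1) B fin(2) this]
  obtain e k where "psd_form.orthonormal_basis W B e k" by blast
  from dominated_form[OF P B this nullB]
  obtain K' where K': "K' > 0" "\<And>v. v \<in> W \<Longrightarrow> P v v \<le> K' * B v v" by blast
  have "r \<le> lam - inverse K'" if "r \<in> R" for r
  proof -
    obtain v where v: "v \<in> W" "P v v \<noteq> 0" "r = Q v v / P v v" using \<open>r \<in> R\<close> by (auto simp: R_def)
    have p: "P v v > 0" using v P.nonneg[of v] by simp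
    have "P v v \<le> K' * (lam * P v v - Q v v)" using K'(2)[OF v(1)] by (simp add: B_def)
    then have "inverse K' * P v v \<le> lam * P v v - Q v v" using K'(1) by (simp add: field_simps)
    then have "r * P v v \<le> (lam - inverse K') * P v v" using p v(3) by (simp add: algebra_simps)
    then show ?thesis using p by (rule mult_right_le_imp_le)
  qed
  then have "lam \<le> lam - inverse K'" unfolding lam_def using R(1) by (intro cSup_least) auto
  then show False using K'(1) by simp
qed

text \<open>The solution minimises \<open>J v = B v v - 2 L v\<close>. The parallelogram law turns the rate at which a minimising
  sequence approaches the infimum into a Cauchy rate, hence completeness is needed only for sequences
  whose increments decay geometrically; such sequences of functions converge pointwise almost everywhere.\<close>

lemma (in psd_form) Riesz_solution:
  assumes complete: "\<And>w. (\<And>n. w n \<in> W) \<Longrightarrow>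
      (\<And>n. B (\<lambda>x. w (Suc n) x - w n x) (\<lambda>x. w (Suc n) x - w n x) \<le> (1/4) ^ n) \<Longrightarrow>
      \<exists>u\<in>W. (\<lambda>n. B (\<lambda>x. w n x - u x) (\<lambda>x. w n x - u x)) \<longlonglongrightarrow> 0"
    and L: "\<And>u v. u \<in> W \<Longrightarrow> v \<in> W \<Longrightarrow> L (\<lambda>x. u x + v x) = L u + L v"
      "\<And>s v. v \<in> W \<Longrightarrow> L (\<lambda>x. s * v x) = s * L v"
      "\<And>v. v \<in> W \<Longrightarrow> \<bar>L v\<bar> \<le> K * sqrt (B v v)"
  shows "\<exists>\<phi>\<in>W. \<forall>w\<in>W. B \<phi> w = L w"
proof -
  define J where "J = (\<lambda>v. B v v - 2 * L v)"
  have Ldiff: "L (\<lambda>x. u x - s * v x) = L u - s * L v" if "u \<in> W" "v \<in> W" for u v s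
    using L(1)[OF that(1) scale_mem[OF that(2), of "-s"]] L(2)[OF that(2), of "-s"] by simp
  have lower: "- (K\<^sup>2) \<le> J v" if v: "v \<in> W" for v
  proof -
    have "2 * L v \<le> 2 * K * sqrt (B v v)" using L(3)[OF v] by auto
    moreover have "0 \<le> (K - sqrt (B v v))\<^sup>2" by simp
    ultimately show ?thesis
      using nonneg[OF v] by (simp add: J_def power2_diff algebra_simps)
  qed
  define j where "j = Inf (J ` W)"
  have bdd: "bdd_below (J ` W)" using lower by (intro bdd_belowI2)
  have jle: "j \<le> J v" if "v \<in> W" for v
    unfolding j_def using bdd that by (intro cInf_lower) auto
  have ex: "\<exists>v\<in>W. J v \<le> j + \<delta>" if "\<delta> > 0" for \<delta>
  proof -
    have "J ` W \<noteq> {}" using zero_mem by auto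
    moreover have "Inf (J ` W) < j + \<delta>" using that by (simp add: j_def)
    ultimately have "\<exists>y\<in>J ` W. y < j + \<delta>" by (rule cInf_lessD)
    then show ?thesis by force
  qed
  \<comment> \<open>the parallelogram law at the midpoint \<open>m\<close> of \<open>u\<close> and \<open>v\<close>\<close>
  have par: "B (\<lambda>x. u x - v x) (\<lambda>x. u x - v x) \<le> 2 * (J u - j) + 2 * (J v - j)"
    if u: "u \<in> W" and v: "v \<in> W" for u v
  proof -
    define m' where "m' = (\<lambda>x. u x - (-1) * v x)"
    define m where "m = (\<lambda>x. (1/2) * m' x)"
    have m': "m' \<in> W" unfolding m'_def using diff_mem[OF u v] .
    have m: "m \<in> W" unfolding m_def using scale_mem[OF m'] .
    have "B m' m' = B u u + 2 * B u v + B v v" "L m' = L u + L v"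
      unfolding m'_def using diff_diff[OF u v, of "-1"] Ldiff[OF u v, of "-1"] by simp_all
    moreover have "B m m = (1/2) * B m' m" "B m m' = (1/2) * B m' m'" "L m = (1/2) * L m'"
      using scale_left[OF m' m, of "1/2"] scale_left[OF m' m', of "1/2"] L(2)[OF m', of "1/2"]
      by (simp_all only: m_def[symmetric])
    ultimately have "J m = (1/4) * (B u u + 2 * B u v + B v v) - (L u + L v)"
      using sym[OF m m'] by (simp add: J_def field_simps)
    moreover have "B (\<lambda>x. u x - v x) (\<lambda>x. u x - v x) = B u u - 2 * B u v + B v v"
      using diff_diff[OF u v, of 1] by simp
    ultimately show ?thesis using jle[OF m] by (simp add: J_def field_simps)
  qed
  have "\<forall>n::nat. \<exists>v. v \<in> W \<and> J v \<le> j + (1/4) ^ n / 4" using ex by (metis divide_pos_pos zero_less_numeral zero_less_power zero_less_one)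
  then obtain w where w: "\<And>n::nat. w n \<in> W" "\<And>n::nat. J (w n) \<le> j + (1/4) ^ n / 4" by metis
  have rapid: "B (\<lambda>x. w (Suc n) x - w n x) (\<lambda>x. w (Suc n) x - w n x) \<le> (1/4) ^ n" for n
  proof -
    define q where "q = (1/4::real) ^ n"
    have "0 \<le> q" by (simp add: q_def)
    then show ?thesis
      using par[OF w(1) w(1), of "Suc n" n] w(2)[of n] w(2)[of "Suc n"]
      unfolding power_Suc q_def[symmetric] by simp
  qed
  obtain \<phi> where \<phi>: "\<phi> \<in> W" "(\<lambda>n. B (\<lambda>x. w n x - \<phi> x) (\<lambda>x. w n x - \<phi> x)) \<longlonglongrightarrow> 0"
    using complete[OF w(1) rapid] by auto
  \<comment> \<open>The functional at \<open>w n - s v\<close> is at least the infimum; \<open>s\<close> is the minimiser up to the summand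
    that keeps its denominator positive for null vectors \<open>v\<close>.\<close>
  have var: "(L v - B (w n) v)\<^sup>2 \<le> ((1/4) ^ n / 4) * (B v v + 1)" if v: "v \<in> W" for n v
  proof -
    define g where "g = L v - B (w n) v"
    define s where "s = - g / (B v v + 1)"
    have p: "B v v + 1 > 0" using nonneg[OF v] by linarith
    have "J (\<lambda>x. w n x - s * v x) = J (w n) + 2 * s * g + s\<^sup>2 * B v v"
      using diff_diff[OF w(1) v, of n s] Ldiff[OF w(1) v, of n s]
      by (simp add: J_def g_def algebra_simps)
    moreover have "s\<^sup>2 * B v v \<le> s\<^sup>2 * (B v v + 1)" by (simp add: algebra_simps)
    moreover have "s\<^sup>2 * (B v v + 1) = g\<^sup>2 / (B v v + 1)" "s * g = - (g\<^sup>2 / (B v v + 1))"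
      using p by (simp_all add: s_def power2_eq_square)
    ultimately have "g\<^sup>2 / (B v v + 1) \<le> (1/4) ^ n / 4"
      using jle[OF diff_mem[OF w(1) v, of n s]] w(2)[of n] by linarith
    then show ?thesis using p by (simp add: g_def field_simps)
  qed
  have "B \<phi> v = L v" if v: "v \<in> W" for v
  proof -
    have "(\<lambda>n. B (w n) v) \<longlonglongrightarrow> L v"
    proof -
      have lim: "(\<lambda>n. ((1/4) ^ n / 4) * (B v v + 1)) \<longlonglongrightarrow> (0 / 4) * (B v v + 1)"
        by (intro tendsto_intros LIMSEQ_power_zero) auto
      have "(\<lambda>n. (L v - B (w n) v)\<^sup>2) \<longlonglongrightarrow> 0"
      proof (rule tendsto_sandwich[OF _ _ tendsto_const])
        show "\<forall>\<^sub>F n in sequentially. (L v - B (w n) v)\<^sup>2 \<le> ((1/4) ^ n / 4) * (B v v + 1)"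
          using var[OF v] by simp
      qed (use lim in simp_all)
      then have "(\<lambda>n. sqrt ((L v - B (w n) v)\<^sup>2)) \<longlonglongrightarrow> sqrt 0" by (rule tendsto_real_sqrt)
      then have "(\<lambda>n. \<bar>L v - B (w n) v\<bar>) \<longlonglongrightarrow> 0" by simp
      then have "(\<lambda>n. L v - (L v - B (w n) v)) \<longlonglongrightarrow> L v - 0"
        by (intro tendsto_diff tendsto_const) (simp add: tendsto_rabs_zero_iff)
      then show ?thesis by simp
    qed
    moreover have "(\<lambda>n. B (w n) v) \<longlonglongrightarrow> B \<phi> v"
    proof -
      have lim: "(\<lambda>n. B (\<lambda>x. w n x - \<phi> x) (\<lambda>x. w n x - \<phi> x) * B v v) \<longlonglongrightarrow> 0 * B v v"
        by (intro tendsto_mult tendsto_const \<phi>)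
      have "(\<lambda>n. (B (\<lambda>x. w n x - \<phi> x) v)\<^sup>2) \<longlonglongrightarrow> 0"
      proof (rule tendsto_sandwich[OF _ _ tendsto_const])
        show "\<forall>\<^sub>F n in sequentially. (B (\<lambda>x. w n x - \<phi> x) v)\<^sup>2
            \<le> B (\<lambda>x. w n x - \<phi> x) (\<lambda>x. w n x - \<phi> x) * B v v"
          using Cauchy_Schwarz[OF diff_mem[OF w(1) \<phi>(1), of _ 1] v] by simp
      qed (use lim in simp_all)
      then have "(\<lambda>n. sqrt ((B (\<lambda>x. w n x - \<phi> x) v)\<^sup>2)) \<longlonglongrightarrow> sqrt 0" by (rule tendsto_real_sqrt)
      then have "(\<lambda>n. B (w n) v - B \<phi> v) \<longlonglongrightarrow> 0"
        using diff_left[OF w(1) \<phi>(1) v, of _ 1] by (simp add: tendsto_rabs_zero_iff)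
      then show ?thesis by (simp add: LIM_zero_iff)
    qed
    ultimately show ?thesis using LIMSEQ_unique by blast
  qed
  then show ?thesis using \<phi>(1) by blast
qed

section \<open>Test functions and the fundamental lemma of the calculus of variations\<close>

definition C1 :: "('a::euclidean_space \<Rightarrow> real) \<Rightarrow> bool" where
  "C1 \<phi> \<longleftrightarrow> (\<exists>\<psi>. (\<forall>x. GDERIV \<phi> x :> \<psi> x) \<and> continuous_on UNIV \<psi>)"

lemma C1_continuous: "C1 \<phi> \<Longrightarrow> continuous_on UNIV \<phi>"
  unfolding C1_def gderiv_def
  by (auto intro!: continuous_at_imp_continuous_on) (blast intro: has_derivative_continuous)

lemma C1_const: "C1 (\<lambda>x. c)"
  unfolding C1_def by (intro exI[of _ "\<lambda>_. 0"]) (auto intro: GDERIV_const)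

lemma C1_mult:
  assumes "C1 f" "C1 g" shows "C1 (\<lambda>x. f x * g x)"
proof -
  obtain f' where f: "\<And>x. GDERIV f x :> f' x" "continuous_on UNIV f'" using assms by (auto simp: C1_def)
  obtain g' where g: "\<And>x. GDERIV g x :> g' x" "continuous_on UNIV g'" using assms by (auto simp: C1_def)
  have "GDERIV (\<lambda>x. f x * g x) x :> f x *\<^sub>R g' x + g x *\<^sub>R f' x" for x
    by (rule GDERIV_mult[OF f(1) g(1)])
  moreover have "continuous_on UNIV (\<lambda>x. f x *\<^sub>R g' x + g x *\<^sub>R f' x)"
    using assms[THEN C1_continuous] f(2) g(2) by (intro continuous_intros) auto
  ultimately show ?thesis unfolding C1_def by (intro exI[of _ "\<lambda>x. f x *\<^sub>R g' x + g x *\<^sub>R f' x"]) auto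
qed

lemma C1_prod: "finite F \<Longrightarrow> (\<And>i. i \<in> F \<Longrightarrow> C1 (f i)) \<Longrightarrow> C1 (\<lambda>x. \<Prod>i\<in>F. f i x)"
proof (induction F rule: finite_induct)
  case (insert i F)
  have "C1 (\<lambda>x. f i x * (\<Prod>i\<in>F. f i x))"
    by (rule C1_mult) (use insert in auto)
  then show ?case using insert by simp
qed (simp add: C1_const)

lemma C1_compose:
  fixes h :: "real \<Rightarrow> real"
  assumes "C1 f" and h: "\<And>x. (h has_field_derivative h' (f x)) (at (f x))" "continuous_on (range f) h'"
  shows "C1 (\<lambda>x. h (f x))"
proof -
  obtain f' where f: "\<And>x. GDERIV f x :> f' x" "continuous_on UNIV f'" using assms(1) by (auto simp: C1_def)
  have "GDERIV (\<lambda>x. h (f x)) x :> h' (f x) *\<^sub>R f' x" for x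
    by (rule GDERIV_DERIV_compose[OF f(1) h(1)])
  moreover have "continuous_on UNIV (\<lambda>x. h' (f x))"
    using continuous_on_compose2[OF h(2) C1_continuous[OF assms(1)]] by auto
  then have "continuous_on UNIV (\<lambda>x. h' (f x) *\<^sub>R f' x)"
    using f(2) by (intro continuous_intros) auto
  ultimately show ?thesis unfolding C1_def by (intro exI[of _ "\<lambda>x. h' (f x) *\<^sub>R f' x"]) auto
qed

lemma C1_affine: "C1 (\<lambda>x. s * (x \<bullet> b) + c)"
  unfolding C1_def gderiv_def
  by (intro exI[of _ "\<lambda>_. s *\<^sub>R b"]) (auto intro!: derivative_eq_intros)

lemma has_derivative_square_max0:
  "((\<lambda>t. (max 0 t)\<^sup>2) has_field_derivative 2 * max 0 t) (at (t::real))"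
proof -
  consider "t < 0" | "t > 0" | "t = 0" by linarith
  then show ?thesis
  proof cases
    case 1
    have "eventually (\<lambda>s. s < 0) (nhds t)" using 1 by (intro eventually_nhds_in_open[of "{..<0}", simplified]) auto
    then have "eventually (\<lambda>s. (max 0 s)\<^sup>2 = 0) (nhds t)" by eventually_elim auto
    then have "((\<lambda>s. (max 0 s)\<^sup>2) has_field_derivative 0) (at t) \<longleftrightarrow> ((\<lambda>_. 0) has_field_derivative 0) (at t)"
      by (intro DERIV_cong_ev refl)
    then show ?thesis using 1 by simp
  next
    case 2
    have "eventually (\<lambda>s. s > 0) (nhds t)" using 2 by (intro eventually_nhds_in_open[of "{0<..}", simplified]) auto
    then have "eventually (\<lambda>s. (max 0 s)\<^sup>2 = s\<^sup>2) (nhds t)" by eventually_elim auto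
    then have "((\<lambda>s. (max 0 s)\<^sup>2) has_field_derivative 2 * t) (at t) \<longleftrightarrow> ((\<lambda>s. s\<^sup>2) has_field_derivative 2 * t) (at t)"
      by (intro DERIV_cong_ev refl)
    moreover have "((\<lambda>s. s\<^sup>2) has_field_derivative 2 * t) (at t)" by (auto intro!: derivative_eq_intros)
    ultimately show ?thesis using 2 by simp
  next
    case 3
    have "((\<lambda>h::real. (max 0 h)\<^sup>2 / h) \<longlongrightarrow> 0) (at 0)"
    proof (rule Lim_null_comparison)
      show "\<forall>\<^sub>F h::real in at 0. norm ((max 0 h)\<^sup>2 / h) \<le> \<bar>h\<bar>"
        by (rule always_eventually) (auto simp: max_def power2_eq_square)
      show "((\<lambda>h::real. \<bar>h\<bar>) \<longlongrightarrow> 0) (at 0)"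
        by (intro tendsto_rabs_zero tendsto_ident_at)
    qed
    then show ?thesis using 3 by (simp add: has_field_derivative_iff)
  qed
qed

lemma C1_square_max0: "C1 f \<Longrightarrow> C1 (\<lambda>x. (max 0 (f x))\<^sup>2)"
  by (rule C1_compose[where h = "\<lambda>t. (max 0 t)\<^sup>2" and h' = "\<lambda>t. 2 * max 0 t"])
    (auto intro!: has_derivative_square_max0 continuous_intros)

text \<open>A continuously differentiable function that is positive exactly on the open box.\<close>

definition box_bump :: "'a::euclidean_space \<Rightarrow> 'a \<Rightarrow> 'a \<Rightarrow> real" where
  "box_bump a b x = (\<Prod>i\<in>Basis. (max 0 (1 * (x \<bullet> i) + - (a \<bullet> i)))\<^sup>2 * (max 0 (- 1 * (x \<bullet> i) + b \<bullet> i))\<^sup>2)"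

lemma C1_box_bump: "C1 (box_bump a b)"
  unfolding box_bump_def
  by (intro C1_prod C1_mult C1_square_max0 C1_affine) auto

lemma box_bump_pos: "x \<in> box a b \<Longrightarrow> box_bump a b x > 0"
  unfolding box_bump_def by (intro prod_pos) (auto simp: box_def)

lemma box_bump_zero: "x \<notin> box a b \<Longrightarrow> box_bump a b x = 0"
proof -
  assume "x \<notin> box a b"
  then obtain i where "i \<in> Basis" "x \<bullet> i \<le> a \<bullet> i \<or> b \<bullet> i \<le> x \<bullet> i" by (auto simp: box_def not_less)
  then show ?thesis unfolding box_bump_def by (intro prod_zero bexI[of _ i]) (auto simp: max_def)
qed

lemma box_bump_nonneg: "box_bump a b x \<ge> 0"
  unfolding box_bump_def by (intro prod_nonneg) auto

text \<open>The increasing functions \<open>t \<mapsto> 1 - 1 / (1 + n t)\<close> vanish at 0 and tend to 1 for positive \<open>t\<close>. They turn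
  the bump into the indicator function of its box without enlarging the support.\<close>

definition box_approx :: "'a::euclidean_space \<Rightarrow> 'a \<Rightarrow> nat \<Rightarrow> 'a \<Rightarrow> real" where
  "box_approx a b n x = 1 - inverse (1 + real n * box_bump a b x)"

lemma C1_box_approx: "C1 (box_approx a b n)"
  unfolding box_approx_def
proof (rule C1_compose[OF C1_box_bump, where h = "\<lambda>t. 1 - inverse (1 + real n * t)"
      and h' = "\<lambda>t. real n * (inverse (1 + real n * t))\<^sup>2"])
  fix x :: 'a
  have "1 + real n * box_bump a b x \<noteq> 0"
    by (smt (verit) box_bump_nonneg mult_nonneg_nonneg of_nat_0_le_iff)
  then show "((\<lambda>t. 1 - inverse (1 + real n * t)) has_real_derivative real n * (inverse (1 + real n * box_bump a b x))\<^sup>2)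
     (at (box_bump a b x))"
    by (auto intro!: derivative_eq_intros simp: power2_eq_square)
next
  have "1 + real n * t \<noteq> 0" if "t \<in> range (box_bump a b)" for t
    using that by (smt (verit) box_bump_nonneg mult_nonneg_nonneg of_nat_0_le_iff imageE)
  then show "continuous_on (range (box_bump a b)) (\<lambda>t. real n * (inverse (1 + real n * t))\<^sup>2)"
    by (intro continuous_intros) auto
qed

lemma box_approx_zero: "x \<notin> box a b \<Longrightarrow> box_approx a b n x = 0"
  by (simp add: box_approx_def box_bump_zero)

lemma box_approx_bounds: "0 \<le> box_approx a b n x" "box_approx a b n x \<le> 1"
proof -
  have "1 \<le> 1 + real n * box_bump a b x" by (simp add: box_bump_nonneg)
  then have "inverse (1 + real n * box_bump a b x) \<le> 1" "0 \<le> inverse (1 + real n * box_bump a b x)"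
    by (auto simp: inverse_le_1_iff)
  then show "0 \<le> box_approx a b n x" "box_approx a b n x \<le> 1" by (auto simp: box_approx_def)
qed

lemma box_approx_tendsto: "(\<lambda>n. box_approx a b n x) \<longlonglongrightarrow> indicator (box a b) x"
proof (cases "x \<in> box a b")
  case True
  then have p: "box_bump a b x > 0" by (rule box_bump_pos)
  have "filterlim (\<lambda>n. 1 + box_bump a b x * real n) at_top sequentially"
    by (rule filterlim_tendsto_add_at_top[OF tendsto_const
          filterlim_tendsto_pos_mult_at_top[OF tendsto_const p filterlim_real_sequentially]])
  then have "(\<lambda>n. 1 - inverse (1 + box_bump a b x * real n)) \<longlonglongrightarrow> 1 - 0"
    by (rule tendsto_diff[OF tendsto_const tendsto_inverse_0_at_top])
  moreover have "box_approx a b n x = 1 - inverse (1 + box_bump a b x * real n)" for n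
    unfolding box_approx_def mult.commute[of "real n"] ..
  ultimately show ?thesis using True by simp
qed (simp add: box_approx_zero)

lemma sigma_finite_lebesgue: "sigma_finite_measure (lebesgue :: 'a::euclidean_space measure)"
proof
  obtain A :: "'a set set" where A: "countable A \<and> A \<subseteq> sets lborel \<and> \<Union>A = space lborel \<and>
    (\<forall>a\<in>A. emeasure lborel a \<noteq> \<infinity>)"
    using lborel.sigma_finite_countable by (rule exE)
  then have sub: "a \<in> sets lborel" "emeasure lborel a \<noteq> \<infinity>" if "a \<in> A" for a
    using that by (simp_all add: subset_iff)
  have "A \<subseteq> sets lebesgue" using sub(1) by (auto intro: sets_completionI_sets)
  moreover have "emeasure lebesgue a \<noteq> \<infinity>" if "a \<in> A" for a
    using sub[OF that] by simp
  ultimately show "\<exists>A::'a set set. countable A \<and> A \<subseteq> sets lebesgue \<and> \<Union>A = space lebesgue \<and> (\<forall>a\<in>A. emeasure lebesgue a \<noteq> \<infinity>)"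
    using A by (intro exI[of _ A]) simp
qed

text \<open>By dominated convergence along \<open>box_approx\<close> the integrals of \<open>g\<close> over all boxes in \<open>U\<close> vanish. Boxes
  generate the Borel sets and are stable under intersection, so the integrals over all measurable subsets
  of a box in \<open>U\<close> vanish. The localisation to \<open>U\<close> is what makes weak gradients local later on.\<close>

lemma C1_compact_support_AE_zero:
  fixes g :: "'a::euclidean_space \<Rightarrow> 'b::euclidean_space"
  assumes opn: "open U"
    and g: "\<And>K. compact K \<Longrightarrow> K \<subseteq> U \<Longrightarrow> set_integrable lebesgue K g"
    and zero: "\<And>\<phi> K. C1 \<phi> \<Longrightarrow> compact K \<Longrightarrow> K \<subseteq> U \<Longrightarrow> (\<And>x. x \<notin> K \<Longrightarrow> \<phi> x = 0) \<Longrightarrow>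
       (LINT x|lebesgue. \<phi> x *\<^sub>R g x) = 0"
  shows "AE x in lebesgue. x \<in> U \<longrightarrow> g x = 0"
proof -
  have box_zero: "AE x in lebesgue. x \<in> box a b \<longrightarrow> g x = 0" if ab: "cbox a b \<subseteq> U" for a b
  proof -
    have int: "set_integrable lebesgue (cbox a b) g" using g[OF compact_cbox ab] .
    have sub: "set_integrable lebesgue (box a b) g"
      by (rule set_integrable_subset[OF int]) (auto simp: box_subset_cbox)
    define f where "f = (\<lambda>x. indicator (box a b) x *\<^sub>R g x)"
    have fint: "integrable lebesgue f" using sub by (simp add: f_def set_integrable_def)
    have box0: "(LINT x|lebesgue. indicator (box c d) x *\<^sub>R f x) = 0" for c d
    proof -
      obtain c' d' where cd: "box c d \<inter> box a b = box c' d'" using box_Int_box[of c d a b] by blast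
      have inner: "(LINT x|lebesgue. indicator (box c' d') x *\<^sub>R g x) = 0" if sub': "box c' d' \<subseteq> box a b"
      proof (cases "box c' d' = {}")
        case False
        have cb: "cbox c' d' \<subseteq> cbox a b"
          using closure_minimal[OF subset_trans[OF sub' box_subset_cbox] closed_cbox] closure_box[OF False] by simp
        have "(\<lambda>n. LINT x|lebesgue. box_approx c' d' n x *\<^sub>R g x)
            \<longlonglongrightarrow> (LINT x|lebesgue. indicator (box c' d') x *\<^sub>R g x)"
        proof (rule integral_dominated_convergence[where w = "\<lambda>x. norm (indicator (cbox a b) x *\<^sub>R g x)"])
          show "integrable lebesgue (\<lambda>x. norm (indicator (cbox a b) x *\<^sub>R g x))"
            using int unfolding set_integrable_def by (rule integrable_norm)
          show "AE x in lebesgue. (\<lambda>n. box_approx c' d' n x *\<^sub>R g x) \<longlonglongrightarrow> indicator (box c' d') x *\<^sub>R g x"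
            by (intro AE_I2 tendsto_intros box_approx_tendsto)
          show "AE x in lebesgue. norm (box_approx c' d' n x *\<^sub>R g x) \<le> norm (indicator (cbox a b) x *\<^sub>R g x)" for n
          proof (intro AE_I2)
            fix x show "norm (box_approx c' d' n x *\<^sub>R g x) \<le> norm (indicator (cbox a b) x *\<^sub>R g x)"
            proof (cases "x \<in> box c' d'")
              case True
              then have "x \<in> cbox a b" using cb box_subset_cbox by blast
              then show ?thesis using box_approx_bounds[of c' d' n x] by (simp add: mult_left_le_one_le)
            qed (simp add: box_approx_zero)
          qed
          have cm: "box_approx c' d' n \<in> borel_measurable lebesgue" for n
            by (intro measurable_completion) (simp add: borel_measurable_continuous_onI C1_continuous C1_box_approx)
          show "(\<lambda>x. indicator (box c' d') x *\<^sub>R g x) \<in> borel_measurable lebesgue"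
            using set_integrable_subset[OF int, of "box c' d'"] subset_trans[OF box_subset_cbox cb]
            by (simp add: set_integrable_def borel_measurable_integrable)
          have eq: "(\<lambda>x. box_approx c' d' n x *\<^sub>R g x) = (\<lambda>x. box_approx c' d' n x *\<^sub>R (indicator (cbox a b) x *\<^sub>R g x))" for n
          proof
            fix x show "box_approx c' d' n x *\<^sub>R g x = box_approx c' d' n x *\<^sub>R (indicator (cbox a b) x *\<^sub>R g x)"
              using cb box_subset_cbox[of c' d'] by (cases "x \<in> box c' d'") (auto simp: box_approx_zero)
          qed
          show "(\<lambda>x. box_approx c' d' n x *\<^sub>R g x) \<in> borel_measurable lebesgue" for n
            by (subst eq, intro borel_measurable_scaleR cm borel_measurable_integrable)
              (use int in \<open>simp add: set_integrable_def\<close>)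
        qed
        moreover have "(LINT x|lebesgue. box_approx c' d' n x *\<^sub>R g x) = 0" for n
        proof (rule zero[OF C1_box_approx compact_cbox])
          show "cbox c' d' \<subseteq> U" using cb ab by blast
          show "box_approx c' d' n x = 0" if "x \<notin> cbox c' d'" for x
            using that box_subset_cbox[of c' d'] by (intro box_approx_zero) blast
        qed
        ultimately show ?thesis by (simp add: LIMSEQ_const_iff)
      qed simp
      have "(LINT x|lebesgue. indicator (box c d) x *\<^sub>R f x) = (LINT x|lebesgue. indicator (box c' d') x *\<^sub>R g x)"
        by (intro Bochner_Integration.integral_cong refl) (auto simp: f_def cd[symmetric] indicator_def)
      moreover have "box c' d' \<subseteq> box a b" using cd by blast
      ultimately show ?thesis using inner by simp
    qed
    have all: "(LINT x|lebesgue. indicator A x *\<^sub>R f x) = 0" if "A \<in> sets borel" for A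
    proof -
      let ?G = "range (\<lambda>(c, d). box c d :: 'a set)"
      have SG: "sigma_sets UNIV ?G = sets borel" by (simp add: borel_eq_box)
      then have "A \<in> sigma_sets UNIV ?G" using that by simp
      have "Int_stable ?G"
        by (auto simp: Int_stable_def box_Int_box)
      moreover have "?G \<subseteq> Pow UNIV" by simp
      ultimately show ?thesis using \<open>A \<in> sigma_sets UNIV ?G\<close>
      proof (induction rule: sigma_sets_induct_disjoint)
        case (basic A)
        then show ?case using box0 by auto
      next
        case empty
        then show ?case by simp
      next
        case (compl A)
        then have A: "A \<in> sets lebesgue" using SG by (intro sets_completionI_sets) simp
        have "(LINT x|lebesgue. indicator (UNIV - A) x *\<^sub>R f x)
            = (LINT x|lebesgue. f x - indicator A x *\<^sub>R f x)"
          by (intro Bochner_Integration.integral_cong refl) (auto simp: indicator_def)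
        also have "\<dots> = (LINT x|lebesgue. f x) - (LINT x|lebesgue. indicator A x *\<^sub>R f x)"
          using fint A by (intro Bochner_Integration.integral_diff integrable_mult_indicator) auto
        also have "(LINT x|lebesgue. f x) = (LINT x|lebesgue. indicator (box a b) x *\<^sub>R f x)"
          by (intro Bochner_Integration.integral_cong refl) (auto simp: f_def indicator_def)
        finally show ?case using compl box0 by simp
      next
        case (union A)
        have Al: "A i \<in> sets lebesgue" for i
          using union(2) SG by (intro sets_completionI_sets) auto
        have "set_lebesgue_integral lebesgue (\<Union>i. A i) f = (\<Sum>i. set_lebesgue_integral lebesgue (A i) f)"
        proof (rule lebesgue_integral_countable_add)
          show "set_integrable lebesgue (\<Union> (range A)) f"
            unfolding set_integrable_def using fint Al by (intro integrable_mult_indicator) auto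
        qed (use Al union(1) in \<open>auto simp: disjoint_family_on_def\<close>)
        then show ?case using union(3) by (simp add: set_lebesgue_integral_def)
      qed
    qed
    have "AE x in lebesgue. f x = 0"
    proof (rule sigma_finite_measure.density_zero[OF sigma_finite_lebesgue fint])
      fix A :: "'a set" assume A: "A \<in> sets lebesgue"
      then obtain S N N' where SN: "A = S \<union> N" "N \<subseteq> N'" "N' \<in> null_sets lborel" "S \<in> sets lborel"
        by (rule sets_completionE)
      have N: "AE x in lebesgue. x \<notin> N"
        using AE_not_in[OF null_sets_completionI[OF SN(3)]] by eventually_elim (use SN(2) in blast)
      have fm: "f \<in> borel_measurable lebesgue" using fint by auto
      have "(LINT x|lebesgue. indicator A x *\<^sub>R f x) = (LINT x|lebesgue. indicator S x *\<^sub>R f x)"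
      proof (rule integral_cong_AE)
        show "AE x in lebesgue. indicator A x *\<^sub>R f x = indicator S x *\<^sub>R f x"
          using N by eventually_elim (simp add: SN(1) indicator_def)
      qed (use SN(4) A fm in \<open>auto intro!: borel_measurable_scaleR borel_measurable_indicator\<close>)
      then show "set_lebesgue_integral lebesgue A f = 0"
        using all SN(4) by (simp add: set_lebesgue_integral_def)
    qed
    then show ?thesis by eventually_elim (auto simp: f_def)
  qed
  obtain \<D> where D: "countable \<D>" "\<D> \<subseteq> Pow U" "\<And>X. X \<in> \<D> \<Longrightarrow> \<exists>a b. X = cbox a b"  "\<Union>\<D> = U"
    by (rule open_countable_Union_open_cbox[OF opn]) blast
  have "AE x in lebesgue. \<forall>X\<in>\<D>. x \<in> X \<longrightarrow> g x = 0"
    unfolding AE_ball_countable[OF D(1)]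
  proof
    fix X assume X: "X \<in> \<D>"
    then obtain a b where ab: "X = cbox a b" using D(3) by blast
    have "cbox a b - box a b \<in> null_sets lebesgue"
      by (simp add: negligible_iff_null_sets[symmetric] negligible_frontier_interval)
    then have "AE x in lebesgue. x \<notin> cbox a b - box a b" by (rule AE_not_in)
    moreover have "AE x in lebesgue. x \<in> box a b \<longrightarrow> g x = 0" using box_zero[of a b] X D(2) ab by auto
    ultimately show "AE x in lebesgue. x \<in> X \<longrightarrow> g x = 0" by eventually_elim (auto simp: ab)
  qed
  then show ?thesis by eventually_elim (use D(4) in blast)
qed

section \<open>Lebesgue measure and integer translations\<close>

lemma lebesgue_measurable_affine:
  "(c::real) \<noteq> 0 \<Longrightarrow> (\<lambda>x. c *\<^sub>R x + t) \<in> lebesgue \<rightarrow>\<^sub>M (lebesgue :: 'a::euclidean_space measure)"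
  using lebesgue_affine_measurable[of "\<lambda>_. c" t]
  unfolding scaleR_scaleR[symmetric] scaleR_sum_right[symmetric] euclidean_representation
  by (simp add: add.commute)

lemma AE_lebesgue_affine:
  fixes t :: "'a::euclidean_space"
  assumes c: "c \<noteq> 0" and P: "AE x in lebesgue. P x"
  shows "AE x in lebesgue. P (c *\<^sub>R x + t)"
proof -
  obtain N where N: "{x \<in> space lebesgue. \<not> P x} \<subseteq> N" "N \<in> null_sets lebesgue"
    using P by (auto simp: eventually_ae_filter)
  let ?M = "(\<lambda>x. (1/c) *\<^sub>R x + (- (1/c) *\<^sub>R t)) ` N"
  have eq: "?M = (\<lambda>x. c *\<^sub>R x + t) -` N \<inter> space lebesgue"
  proof (intro set_eqI iffI)
    fix x assume "x \<in> (\<lambda>x. c *\<^sub>R x + t) -` N \<inter> space lebesgue"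
    then have "c *\<^sub>R x + t \<in> N" by simp
    moreover have "x = (1/c) *\<^sub>R (c *\<^sub>R x + t) + (- (1/c) *\<^sub>R t)"
      using c by (simp add: scaleR_add_right)
    ultimately show "x \<in> ?M" by blast
  qed (use c in \<open>auto simp: scaleR_diff_right\<close>)
  have "?M \<in> sets lebesgue"
    unfolding eq by (rule measurable_sets[OF lebesgue_measurable_affine[OF c]]) (use N in auto)
  moreover have "emeasure lebesgue ?M = 0"
    using N(2) unfolding emeasure_lebesgue_affine by auto
  ultimately have "AE x in lebesgue. x \<notin> ?M" by (intro AE_not_in) auto
  then show ?thesis
    by eventually_elim (use N(1) eq in auto)
qed

lemma lebesgue_distr_translation:
  "distr lebesgue lebesgue (\<lambda>x. x + t) = (lebesgue :: 'a::euclidean_space measure)"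
proof (rule measure_eqI)
  fix A :: "'a set" assume "A \<in> sets (distr lebesgue lebesgue (\<lambda>x. x + t))"
  then have A: "A \<in> sets lebesgue" by simp
  have eq: "(\<lambda>x. x + t) -` A \<inter> space lebesgue = (\<lambda>x. 1 *\<^sub>R x + (- t)) ` A"
    by (auto simp: image_iff) (metis add_diff_cancel)
  have "emeasure (distr lebesgue lebesgue (\<lambda>x. x + t)) A = emeasure lebesgue ((\<lambda>x. x + t) -` A \<inter> space lebesgue)"
    using lebesgue_measurable_affine[of 1 t] A by (intro emeasure_distr) simp_all
  also have "\<dots> = emeasure lebesgue A"
    unfolding eq emeasure_lebesgue_affine by simp
  finally show "emeasure (distr lebesgue lebesgue (\<lambda>x. x + t)) A = emeasure lebesgue A" .
qed simp

lemma measurable_translation: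
  "f \<in> borel_measurable lebesgue \<Longrightarrow> (\<lambda>x. f (x + t)) \<in> borel_measurable (lebesgue :: 'a::euclidean_space measure)"
  using measurable_compose[OF lebesgue_measurable_affine[of 1 t], of f] by simp

lemma integral_translation:
  fixes f :: "'a::euclidean_space \<Rightarrow> 'b::euclidean_space"
  assumes "f \<in> borel_measurable lebesgue"
  shows "(LINT x|lebesgue. f (x + t)) = (LINT x|lebesgue. f x)"
    and "integrable lebesgue (\<lambda>x. f (x + t)) \<longleftrightarrow> integrable lebesgue f"
  using integral_distr[of "\<lambda>x. x + t" lebesgue lebesgue f] integrable_distr_eq[of "\<lambda>x. x + t" lebesgue lebesgue f]
    lebesgue_measurable_affine[of 1 t] assms
  by (simp_all add: lebesgue_distr_translation)

lemma nn_integral_translation: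
  assumes "f \<in> borel_measurable (lebesgue :: 'a::euclidean_space measure)"
  shows "(\<integral>\<^sup>+x. f (x + t) \<partial>lebesgue) = (\<integral>\<^sup>+x. f x \<partial>lebesgue)"
  using nn_integral_distr[of "\<lambda>x. x + t" lebesgue lebesgue f]
    lebesgue_measurable_affine[of 1 t] assms
  by (simp add: lebesgue_distr_translation)

lemma countable_int_vecs: "countable (int_vecs :: (real ^ 'd) set)"
proof -
  have "(int_vecs :: (real ^ 'd) set) \<subseteq> range (\<lambda>k :: int ^ 'd. \<chi> j. real_of_int (k $ j))"
  proof
    fix k :: "real ^ 'd" assume "k \<in> int_vecs"
    then have "k = (\<chi> j. real_of_int ((\<chi> j. \<lfloor>k $ j\<rfloor>) $ j))"
      by (auto simp: int_vecs_def vec_eq_iff)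
    then show "k \<in> range (\<lambda>k :: int ^ 'd. \<chi> j. real_of_int (k $ j))" by blast
  qed
  then show ?thesis by (rule countable_subset) simp
qed

definition cell_shift :: "real ^ 'd \<Rightarrow> real ^ 'd" where
  "cell_shift x = (\<chi> j. of_int \<lfloor>x $ j\<rfloor>)"

lemma cell_shift: "cell_shift x \<in> int_vecs" "x - cell_shift x \<in> unit_cell"
proof -
  have "0 \<le> x $ j - of_int \<lfloor>x $ j\<rfloor>" "x $ j - of_int \<lfloor>x $ j\<rfloor> \<le> 1" for j by linarith+
  then show "x - cell_shift x \<in> unit_cell"
    by (simp add: cell_shift_def unit_cell_def mem_box_cart)
qed (simp add: cell_shift_def int_vecs_def)

lemma diff_int_vecs: "k \<in> int_vecs \<Longrightarrow> l \<in> int_vecs \<Longrightarrow> k - l \<in> int_vecs"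
  by (simp add: int_vecs_def)

text \<open>Every point is moved into the cell by one of countably many integer vectors.\<close>

lemma AE_from_cell:
  fixes P :: "real ^ 'd \<Rightarrow> bool"
  assumes cell: "AE x in lebesgue. x \<in> unit_cell \<longrightarrow> P x"
    and per: "\<And>k. k \<in> int_vecs \<Longrightarrow> AE x in lebesgue. P x \<longrightarrow> P (x + k)"
  shows "AE x in lebesgue. P x"
proof -
  have "AE x in lebesgue. \<forall>k\<in>int_vecs. x - k \<in> unit_cell \<longrightarrow> P x"
    unfolding AE_ball_countable[OF countable_int_vecs]
  proof
    fix k :: "real ^ 'd" assume k: "k \<in> int_vecs"
    have "AE x in lebesgue. x - k \<in> unit_cell \<longrightarrow> P (x - k)"
      using AE_lebesgue_affine[OF _ cell, of 1 "- k"] by simp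
    moreover have "AE x in lebesgue. P (x - k) \<longrightarrow> P (x - k + k)"
      using AE_lebesgue_affine[OF _ per[OF k], of 1 "- k"] by simp
    ultimately show "AE x in lebesgue. x - k \<in> unit_cell \<longrightarrow> P x" by eventually_elim simp
  qed
  then show ?thesis by eventually_elim (use cell_shift in blast)
qed

lemma compact_unit_cell: "compact unit_cell"
  by (simp add: unit_cell_def)

lemma unit_cell_sets [measurable]: "unit_cell \<in> sets lebesgue"
  by (simp add: unit_cell_def)

lemma compact_covered_by_cells:
  fixes K :: "(real ^ 'd) set"
  assumes "compact K"
  shows "\<exists>F. finite F \<and> F \<subseteq> int_vecs \<and> K \<subseteq> (\<Union>k\<in>F. {x. x - k \<in> unit_cell})"
proof -
  obtain M where M: "\<And>x. x \<in> K \<Longrightarrow> norm x \<le> M"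
    using compact_imp_bounded[OF assms] by (auto simp: bounded_iff)
  let ?F = "cell_shift ` K"
  let ?G = "(\<lambda>k :: int ^ 'd. \<chi> j. real_of_int (k $ j)) ` {k. \<forall>j. k $ j \<in> {- \<lceil>M\<rceil> - 1..\<lceil>M\<rceil>}}"
  have "?F \<subseteq> ?G"
  proof
    fix y assume "y \<in> ?F"
    then obtain x where x: "x \<in> K" "y = cell_shift x" by blast
    have "\<lfloor>x $ j\<rfloor> \<in> {- \<lceil>M\<rceil> - 1..\<lceil>M\<rceil>}" for j
    proof -
      have "\<bar>x $ j\<bar> \<le> M" using component_le_norm_cart[of x j] M[OF x(1)] by linarith
      then show ?thesis by simp linarith
    qed
    then have "y = (\<chi> j. real_of_int ((\<chi> j. \<lfloor>x $ j\<rfloor>) $ j))" "(\<chi> j. \<lfloor>x $ j\<rfloor>) \<in> {k. \<forall>j. k $ j \<in> {- \<lceil>M\<rceil> - 1..\<lceil>M\<rceil>}}"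
      by (auto simp: x(2) cell_shift_def)
    then show "y \<in> ?G" by blast
  qed
  moreover have "finite {k :: int ^ 'd. \<forall>j. k $ j \<in> {- \<lceil>M\<rceil> - 1..\<lceil>M\<rceil>}}"
  proof -
    have "{k :: int ^ 'd. \<forall>j. k $ j \<in> {- \<lceil>M\<rceil> - 1..\<lceil>M\<rceil>}} \<subseteq> vec_lambda ` (UNIV \<rightarrow>\<^sub>E {- \<lceil>M\<rceil> - 1..\<lceil>M\<rceil>})"
    proof
      fix k :: "int ^ 'd" assume "k \<in> {k. \<forall>j. k $ j \<in> {- \<lceil>M\<rceil> - 1..\<lceil>M\<rceil>}}"
      then have "k = vec_lambda (\<lambda>j. k $ j)" "(\<lambda>j. k $ j) \<in> UNIV \<rightarrow>\<^sub>E {- \<lceil>M\<rceil> - 1..\<lceil>M\<rceil>}" by auto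
      then show "k \<in> vec_lambda ` (UNIV \<rightarrow>\<^sub>E {- \<lceil>M\<rceil> - 1..\<lceil>M\<rceil>})" by blast
    qed
    then show ?thesis by (rule finite_subset) (intro finite_imageI finite_PiE, auto)
  qed
  ultimately have "finite ?F" by (rule finite_subset[OF _ finite_imageI])
  then show ?thesis
    by (intro exI[of _ ?F]) (auto simp: cell_shift)
qed

text \<open>A compact set is covered by finitely many translates of the cell, each of which contributes the integral
  over the cell itself. The number depends on the set only.\<close>

lemma nn_integral_compact_le_cell:
  fixes K :: "(real ^ 'd) set"
  assumes "compact K"
  shows "\<exists>n::nat. \<forall>f \<in> borel_measurable lebesgue. (\<forall>k\<in>int_vecs. AE x in lebesgue. f (x + k) = f x) \<longrightarrow>
    (\<integral>\<^sup>+x. indicator K x * f x \<partial>lebesgue) \<le> of_nat n * (\<integral>\<^sup>+x. indicator unit_cell x * f x \<partial>lebesgue)"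
proof -
  obtain F where F: "finite F" "F \<subseteq> int_vecs" "K \<subseteq> (\<Union>k\<in>F. {x. x - k \<in> unit_cell})"
    using compact_covered_by_cells[OF assms] by blast
  show ?thesis
  proof (intro exI[of _ "card F"] ballI impI)
    fix f :: "real ^ 'd \<Rightarrow> ennreal"
    assume f[measurable]: "f \<in> borel_measurable lebesgue"
      and per: "\<forall>k\<in>int_vecs. AE x in lebesgue. f (x + k) = f x"
    have m: "(\<lambda>x. indicator unit_cell (x - k) * f x) \<in> borel_measurable lebesgue" for k
      using measurable_translation[of "indicator unit_cell :: _ \<Rightarrow> ennreal" "-k"] by simp
    have "(\<integral>\<^sup>+x. indicator K x * f x \<partial>lebesgue) \<le> (\<integral>\<^sup>+x. (\<Sum>k\<in>F. indicator unit_cell (x - k) * f x) \<partial>lebesgue)"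
    proof (rule nn_integral_mono)
      fix x
      show "indicator K x * f x \<le> (\<Sum>k\<in>F. indicator unit_cell (x - k) * f x)"
      proof (cases "x \<in> K")
        case True
        then obtain k where k: "k \<in> F" "x - k \<in> unit_cell" using F(3) by blast
        have "indicator K x * f x = indicator unit_cell (x - k) * f x" using True k by simp
        also have "\<dots> \<le> (\<Sum>k\<in>F. indicator unit_cell (x - k) * f x)"
          by (rule member_le_sum[OF k(1)]) (use F in auto)
        finally show ?thesis .
      qed simp
    qed
    also have "\<dots> = (\<Sum>k\<in>F. (\<integral>\<^sup>+x. indicator unit_cell (x - k) * f x \<partial>lebesgue))"
      by (rule nn_integral_sum[OF m])
    also have "\<dots> = (\<Sum>k\<in>F. (\<integral>\<^sup>+x. indicator unit_cell x * f x \<partial>lebesgue))"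
    proof (rule sum.cong[OF refl])
      fix k assume "k \<in> F"
      then have k: "k \<in> int_vecs" using F by blast
      have "(\<integral>\<^sup>+x. indicator unit_cell (x - k) * f x \<partial>lebesgue)
          = (\<integral>\<^sup>+x. indicator unit_cell (x + k - k) * f (x + k) \<partial>lebesgue)"
        by (rule nn_integral_translation[OF m, symmetric])
      also have "\<dots> = (\<integral>\<^sup>+x. indicator unit_cell x * f x \<partial>lebesgue)"
      proof (rule nn_integral_cong_AE)
        show "AE x in lebesgue. indicator unit_cell (x + k - k) * f (x + k) = indicator unit_cell x * f x"
          using bspec[OF per k] by eventually_elim simp
      qed
      finally show "(\<integral>\<^sup>+x. indicator unit_cell (x - k) * f x \<partial>lebesgue)
          = (\<integral>\<^sup>+x. indicator unit_cell x * f x \<partial>lebesgue)" .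
    qed
    also have "\<dots> = of_nat (card F) * (\<integral>\<^sup>+x. indicator unit_cell x * f x \<partial>lebesgue)" by simp
    finally show "(\<integral>\<^sup>+x. indicator K x * f x \<partial>lebesgue)
      \<le> of_nat (card F) * (\<integral>\<^sup>+x. indicator unit_cell x * f x \<partial>lebesgue)" .
  qed
qed

section \<open>Rapidly converging sequences of square-integrable functions\<close>

text \<open>The factor \<open>2 ^ k\<close> in the sum is paid for by the convergent series of its inverses, which also
  produces the decay in \<open>n\<close>.\<close>

lemma telescoping_Cauchy_Schwarz:
  fixes f :: "nat \<Rightarrow> 'b::real_normed_vector"
  assumes "summable (\<lambda>k. 2 ^ k * (norm (f (Suc k) - f k))\<^sup>2)" and "n \<le> m"
  shows "(norm (f m - f n))\<^sup>2 \<le> 2 * (1/2) ^ n * (\<Sum>k. 2 ^ k * (norm (f (Suc k) - f k))\<^sup>2)"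
proof -
  define d where "d = (\<lambda>k. norm (f (Suc k) - f k))"
  have "norm (f m - f n) \<le> (\<Sum>k\<in>{n..<m}. d k)"
    using norm_sum[of "\<lambda>k. f (Suc k) - f k" "{n..<m}"] sum_Suc_diff'[OF assms(2), of f] by (simp add: d_def)
  also have "\<dots> = (\<Sum>k\<in>{n..<m}. sqrt ((1/2) ^ k) * (sqrt (2 ^ k) * d k))"
    by (intro sum.cong refl) (simp add: real_sqrt_mult[symmetric] power_mult_distrib[symmetric] mult.assoc[symmetric])
  finally have "(norm (f m - f n))\<^sup>2 \<le> (\<Sum>k\<in>{n..<m}. sqrt ((1/2) ^ k) * (sqrt (2 ^ k) * d k))\<^sup>2"
    by (rule power_mono) simp
  also have "\<dots> \<le> (\<Sum>k\<in>{n..<m}. (sqrt ((1/2) ^ k))\<^sup>2) * (\<Sum>k\<in>{n..<m}. (sqrt (2 ^ k) * d k)\<^sup>2)"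
    by (rule Cauchy_Schwarz_ineq_sum)
  also have "\<dots> = (\<Sum>k\<in>{n..<m}. (1/2) ^ k) * (\<Sum>k\<in>{n..<m}. 2 ^ k * (d k)\<^sup>2)"
    by (simp add: power_mult_distrib)
  also have "\<dots> \<le> (2 * (1/2) ^ n) * (\<Sum>k. 2 ^ k * (d k)\<^sup>2)"
  proof (rule mult_mono)
    have "(\<Sum>k\<in>{n..<m}. (1/2::real) ^ k) = 2 * (1/2) ^ n - 2 * (1/2) ^ m"
      using assms(2) by (induction m rule: dec_induct) auto
    then show "(\<Sum>k\<in>{n..<m}. (1/2::real) ^ k) \<le> 2 * (1/2) ^ n" by simp
    show "(\<Sum>k\<in>{n..<m}. 2 ^ k * (d k)\<^sup>2) \<le> (\<Sum>k. 2 ^ k * (d k)\<^sup>2)"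
      using assms(1) by (intro sum_le_suminf) (auto simp: d_def)
  qed (auto intro: sum_nonneg)
  finally show ?thesis by (simp add: d_def)
qed

text \<open>The sum \<open>G\<close> of \<open>2 ^ k * (norm (f (Suc k) - f k))\<^sup>2\<close> is integrable and controls all differences pointwise.
  This one function yields convergence almost everywhere and convergence in the square mean.\<close>

lemma rapidly_Cauchy_dominated:
  fixes f :: "nat \<Rightarrow> 'a::euclidean_space \<Rightarrow> 'b::euclidean_space"
  assumes S[measurable]: "S \<in> sets lebesgue" and f[measurable]: "\<And>n. f n \<in> borel_measurable lebesgue"
    and int: "\<And>n. set_integrable lebesgue S (\<lambda>x. (norm (f (Suc n) x - f n x))\<^sup>2)"
    and K: "\<And>n. (LINT x:S|lebesgue. (norm (f (Suc n) x - f n x))\<^sup>2) \<le> K * (1/4) ^ n"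
  shows "\<exists>G. set_integrable lebesgue S G \<and>
    (AE x in lebesgue. x \<in> S \<longrightarrow> (\<forall>n m. n \<le> m \<longrightarrow> (norm (f m x - f n x))\<^sup>2 \<le> 2 * (1/2) ^ n * G x))"
proof -
  define D where "D = (\<lambda>k x. indicator S x * (2 ^ k * (norm (f (Suc k) x - f k x))\<^sup>2))"
  have D0: "0 \<le> D k x" for k x by (simp add: D_def)
  have [measurable]: "D k \<in> borel_measurable lebesgue" for k unfolding D_def by measurable
  have Dint: "integrable lebesgue (D k)" for k
  proof -
    have "integrable lebesgue (\<lambda>x. 2 ^ k * (indicator S x *\<^sub>R (norm (f (Suc k) x - f k x))\<^sup>2))"
      using int[of k] unfolding set_integrable_def by (intro integrable_mult_right)
    then show ?thesis by (simp add: D_def algebra_simps)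
  qed
  have DK: "(LINT x|lebesgue. D k x) \<le> K * (1/2) ^ k" for k
  proof -
    have "(LINT x|lebesgue. D k x) = (LINT x|lebesgue. 2 ^ k * (indicator S x *\<^sub>R (norm (f (Suc k) x - f k x))\<^sup>2))"
      by (simp add: D_def algebra_simps)
    also have "\<dots> = 2 ^ k * (LINT x:S|lebesgue. (norm (f (Suc k) x - f k x))\<^sup>2)"
      unfolding set_lebesgue_integral_def by (rule integral_mult_right_zero)
    also have "\<dots> \<le> 2 ^ k * (K * (1/4) ^ k)" using K by (intro mult_left_mono) auto
    also have "\<dots> = K * (2 * (1/4)) ^ k" by (simp only: power_mult_distrib) simp
    finally show ?thesis by simp
  qed
  have K0: "K \<ge> 0" using order_trans[OF Bochner_Integration.integral_nonneg[of lebesgue "D 0"] DK[of 0]] D0 by simp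
  have fin: "(\<integral>\<^sup>+x. (\<Sum>k. ennreal (D k x)) \<partial>lebesgue) \<noteq> \<infinity>"
  proof -
    have "(\<integral>\<^sup>+x. (\<Sum>k. ennreal (D k x)) \<partial>lebesgue) = (\<Sum>k. (\<integral>\<^sup>+x. ennreal (D k x) \<partial>lebesgue))"
      by (rule nn_integral_suminf) measurable
    also have "\<dots> \<le> (\<Sum>k. ennreal (K * (1/2) ^ k))"
      using DK by (intro suminf_le summableI) (auto simp: nn_integral_eq_integral[OF Dint] D0 intro: ennreal_leI)
    also have "\<dots> = ennreal (\<Sum>k. K * (1/2) ^ k)"
      using K0 by (intro suminf_ennreal2) (auto intro!: summable_mult summable_geometric)
    finally show ?thesis by (auto simp: top_unique)
  qed
  have summ: "AE x in lebesgue. summable (\<lambda>k. D k x)"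
    using nn_integral_PInf_AE[OF _ fin]
    by (rule AE_mp) (auto intro!: AE_I2 summable_suminf_not_top D0)
  define G where "G = (\<lambda>x. \<Sum>k. D k x)"
  have Gint: "integrable lebesgue G"
  proof (rule integrableI_nonneg)
    show "G \<in> borel_measurable lebesgue" unfolding G_def by measurable
    show "AE x in lebesgue. 0 \<le> G x" using summ
      by eventually_elim (auto simp: G_def intro!: suminf_nonneg D0)
    have "(\<integral>\<^sup>+x. ennreal (G x) \<partial>lebesgue) = (\<integral>\<^sup>+x. (\<Sum>k. ennreal (D k x)) \<partial>lebesgue)"
      using summ by (intro nn_integral_cong_AE, eventually_elim) (auto simp: G_def D0 suminf_ennreal2)
    then show "(\<integral>\<^sup>+x. ennreal (G x) \<partial>lebesgue) < \<infinity>" using fin by (simp add: top.not_eq_extremum)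
  qed
  show ?thesis
  proof (intro exI[of _ G] conjI)
    show "set_integrable lebesgue S G"
      unfolding set_integrable_def using Gint by (intro integrable_mult_indicator) auto
    show "AE x in lebesgue. x \<in> S \<longrightarrow> (\<forall>n m. n \<le> m \<longrightarrow> (norm (f m x - f n x))\<^sup>2 \<le> 2 * (1/2) ^ n * G x)"
      using summ
    proof eventually_elim
      case (elim x)
      show ?case
      proof (intro impI allI)
        fix n m :: nat assume "x \<in> S" "n \<le> m"
        then show "(norm (f m x - f n x))\<^sup>2 \<le> 2 * (1/2) ^ n * G x"
          using elim telescoping_Cauchy_Schwarz[of "\<lambda>k. f k x" n m] by (simp add: D_def G_def)
      qed
    qed
  qed
qed

lemma Cauchy_of_half_powers:
  fixes f :: "nat \<Rightarrow> 'b::banach"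
  assumes "\<And>n m. n \<le> m \<Longrightarrow> (norm (f m - f n))\<^sup>2 \<le> 2 * (1/2) ^ n * g"
  shows "convergent f"
proof -
  have lim: "(\<lambda>n. 2 * (1/2) ^ n * g) \<longlonglongrightarrow> 2 * 0 * g"
    by (intro tendsto_mult tendsto_const LIMSEQ_power_zero) simp
  have "Cauchy f"
  proof (rule CauchyI)
    fix e :: real assume e: "0 < e"
    then have "eventually (\<lambda>n. 2 * (1/2) ^ n * g < (e/2)\<^sup>2) sequentially"
      using order_tendstoD(2)[OF lim, of "(e/2)\<^sup>2"] by simp
    then obtain M where M: "2 * (1/2) ^ M * g < (e/2)\<^sup>2" by (auto simp: eventually_sequentially)
    have half: "norm (f m - f M) < e / 2" if "m \<ge> M" for m
      using assms[OF that] M e by (intro power2_less_imp_less[of _ "e/2"]) auto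
    show "\<exists>M. \<forall>m\<ge>M. \<forall>n\<ge>M. norm (f m - f n) < e"
    proof (intro exI[of _ M] allI impI)
      fix m n assume "M \<le> m" "M \<le> n"
      then have "norm (f m - f M) < e / 2" "norm (f n - f M) < e / 2" using half by auto
      then show "norm (f m - f n) < e"
        using norm_triangle_ineq4[of "f m - f M" "f n - f M"] by simp
    qed
  qed
  then show ?thesis by (rule Cauchy_convergent)
qed

lemma Riesz_Fischer_limit:
  fixes f :: "nat \<Rightarrow> 'a::euclidean_space \<Rightarrow> 'b::euclidean_space"
  assumes S[measurable]: "S \<in> sets lebesgue"
    and f[measurable]: "\<And>n. f n \<in> borel_measurable lebesgue" "g \<in> borel_measurable lebesgue"
    and G: "set_integrable lebesgue S G"
      "AE x in lebesgue. x \<in> S \<longrightarrow> (\<forall>n m. n \<le> m \<longrightarrow> (norm (f m x - f n x))\<^sup>2 \<le> 2 * (1/2) ^ n * G x)"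
    and lim: "AE x in lebesgue. x \<in> S \<longrightarrow> (\<lambda>n. f n x) \<longlonglongrightarrow> g x"
  shows "set_integrable lebesgue S (\<lambda>x. (norm (f n x - g x))\<^sup>2)"
    and "(\<lambda>n. LINT x:S|lebesgue. (norm (f n x - g x))\<^sup>2) \<longlonglongrightarrow> 0"
proof -
  have bd: "AE x in lebesgue. x \<in> S \<longrightarrow> (\<forall>n. (norm (f n x - g x))\<^sup>2 \<le> 2 * (1/2) ^ n * G x)"
    using G(2) lim
  proof eventually_elim
    case (elim x)
    show ?case
    proof (intro impI allI)
      fix n assume x: "x \<in> S"
      have "(\<lambda>m. (norm (f m x - f n x))\<^sup>2) \<longlonglongrightarrow> (norm (g x - f n x))\<^sup>2"
        using elim(2) x by (intro tendsto_power tendsto_norm tendsto_diff tendsto_const) auto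
      then have "(norm (g x - f n x))\<^sup>2 \<le> 2 * (1/2) ^ n * G x"
        by (rule LIMSEQ_le_const2) (use elim(1) x in auto)
      then show "(norm (f n x - g x))\<^sup>2 \<le> 2 * (1/2) ^ n * G x" by (simp add: norm_minus_commute)
    qed
  qed
  have Gn: "set_integrable lebesgue S (\<lambda>x. 2 * (1/2) ^ n * G x)" for n :: nat
    using G(1) by (rule set_integrable_mult_right)
  show int: "set_integrable lebesgue S (\<lambda>x. (norm (f n x - g x))\<^sup>2)" for n
    unfolding set_integrable_def
  proof (rule Bochner_Integration.integrable_bound[OF Gn[unfolded set_integrable_def]])
    show "AE x in lebesgue. norm (indicator S x *\<^sub>R (norm (f n x - g x))\<^sup>2)
       \<le> norm (indicator S x *\<^sub>R (2 * (1/2) ^ n * G x))"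
      using bd by eventually_elim (auto simp: indicator_def intro: order_trans[OF _ abs_ge_self])
  qed measurable
  have up: "(LINT x:S|lebesgue. (norm (f n x - g x))\<^sup>2) \<le> 2 * (1/2) ^ n * (LINT x:S|lebesgue. G x)" for n
  proof -
    have "(LINT x:S|lebesgue. (norm (f n x - g x))\<^sup>2) \<le> (LINT x:S|lebesgue. 2 * (1/2) ^ n * G x)"
      unfolding set_lebesgue_integral_def
    proof (rule integral_mono_AE)
      show "AE x in lebesgue. indicator S x *\<^sub>R (norm (f n x - g x))\<^sup>2 \<le> indicator S x *\<^sub>R (2 * (1/2) ^ n * G x)"
        using bd by eventually_elim (auto simp: indicator_def)
    qed (use int Gn in \<open>auto simp: set_integrable_def\<close>)
    then show ?thesis by simp
  qed
  have "(\<lambda>n. 2 * (1/2) ^ n * (LINT x:S|lebesgue. G x)) \<longlonglongrightarrow> 2 * 0 * (LINT x:S|lebesgue. G x)"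
    by (intro tendsto_mult tendsto_const LIMSEQ_power_zero) simp
  then have l0: "(\<lambda>n. 2 * (1/2) ^ n * (LINT x:S|lebesgue. G x)) \<longlonglongrightarrow> 0" by simp
  show "(\<lambda>n. LINT x:S|lebesgue. (norm (f n x - g x))\<^sup>2) \<longlonglongrightarrow> 0"
  proof (rule tendsto_sandwich[OF _ _ tendsto_const l0])
    show "\<forall>\<^sub>F n in sequentially. 0 \<le> (LINT x:S|lebesgue. (norm (f n x - g x))\<^sup>2)"
      by (intro always_eventually allI) (simp add: set_lebesgue_integral_def)
    show "\<forall>\<^sub>F n in sequentially. (LINT x:S|lebesgue. (norm (f n x - g x))\<^sup>2) \<le> 2 * (1/2) ^ n * (LINT x:S|lebesgue. G x)"
      by (intro always_eventually allI up)
  qed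
qed

section \<open>Weak gradients\<close>

lemma gradient_zero_off_support:
  assumes g: "\<And>x. GDERIV \<phi> x :> \<psi> x" and K: "closed K" "\<And>x. x \<notin> K \<Longrightarrow> \<phi> x = 0" and x: "x \<notin> K"
  shows "\<psi> x = (0 :: 'a::euclidean_space)"
proof -
  have "((\<lambda>y. 0) has_derivative (\<lambda>h. h \<bullet> \<psi> x)) (at x)"
  proof (rule has_derivative_transform_within_open)
    show "(\<phi> has_derivative (\<lambda>h. h \<bullet> \<psi> x)) (at x)" using g by (simp add: gderiv_def)
    show "open (- K)" using K(1) by auto
  qed (use K x in auto)
  moreover have "((\<lambda>y. 0) has_derivative (\<lambda>h. 0)) (at x)" by simp
  ultimately have "(\<lambda>h. h \<bullet> \<psi> x) = (\<lambda>h. 0)" by (rule has_derivative_unique)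
  then have "\<psi> x \<bullet> \<psi> x = 0" by (rule fun_cong)
  then show ?thesis by simp
qed

lemma continuous_support_bounded:
  fixes h :: "'a::euclidean_space \<Rightarrow> 'b::real_normed_vector"
  assumes "continuous_on UNIV h" "compact K" "\<And>x. x \<notin> K \<Longrightarrow> h x = 0"
  shows "\<exists>M\<ge>0. \<forall>x. norm (h x) \<le> M * indicator K x"
proof -
  have "compact (h ` K)" using assms(1,2) by (meson compact_continuous_image continuous_on_subset subset_UNIV)
  then obtain M where "\<And>y. y \<in> h ` K \<Longrightarrow> norm y \<le> M" using compact_imp_bounded[of "h ` K"] unfolding bounded_iff by blast
  then have "\<And>x. norm (h x) \<le> max M 0 * indicator K x"
    using assms(3) by (auto simp: indicator_def le_max_iff_disj)
  then show ?thesis by (intro exI[of _ "max M 0"]) auto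
qed

lemma continuous_lebesgue_measurable:
  fixes h :: "'a::euclidean_space \<Rightarrow> 'b::euclidean_space"
  shows "continuous_on UNIV h \<Longrightarrow> h \<in> borel_measurable lebesgue"
  by (intro measurable_completion) (simp add: borel_measurable_continuous_onI)

lemma integrable_of_bound_on_compact:
  fixes F :: "real ^ 'd \<Rightarrow> 'b::euclidean_space" and g :: "real ^ 'd \<Rightarrow> 'c::euclidean_space"
  assumes g: "locally_integrable g" and K: "compact K"
    and F: "F \<in> borel_measurable lebesgue" "\<And>x. norm (F x) \<le> M * indicator K x * norm (g x)"
  shows "integrable lebesgue F"
proof (rule Bochner_Integration.integrable_bound[OF _ F(1)])
  have "integrable lebesgue (\<lambda>x. indicator K x *\<^sub>R g x)"
    using g K by (simp add: locally_integrable_def set_integrable_def)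
  then show "integrable lebesgue (\<lambda>x. M *\<^sub>R (indicator K x *\<^sub>R g x))" by (rule integrable_scaleR_right)
  show "AE x in lebesgue. norm (F x) \<le> norm (M *\<^sub>R (indicator K x *\<^sub>R g x))"
  proof (rule AE_I2)
    fix x
    have "norm (F x) \<le> M * indicator K x * norm (g x)" by (rule F(2))
    also have "\<dots> \<le> \<bar>M\<bar> * (\<bar>indicator K x\<bar> * norm (g x))"
      unfolding mult.assoc by (intro mult_mono) auto
    finally show "norm (F x) \<le> norm (M *\<^sub>R (indicator K x *\<^sub>R g x))" by (simp add: abs_mult mult.assoc)
  qed
qed

lemma integrable_test_scaleR:
  fixes g :: "real ^ 'd \<Rightarrow> 'b::euclidean_space" and h :: "real ^ 'd \<Rightarrow> real"
  assumes g: "locally_integrable g" and h: "continuous_on UNIV h" "compact K" "\<And>x. x \<notin> K \<Longrightarrow> h x = 0"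
  shows "integrable lebesgue (\<lambda>x. h x *\<^sub>R g x)"
proof -
  obtain M where M: "M \<ge> 0" "\<And>x. norm (h x) \<le> M * indicator K x"
    using continuous_support_bounded[OF h] by blast
  show ?thesis
  proof (rule integrable_of_bound_on_compact[OF g h(2)])
    show "(\<lambda>x. h x *\<^sub>R g x) \<in> borel_measurable lebesgue"
      using g continuous_lebesgue_measurable[OF h(1)] by (intro borel_measurable_scaleR) (auto simp: locally_integrable_def)
    show "norm (h x *\<^sub>R g x) \<le> M * indicator K x * norm (g x)" for x
      using M(2)[of x] by (simp add: mult_right_mono)
  qed
qed

lemma integrable_scaleR_test:
  fixes h :: "real ^ 'd \<Rightarrow> 'b::euclidean_space" and v :: "real ^ 'd \<Rightarrow> real"
  assumes v: "locally_integrable v" and h: "continuous_on UNIV h" "compact K" "\<And>x. x \<notin> K \<Longrightarrow> h x = 0"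
  shows "integrable lebesgue (\<lambda>x. v x *\<^sub>R h x)"
proof -
  obtain M where M: "M \<ge> 0" "\<And>x. norm (h x) \<le> M * indicator K x"
    using continuous_support_bounded[OF h] by blast
  show ?thesis
  proof (rule integrable_of_bound_on_compact[OF v h(2)])
    show "(\<lambda>x. v x *\<^sub>R h x) \<in> borel_measurable lebesgue"
      using v continuous_lebesgue_measurable[OF h(1)] by (intro borel_measurable_scaleR) (auto simp: locally_integrable_def)
    show "norm (v x *\<^sub>R h x) \<le> M * indicator K x * norm (v x)" for x
      using mult_left_mono[OF M(2)[of x], of "\<bar>v x\<bar>"] by (simp add: algebra_simps)
  qed
qed

lemma locally_integrable_axpy:
  fixes f g :: "real ^ 'd \<Rightarrow> 'b::euclidean_space"
  assumes f: "locally_integrable f" and g: "locally_integrable g"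
  shows "locally_integrable (\<lambda>x. f x + s *\<^sub>R g x)"
  unfolding locally_integrable_def
proof (intro conjI allI impI)
  show "(\<lambda>x. f x + s *\<^sub>R g x) \<in> borel_measurable lebesgue"
    using f g by (auto simp: locally_integrable_def)
  fix K :: "(real ^ 'd) set" assume "compact K"
  then have "set_integrable lebesgue K f" "set_integrable lebesgue K (\<lambda>x. s *\<^sub>R g x)"
    using f g unfolding locally_integrable_def by (auto intro: set_integrable_scaleR_right)
  then show "set_integrable lebesgue K (\<lambda>x. f x + s *\<^sub>R g x)" by (rule set_integral_add)
qed

lemma weak_grad_test:
  assumes "is_weak_grad v g" "\<And>x. GDERIV \<phi> x :> \<psi> x" "continuous_on UNIV \<psi>" "compact K" "\<And>x. x \<notin> K \<Longrightarrow> \<phi> x = 0"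
  shows "(LINT x|lebesgue. v x *\<^sub>R \<psi> x) = - (LINT x|lebesgue. \<phi> x *\<^sub>R g x)"
proof -
  have "(\<forall>x. GDERIV \<phi> x :> \<psi> x) \<and> continuous_on UNIV \<psi> \<and> (\<exists>K. compact K \<and> (\<forall>x. x \<notin> K \<longrightarrow> \<phi> x = 0))"
    using assms by auto
  with assms(1) show ?thesis by (simp add: is_weak_grad_def)
qed

text \<open>Test functions supported in \<open>U\<close> see the function only on \<open>U\<close>. The case \<open>U = UNIV\<close> is uniqueness of the
  weak gradient, and \<open>w = 0\<close> says that the gradient vanishes on open sets where the function does.\<close>

lemma weak_grad_unique_on:
  fixes v w :: "real ^ 'd \<Rightarrow> real"
  assumes opn: "open U" and g: "is_weak_grad v g" and h: "is_weak_grad w h"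
    and eq: "AE x in lebesgue. x \<in> U \<longrightarrow> v x = w x"
  shows "AE x in lebesgue. x \<in> U \<longrightarrow> g x = h x"
proof -
  have lg: "locally_integrable g" "locally_integrable v" and lh: "locally_integrable h" "locally_integrable w"
    using g h by (auto simp: is_weak_grad_def)
  have "AE x in lebesgue. x \<in> U \<longrightarrow> g x + (-1) *\<^sub>R h x = 0"
  proof (rule C1_compact_support_AE_zero[OF opn])
    fix K :: "(real ^ 'd) set" assume "compact K"
    then show "set_integrable lebesgue K (\<lambda>x. g x + (-1) *\<^sub>R h x)"
      using locally_integrable_axpy[OF lg(1) lh(1), of "-1"] unfolding locally_integrable_def by blast
  next
    fix \<phi> :: "real ^ 'd \<Rightarrow> real" and K assume \<phi>: "C1 \<phi>" and K: "compact K" "K \<subseteq> U" "\<And>x. x \<notin> K \<Longrightarrow> \<phi> x = 0"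
    obtain \<psi> where \<psi>: "\<And>x. GDERIV \<phi> x :> \<psi> x" "continuous_on UNIV \<psi>" using \<phi> by (auto simp: C1_def)
    have \<psi>0: "\<psi> x = 0" if "x \<notin> K" for x
      by (rule gradient_zero_off_support[OF \<psi>(1) compact_imp_closed[OF K(1)] K(3) that])
    have "(LINT x|lebesgue. v x *\<^sub>R \<psi> x) = (LINT x|lebesgue. w x *\<^sub>R \<psi> x)"
    proof (rule integral_cong_AE)
      show "AE x in lebesgue. v x *\<^sub>R \<psi> x = w x *\<^sub>R \<psi> x"
        using eq by eventually_elim (use \<psi>0 K(2) in fastforce)
    qed (use lg(2) lh(2) continuous_lebesgue_measurable[OF \<psi>(2)] in
        \<open>simp_all add: locally_integrable_def borel_measurable_scaleR\<close>)
    moreover have "(LINT x|lebesgue. v x *\<^sub>R \<psi> x) = - (LINT x|lebesgue. \<phi> x *\<^sub>R g x)"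
      "(LINT x|lebesgue. w x *\<^sub>R \<psi> x) = - (LINT x|lebesgue. \<phi> x *\<^sub>R h x)"
      by (rule weak_grad_test[OF g \<psi> K(1,3)], assumption, rule weak_grad_test[OF h \<psi> K(1,3)], assumption)
    ultimately have e: "(LINT x|lebesgue. \<phi> x *\<^sub>R g x) = (LINT x|lebesgue. \<phi> x *\<^sub>R h x)" by simp
    have "(LINT x|lebesgue. \<phi> x *\<^sub>R (g x + (-1) *\<^sub>R h x)) = (LINT x|lebesgue. \<phi> x *\<^sub>R g x - \<phi> x *\<^sub>R h x)"
      by (simp add: scaleR_diff_right)
    also have "\<dots> = (LINT x|lebesgue. \<phi> x *\<^sub>R g x) - (LINT x|lebesgue. \<phi> x *\<^sub>R h x)"
      by (intro Bochner_Integration.integral_diff integrable_test_scaleR[OF _ C1_continuous[OF \<phi>] K(1,3)] lg lh)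
    finally show "(LINT x|lebesgue. \<phi> x *\<^sub>R (g x + (-1) *\<^sub>R h x)) = 0" using e by simp
  qed
  then show ?thesis by eventually_elim simp
qed

lemma weak_grad_is_weak_grad: "is_weak_grad v g \<Longrightarrow> is_weak_grad v (weak_grad v)"
  unfolding weak_grad_def by (rule someI[of "is_weak_grad v"])

lemma weak_grad_AE_eq: "is_weak_grad v g \<Longrightarrow> AE x in lebesgue. weak_grad v x = g x"
  using weak_grad_unique_on[OF open_UNIV weak_grad_is_weak_grad, of v g v g] by simp

lemma is_weak_grad_axpy:
  fixes v w :: "real ^ 'd \<Rightarrow> real"
  assumes g: "is_weak_grad v g" and h: "is_weak_grad w h"
  shows "is_weak_grad (\<lambda>x. v x + s * w x) (\<lambda>x. g x + s *\<^sub>R h x)"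
  unfolding is_weak_grad_def
proof (intro conjI allI impI)
  have lg: "locally_integrable g" "locally_integrable v" and lh: "locally_integrable h" "locally_integrable w"
    using g h by (auto simp: is_weak_grad_def)
  show "locally_integrable (\<lambda>x. v x + s * w x)" using locally_integrable_axpy[OF lg(2) lh(2), of s] by simp
  show "locally_integrable (\<lambda>x. g x + s *\<^sub>R h x)" by (rule locally_integrable_axpy[OF lg(1) lh(1)])
  fix \<phi> :: "real ^ 'd \<Rightarrow> real" and \<psi> assume test: "(\<forall>x. GDERIV \<phi> x :> \<psi> x) \<and> continuous_on UNIV \<psi> \<and> (\<exists>K. compact K \<and> (\<forall>x. x \<notin> K \<longrightarrow> \<phi> x = 0))"
  then obtain K where K: "compact K" "\<And>x. x \<notin> K \<Longrightarrow> \<phi> x = 0" by blast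
  have \<psi>: "\<And>x. GDERIV \<phi> x :> \<psi> x" "continuous_on UNIV \<psi>" using test by auto
  have \<psi>0: "\<psi> x = 0" if "x \<notin> K" for x
    by (rule gradient_zero_off_support[OF \<psi>(1) compact_imp_closed[OF K(1)] K(2) that])
  have c: "continuous_on UNIV \<psi>" "continuous_on UNIV \<phi>"
    using test C1_continuous[of \<phi>] by (auto simp: C1_def)
  have "(LINT x|lebesgue. (v x + s * w x) *\<^sub>R \<psi> x) = (LINT x|lebesgue. v x *\<^sub>R \<psi> x + s *\<^sub>R (w x *\<^sub>R \<psi> x))"
    by (simp add: scaleR_add_left)
  also have "\<dots> = (LINT x|lebesgue. v x *\<^sub>R \<psi> x) + (LINT x|lebesgue. s *\<^sub>R (w x *\<^sub>R \<psi> x))"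
    by (intro Bochner_Integration.integral_add integrable_scaleR_right integrable_scaleR_test[OF _ c(1) K(1) \<psi>0] lg lh)
  also have "\<dots> = (LINT x|lebesgue. v x *\<^sub>R \<psi> x) + s *\<^sub>R (LINT x|lebesgue. w x *\<^sub>R \<psi> x)"
    by (simp only: integral_scaleR_right)
  also have "\<dots> = - (LINT x|lebesgue. \<phi> x *\<^sub>R g x) + s *\<^sub>R (- (LINT x|lebesgue. \<phi> x *\<^sub>R h x))"
    by (subst weak_grad_test[OF g \<psi> K], assumption, subst weak_grad_test[OF h \<psi> K], assumption, rule refl)
  also have "\<dots> = - ((LINT x|lebesgue. \<phi> x *\<^sub>R g x) + (LINT x|lebesgue. s *\<^sub>R (\<phi> x *\<^sub>R h x)))"
    by (simp only: integral_scaleR_right) simp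
  also have "(LINT x|lebesgue. \<phi> x *\<^sub>R g x) + (LINT x|lebesgue. s *\<^sub>R (\<phi> x *\<^sub>R h x))
      = (LINT x|lebesgue. \<phi> x *\<^sub>R g x + s *\<^sub>R (\<phi> x *\<^sub>R h x))"
    by (intro Bochner_Integration.integral_add[symmetric] integrable_scaleR_right integrable_test_scaleR[OF _ c(2) K] lg lh)
  also have "\<dots> = (LINT x|lebesgue. \<phi> x *\<^sub>R (g x + s *\<^sub>R h x))"
    by (simp add: scaleR_add_right mult.commute)
  finally show "(LINT x|lebesgue. (v x + s * w x) *\<^sub>R \<psi> x) = - (LINT x|lebesgue. \<phi> x *\<^sub>R (g x + s *\<^sub>R h x))" .
qed

lemma locally_integrable_translation:
  fixes f :: "real ^ 'd \<Rightarrow> 'b::euclidean_space"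
  assumes f: "locally_integrable f"
  shows "locally_integrable (\<lambda>x. f (x + k))"
  unfolding locally_integrable_def
proof (intro conjI allI impI)
  have fm: "f \<in> borel_measurable lebesgue" using f by (simp add: locally_integrable_def)
  then show "(\<lambda>x. f (x + k)) \<in> borel_measurable lebesgue" by (rule measurable_translation)
  fix K :: "(real ^ 'd) set" assume K: "compact K"
  have K': "compact ((+) k ` K)" using K by (rule compact_translation)
  have iff: "x + k \<in> (+) k ` K \<longleftrightarrow> x \<in> K" for x by (auto simp: image_iff add.commute)
  have "integrable lebesgue (\<lambda>x. indicator ((+) k ` K) x *\<^sub>R f x)"
    using f K' by (simp add: locally_integrable_def set_integrable_def)
  then have "integrable lebesgue (\<lambda>x. indicator ((+) k ` K) (x + k) *\<^sub>R f (x + k))"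
    by (subst integral_translation(2)[where t = k]) (auto intro: borel_measurable_integrable)
  then show "set_integrable lebesgue K (\<lambda>x. f (x + k))"
    by (simp add: set_integrable_def indicator_def iff)
qed

lemma is_weak_grad_translation:
  fixes v :: "real ^ 'd \<Rightarrow> real"
  assumes g: "is_weak_grad v g"
  shows "is_weak_grad (\<lambda>x. v (x + k)) (\<lambda>x. g (x + k))"
  unfolding is_weak_grad_def
proof (intro conjI allI impI)
  have l: "locally_integrable v" "locally_integrable g" using g by (auto simp: is_weak_grad_def)
  show "locally_integrable (\<lambda>x. v (x + k))" "locally_integrable (\<lambda>x. g (x + k))"
    using l by (auto intro: locally_integrable_translation)
  fix \<phi> :: "real ^ 'd \<Rightarrow> real" and \<psi> assume test: "(\<forall>x. GDERIV \<phi> x :> \<psi> x) \<and> continuous_on UNIV \<psi> \<and> (\<exists>K. compact K \<and> (\<forall>x. x \<notin> K \<longrightarrow> \<phi> x = 0))"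
  then obtain K where K: "compact K" "\<And>x. x \<notin> K \<Longrightarrow> \<phi> x = 0" by blast
  have c: "continuous_on UNIV \<psi>" "continuous_on UNIV \<phi>"
    using test C1_continuous[of \<phi>] by (auto simp: C1_def)
  have t1: "GDERIV (\<lambda>x. \<phi> (x - k)) x :> \<psi> (x - k)" for x
  proof -
    have "(\<phi> has_derivative (\<lambda>h. h \<bullet> \<psi> (x - k))) (at (x - k))" using test by (simp add: gderiv_def)
    moreover have "((\<lambda>x. x - k) has_derivative (\<lambda>h. h)) (at x)" by (auto intro!: derivative_eq_intros)
    ultimately have "((\<lambda>x. \<phi> (x - k)) has_derivative (\<lambda>h. h \<bullet> \<psi> (x - k))) (at x)"
      by (rule has_derivative_compose[rotated])
    then show ?thesis by (simp add: gderiv_def)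
  qed
  have t2: "continuous_on UNIV (\<lambda>x. \<psi> (x - k))"
    by (rule continuous_on_compose2[OF c(1)]) (auto intro: continuous_intros)
  have t3: "compact ((+) k ` K)" by (rule compact_translation[OF K(1)])
  have t4: "\<phi> (x - k) = 0" if "x \<notin> (+) k ` K" for x
  proof (rule K(2))
    show "x - k \<notin> K" using that by (auto simp: image_iff)
  qed
  have m: "(\<lambda>x. v x *\<^sub>R \<psi> (x - k)) \<in> borel_measurable lebesgue" "(\<lambda>x. \<phi> (x - k) *\<^sub>R g x) \<in> borel_measurable lebesgue"
    using l measurable_translation[OF continuous_lebesgue_measurable[OF c(1)], of "-k"]
      measurable_translation[OF continuous_lebesgue_measurable[OF c(2)], of "-k"]
    by (auto simp: locally_integrable_def intro!: borel_measurable_scaleR)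
  have "(LINT x|lebesgue. v (x + k) *\<^sub>R \<psi> x) = (LINT x|lebesgue. v x *\<^sub>R \<psi> (x - k))"
    using integral_translation(1)[OF m(1), of k] by simp
  also have "\<dots> = - (LINT x|lebesgue. \<phi> (x - k) *\<^sub>R g x)"
    by (rule weak_grad_test[OF g t1 t2 t3 t4])
  also have "(LINT x|lebesgue. \<phi> (x - k) *\<^sub>R g x) = (LINT x|lebesgue. \<phi> x *\<^sub>R g (x + k))"
    using integral_translation(1)[OF m(2), of k] by simp
  finally show "(LINT x|lebesgue. v (x + k) *\<^sub>R \<psi> x) = - (LINT x|lebesgue. \<phi> x *\<^sub>R g (x + k))" .
qed

text \<open>A translated gradient is the gradient of the translated function, so this follows from uniqueness.\<close>

lemma weak_grad_periodic:
  assumes g: "is_weak_grad v g" and per: "ae_periodic v" and k: "k \<in> int_vecs"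
  shows "AE x in lebesgue. g (x + k) = g x"
  using weak_grad_unique_on[OF open_UNIV is_weak_grad_translation[OF g, of k] g] per k
  by (simp add: ae_periodic_def)

section \<open>Square-integrable fields\<close>

lemma square_integrable_axpy:
  fixes f g :: "real ^ 'd \<Rightarrow> 'b::euclidean_space"
  assumes S[measurable]: "S \<in> sets lebesgue" and f: "square_integrable_on f S" and g: "square_integrable_on g S"
  shows "square_integrable_on (\<lambda>x. f x + s *\<^sub>R g x) S"
proof -
  have [measurable]: "f \<in> borel_measurable lebesgue" "g \<in> borel_measurable lebesgue"
    using f g by (auto simp: square_integrable_on_def)
  have "set_integrable lebesgue S (\<lambda>x. 2 * (norm (f x))\<^sup>2 + 2 * s\<^sup>2 * (norm (g x))\<^sup>2)"
    using f g by (intro set_integral_add set_integrable_mult_right) (auto simp: square_integrable_on_def)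
  then have i: "integrable lebesgue (\<lambda>x. indicator S x *\<^sub>R (2 * (norm (f x))\<^sup>2 + 2 * s\<^sup>2 * (norm (g x))\<^sup>2))"
    by (simp add: set_integrable_def)
  have le: "(norm (f x + s *\<^sub>R g x))\<^sup>2 \<le> 2 * (norm (f x))\<^sup>2 + 2 * s\<^sup>2 * (norm (g x))\<^sup>2" for x
  proof -
    have "(norm (f x + s *\<^sub>R g x))\<^sup>2 \<le> (norm (f x) + \<bar>s\<bar> * norm (g x))\<^sup>2"
      using norm_triangle_ineq[of "f x" "s *\<^sub>R g x"] by (intro power_mono) auto
    moreover have "0 \<le> (norm (f x) - \<bar>s\<bar> * norm (g x))\<^sup>2" by simp
    ultimately show ?thesis by (simp add: power2_sum power2_diff power_mult_distrib)
  qed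
  show ?thesis
    unfolding square_integrable_on_def set_integrable_def
  proof
    show "integrable lebesgue (\<lambda>x. indicator S x *\<^sub>R (norm (f x + s *\<^sub>R g x))\<^sup>2)"
    proof (rule Bochner_Integration.integrable_bound[OF i])
      show "AE x in lebesgue. norm (indicator S x *\<^sub>R (norm (f x + s *\<^sub>R g x))\<^sup>2)
          \<le> norm (indicator S x *\<^sub>R (2 * (norm (f x))\<^sup>2 + 2 * s\<^sup>2 * (norm (g x))\<^sup>2))"
        using le by (intro AE_I2) (auto simp: indicator_def intro: order_trans[OF _ abs_ge_self])
    qed measurable
  qed measurable
qed

lemma square_integrable_subset:
  "square_integrable_on f S \<Longrightarrow> T \<in> sets lebesgue \<Longrightarrow> T \<subseteq> S \<Longrightarrow> square_integrable_on f T"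
  by (auto simp: square_integrable_on_def intro: set_integrable_subset)

lemma square_integrable_imp_integrable:
  fixes f :: "real ^ 'd \<Rightarrow> 'b::euclidean_space"
  assumes f: "square_integrable_on f unit_cell"
  shows "set_integrable lebesgue unit_cell f"
  unfolding set_integrable_def
proof (rule Bochner_Integration.integrable_bound)
  have "set_integrable lebesgue unit_cell (\<lambda>x. 1 :: real)"
    using lmeasurable_compact[OF compact_unit_cell]
    by (simp add: set_integrable_def lmeasurable_iff_integrable)
  then show "integrable lebesgue (\<lambda>x. indicator unit_cell x *\<^sub>R (1 + (norm (f x))\<^sup>2))"
    using f set_integral_add(1)[of lebesgue unit_cell "\<lambda>x. 1 :: real" "\<lambda>x. (norm (f x))\<^sup>2"]
    by (simp add: square_integrable_on_def set_integrable_def)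
  have "norm (f x) \<le> 1 + (norm (f x))\<^sup>2" for x
    using zero_le_power2[of "norm (f x) - 1"] norm_ge_zero[of "f x"] unfolding power2_diff power_one by linarith
  then show "AE x in lebesgue. norm (indicator unit_cell x *\<^sub>R f x) \<le> norm (indicator unit_cell x *\<^sub>R (1 + (norm (f x))\<^sup>2))"
    by (intro AE_I2) (auto simp: indicator_def intro: order_trans[OF _ abs_ge_self])
qed (use f in \<open>auto simp: square_integrable_on_def\<close>)

lemma periodic_locally_integrable:
  fixes f :: "real ^ 'd \<Rightarrow> 'b::euclidean_space"
  assumes f: "f \<in> borel_measurable lebesgue" "set_integrable lebesgue unit_cell f"
    and per: "\<And>k. k \<in> int_vecs \<Longrightarrow> AE x in lebesgue. f (x + k) = f x"
  shows "locally_integrable f"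
  unfolding locally_integrable_def
proof (intro conjI allI impI)
  show "f \<in> borel_measurable lebesgue" by fact
  fix K :: "(real ^ 'd) set" assume K: "compact K"
  obtain n :: nat where n: "\<And>f. f \<in> borel_measurable lebesgue \<Longrightarrow> (\<forall>k\<in>int_vecs. AE x in lebesgue. f (x + k) = f x) \<Longrightarrow>
    (\<integral>\<^sup>+x. indicator K x * f x \<partial>lebesgue) \<le> of_nat n * (\<integral>\<^sup>+x. indicator unit_cell x * f x \<partial>lebesgue)"
    using nn_integral_compact_le_cell[OF K] by blast
  have "(\<integral>\<^sup>+x. indicator K x * ennreal (norm (f x)) \<partial>lebesgue)
    \<le> of_nat n * (\<integral>\<^sup>+x. indicator unit_cell x * ennreal (norm (f x)) \<partial>lebesgue)"
  proof (rule n)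
    show "\<forall>k\<in>int_vecs. AE x in lebesgue. ennreal (norm (f (x + k))) = ennreal (norm (f x))"
    proof
      fix k :: "real ^ 'd" assume "k \<in> int_vecs"
      from per[OF this] show "AE x in lebesgue. ennreal (norm (f (x + k))) = ennreal (norm (f x))"
        by eventually_elim simp
    qed
  qed (use f in measurable)
  also have "\<dots> < \<infinity>"
  proof -
    have "(\<integral>\<^sup>+x. ennreal (norm (indicator unit_cell x *\<^sub>R f x)) \<partial>lebesgue) < \<infinity>"
      using f(2) by (simp add: set_integrable_def integrable_iff_bounded)
    moreover have "ennreal (norm (indicator unit_cell x *\<^sub>R f x)) = indicator unit_cell x * ennreal (norm (f x))" for x
      by (simp add: indicator_def)
    ultimately show ?thesis by (simp add: ennreal_mult_less_top of_nat_less_top)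
  qed
  finally have "(\<integral>\<^sup>+x. indicator K x * ennreal (norm (f x)) \<partial>lebesgue) < \<infinity>" .
  moreover have "ennreal (norm (indicator K x *\<^sub>R f x)) = indicator K x * ennreal (norm (f x))" for x
      by (simp add: indicator_def)
  moreover have "(\<lambda>x. indicator K x *\<^sub>R f x) \<in> borel_measurable lebesgue"
    using f(1) K by (intro borel_measurable_scaleR borel_measurable_indicator) (auto intro: fmeasurableD lmeasurable_compact)
  ultimately show "set_integrable lebesgue K f"
    by (simp add: set_integrable_def integrable_iff_bounded)
qed

section \<open>The periodic Sobolev space\<close>

lemma H1_per0D:
  assumes "v \<in> H1_per0"
  shows "ae_periodic v" "square_integrable_on v unit_cell" "is_weak_grad v (weak_grad v)"
    "square_integrable_on (weak_grad v) unit_cell" "(LINT x:unit_cell|lebesgue. v x) = 0"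
proof -
  obtain g where g: "is_weak_grad v g" "square_integrable_on g unit_cell" using assms by (auto simp: H1_per0_def)
  show "ae_periodic v" "square_integrable_on v unit_cell" "(LINT x:unit_cell|lebesgue. v x) = 0"
    using assms by (auto simp: H1_per0_def)
  show wg: "is_weak_grad v (weak_grad v)" by (rule weak_grad_is_weak_grad[OF g(1)])
  have m: "weak_grad v \<in> borel_measurable lebesgue" "g \<in> borel_measurable lebesgue"
    using wg g(1) by (auto simp: is_weak_grad_def locally_integrable_def)
  have ae: "AE x in lebesgue. x \<in> unit_cell \<longrightarrow> (norm (weak_grad v x))\<^sup>2 = (norm (g x))\<^sup>2"
    using weak_grad_AE_eq[OF g(1)] by eventually_elim simp
  have "set_integrable lebesgue unit_cell (\<lambda>x. (norm (weak_grad v x))\<^sup>2)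
      = set_integrable lebesgue unit_cell (\<lambda>x. (norm (g x))\<^sup>2)"
    by (rule set_integrable_cong_AE) (use m ae in measurable)
  then show "square_integrable_on (weak_grad v) unit_cell"
    using g(2) m by (simp add: square_integrable_on_def)
qed

lemma H1_per0I:
  assumes "ae_periodic v" "square_integrable_on v unit_cell" "is_weak_grad v g"
    "square_integrable_on g unit_cell" "(LINT x:unit_cell|lebesgue. v x) = 0"
  shows "v \<in> H1_per0"
  using assms by (auto simp: H1_per0_def)

lemma H1_axpy:
  assumes u: "u \<in> H1_per0" and v: "v \<in> H1_per0"
  shows "(\<lambda>x. u x + s * v x) \<in> H1_per0"
    and "AE x in lebesgue. weak_grad (\<lambda>x. u x + s * v x) x = weak_grad u x + s *\<^sub>R weak_grad v x"
proof -
  note U = H1_per0D[OF u] and V = H1_per0D[OF v]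
  note wg = is_weak_grad_axpy[OF U(3) V(3), of s]
  show "AE x in lebesgue. weak_grad (\<lambda>x. u x + s * v x) x = weak_grad u x + s *\<^sub>R weak_grad v x"
    by (rule weak_grad_AE_eq[OF wg])
  show "(\<lambda>x. u x + s * v x) \<in> H1_per0"
  proof (rule H1_per0I[OF _ _ wg])
    show "ae_periodic (\<lambda>x. u x + s * v x)"
      unfolding ae_periodic_def
    proof
      fix k :: "real ^ 'a" assume "k \<in> int_vecs"
      then have "AE x in lebesgue. u (x + k) = u x" "AE x in lebesgue. v (x + k) = v x"
        using U(1) V(1) by (auto simp: ae_periodic_def)
      then show "AE x in lebesgue. u (x + k) + s * v (x + k) = u x + s * v x" by eventually_elim simp
    qed
    show "square_integrable_on (\<lambda>x. u x + s * v x) unit_cell"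
      using square_integrable_axpy[OF unit_cell_sets U(2) V(2), of s] by simp
    show "square_integrable_on (\<lambda>x. weak_grad u x + s *\<^sub>R weak_grad v x) unit_cell"
      by (rule square_integrable_axpy[OF unit_cell_sets U(4) V(4)])
    have "(LINT x:unit_cell|lebesgue. u x + s * v x) = (LINT x:unit_cell|lebesgue. u x) + (LINT x:unit_cell|lebesgue. s * v x)"
      by (intro set_integral_add set_integrable_mult_right square_integrable_imp_integrable U V)
    then show "(LINT x:unit_cell|lebesgue. u x + s * v x) = 0" using U(5) V(5) by simp
  qed
qed

lemma is_weak_grad_zero: "is_weak_grad (\<lambda>x. 0) (\<lambda>x. 0)"
  by (auto simp: is_weak_grad_def locally_integrable_def set_integrable_def)

lemma H1_zero: "(\<lambda>x. 0) \<in> H1_per0"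
  by (rule H1_per0I[OF _ _ is_weak_grad_zero])
    (auto simp: ae_periodic_def square_integrable_on_def set_integrable_def set_lebesgue_integral_def)

lemma weak_grad_zero: "AE x in lebesgue. weak_grad (\<lambda>x. 0) x = 0"
  by (rule weak_grad_AE_eq[OF is_weak_grad_zero])

lemma H1_add:
  assumes "u \<in> H1_per0" "v \<in> H1_per0"
  shows "(\<lambda>x. u x + v x) \<in> H1_per0"
    and "AE x in lebesgue. weak_grad (\<lambda>x. u x + v x) x = weak_grad u x + weak_grad v x"
  using H1_axpy[OF assms, of 1] by simp_all

lemma H1_scale:
  assumes v: "v \<in> H1_per0"
  shows "(\<lambda>x. s * v x) \<in> H1_per0"
    and "AE x in lebesgue. weak_grad (\<lambda>x. s * v x) x = s *\<^sub>R weak_grad v x"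
proof -
  show "(\<lambda>x. s * v x) \<in> H1_per0" using H1_axpy(1)[OF H1_zero v, of s] by simp
  have "AE x in lebesgue. weak_grad (\<lambda>x. 0 + s * v x) x = weak_grad (\<lambda>x. 0) x + s *\<^sub>R weak_grad v x"
    by (rule H1_axpy(2)[OF H1_zero v])
  then show "AE x in lebesgue. weak_grad (\<lambda>x. s * v x) x = s *\<^sub>R weak_grad v x"
    using weak_grad_zero by eventually_elim simp
qed

lemma H1_diff:
  assumes u: "u \<in> H1_per0" and v: "v \<in> H1_per0"
  shows "(\<lambda>x. u x - v x) \<in> H1_per0"
    and "AE x in lebesgue. weak_grad (\<lambda>x. u x - v x) x = weak_grad u x - weak_grad v x"
  using H1_axpy[OF u v, of "-1"] by simp_all

lemma weak_grad_zero_on: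
  assumes v: "v \<in> H1_per0" and U: "open U" "AE x in lebesgue. x \<in> U \<longrightarrow> v x = 0"
  shows "AE x in lebesgue. x \<in> U \<longrightarrow> weak_grad v x = 0"
  by (rule weak_grad_unique_on[OF U(1) H1_per0D(3)[OF v] is_weak_grad_zero U(2)])

lemma H1_AE_zero_from_cell:
  assumes v: "v \<in> H1_per0" and "AE x in lebesgue. x \<in> unit_cell \<longrightarrow> v x = 0"
  shows "AE x in lebesgue. v x = 0"
proof (rule AE_from_cell[OF assms(2)])
  fix k :: "real ^ 'a" assume "k \<in> int_vecs"
  then have "AE x in lebesgue. v (x + k) = v x" using H1_per0D(1)[OF v] by (auto simp: ae_periodic_def)
  then show "AE x in lebesgue. v x = 0 \<longrightarrow> v (x + k) = 0" by eventually_elim simp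
qed

lemma measure_unit_cell: "measure lebesgue (unit_cell :: (real ^ 'd) set) = 1"
proof -
  have "cbox 0 1 \<noteq> ({} :: (real ^ 'd) set)" by (simp add: interval_ne_empty_cart)
  then show ?thesis by (simp add: unit_cell_def content_cbox_cart)
qed

text \<open>On a set of measure one the variance of \<open>norm f\<close> is nonnegative.\<close>

lemma L1_le_L2_unit_cell:
  fixes f :: "real ^ 'd \<Rightarrow> 'b::euclidean_space"
  assumes f: "square_integrable_on f unit_cell"
  shows "(LINT x:unit_cell|lebesgue. norm (f x)) \<le> sqrt (LINT x:unit_cell|lebesgue. (norm (f x))\<^sup>2)"
proof -
  define m where "m = (LINT x:unit_cell|lebesgue. norm (f x))"
  have i1: "set_integrable lebesgue unit_cell (\<lambda>x. norm (f x))"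
    using set_integrable_norm[OF square_integrable_imp_integrable[OF f]] .
  have i2: "set_integrable lebesgue unit_cell (\<lambda>x. (norm (f x))\<^sup>2)"
    using f by (simp add: square_integrable_on_def)
  have lm: "(unit_cell :: (real ^ 'd) set) \<in> lmeasurable" by (rule lmeasurable_compact[OF compact_unit_cell])
  have i0: "set_integrable lebesgue (unit_cell :: (real ^ 'd) set) (\<lambda>x. c)" for c :: real
    using lm by (simp add: set_integrable_def lmeasurable_iff_integrable)
  have c: "(LINT x:(unit_cell :: (real ^ 'd) set)|lebesgue. c) = c" for c :: real
    by (simp add: set_lebesgue_integral_def measure_unit_cell)
  have "0 \<le> (LINT x:unit_cell|lebesgue. (norm (f x) - m)\<^sup>2)"
    by (simp add: set_lebesgue_integral_def)
  also have "\<dots> = (LINT x:unit_cell|lebesgue. (norm (f x))\<^sup>2 + ((- 2 * m) * norm (f x) + m\<^sup>2))"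
    by (simp add: power2_diff algebra_simps)
  also have "\<dots> = (LINT x:unit_cell|lebesgue. (norm (f x))\<^sup>2) + ((LINT x:unit_cell|lebesgue. (- 2 * m) * norm (f x)) + (LINT x:(unit_cell :: (real ^ 'd) set)|lebesgue. m\<^sup>2))"
    by (subst set_integral_add(2)[OF i2 set_integral_add(1)[OF set_integrable_mult_right[OF i1] i0]],
        subst set_integral_add(2)[OF set_integrable_mult_right[OF i1] i0], rule refl)
  also have "\<dots> = (LINT x:unit_cell|lebesgue. (norm (f x))\<^sup>2) - m\<^sup>2"
    by (simp only: set_integral_mult_right m_def[symmetric] c) (simp add: power2_eq_square)
  finally have "m\<^sup>2 \<le> (LINT x:unit_cell|lebesgue. (norm (f x))\<^sup>2)" by simp
  then show ?thesis unfolding m_def[symmetric] by (rule real_le_rsqrt)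
qed

lemma compact_L1_le_cell:
  fixes K :: "(real ^ 'd) set"
  assumes K: "compact K"
  shows "\<exists>n::nat. \<forall>f :: real ^ 'd \<Rightarrow> 'b::euclidean_space. f \<in> borel_measurable lebesgue \<longrightarrow>
    set_integrable lebesgue unit_cell f \<longrightarrow> (\<forall>k\<in>int_vecs. AE x in lebesgue. f (x + k) = f x) \<longrightarrow>
    (LINT x:K|lebesgue. norm (f x)) \<le> real n * (LINT x:unit_cell|lebesgue. norm (f x))"
proof -
  obtain n :: nat where n: "\<And>f. f \<in> borel_measurable lebesgue \<Longrightarrow> (\<forall>k\<in>int_vecs. AE x in lebesgue. f (x + k) = f x) \<Longrightarrow>
    (\<integral>\<^sup>+x. indicator K x * f x \<partial>lebesgue) \<le> of_nat n * (\<integral>\<^sup>+x. indicator unit_cell x * f x \<partial>lebesgue)"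
    using nn_integral_compact_le_cell[OF K] by blast
  show ?thesis
  proof (intro exI[of _ n] allI impI)
    fix f :: "real ^ 'd \<Rightarrow> 'b"
    assume f: "f \<in> borel_measurable lebesgue" "set_integrable lebesgue unit_cell f"
      and per: "\<forall>k\<in>int_vecs. AE x in lebesgue. f (x + k) = f x"
    have iK: "set_integrable lebesgue K (\<lambda>x. norm (f x))"
      using periodic_locally_integrable[OF f] per K by (auto simp: locally_integrable_def intro: set_integrable_norm)
    have iC: "set_integrable lebesgue unit_cell (\<lambda>x. norm (f x))" by (rule set_integrable_norm[OF f(2)])
    have eq: "(\<integral>\<^sup>+x. indicator S x * ennreal (norm (f x)) \<partial>lebesgue) = ennreal (LINT x:S|lebesgue. norm (f x))"
      if "set_integrable lebesgue S (\<lambda>x. norm (f x))" for S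
    proof -
      have "(\<integral>\<^sup>+x. ennreal (indicator S x *\<^sub>R norm (f x)) \<partial>lebesgue) = ennreal (LINT x|lebesgue. indicator S x *\<^sub>R norm (f x))"
        using that by (intro nn_integral_eq_integral) (auto simp: set_integrable_def)
      moreover have "ennreal (indicator S x *\<^sub>R norm (f x)) = indicator S x * ennreal (norm (f x))" for x
        by (simp add: indicator_def)
      ultimately show ?thesis by (simp add: set_lebesgue_integral_def)
    qed
    have "\<forall>k\<in>int_vecs. AE x in lebesgue. ennreal (norm (f (x + k))) = ennreal (norm (f x))"
    proof
      fix k :: "real ^ 'd" assume "k \<in> int_vecs"
      from bspec[OF per this] show "AE x in lebesgue. ennreal (norm (f (x + k))) = ennreal (norm (f x))"
        by eventually_elim simp
    qed
    from n[OF _ this] f(1)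
    have "ennreal (LINT x:K|lebesgue. norm (f x)) \<le> of_nat n * ennreal (LINT x:unit_cell|lebesgue. norm (f x))"
      unfolding eq[OF iK, symmetric] eq[OF iC, symmetric] by measurable
    also have "\<dots> = ennreal (real n * (LINT x:unit_cell|lebesgue. norm (f x)))"
      by (simp add: ennreal_mult' ennreal_of_nat_eq_real_of_nat)
    finally show "(LINT x:K|lebesgue. norm (f x)) \<le> real n * (LINT x:unit_cell|lebesgue. norm (f x))"
      by (subst (asm) ennreal_le_iff) (auto simp: set_lebesgue_integral_def)
  qed
qed

text \<open>Square-mean convergence on the cell gives mean convergence on every compact set, by periodicity; this is
  what integrals against compactly supported bounded weights need.\<close>

lemma periodic_L2_null_tested:
  fixes D :: "nat \<Rightarrow> real ^ 'd \<Rightarrow> 'b::euclidean_space" and E :: "nat \<Rightarrow> real ^ 'd \<Rightarrow> 'c::euclidean_space"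
  assumes K: "compact K" and D: "\<And>n. square_integrable_on (D n) unit_cell"
    and per: "\<And>n k. k \<in> int_vecs \<Longrightarrow> AE x in lebesgue. D n (x + k) = D n x"
    and lim: "(\<lambda>n. LINT x:unit_cell|lebesgue. (norm (D n x))\<^sup>2) \<longlonglongrightarrow> 0"
    and E: "\<And>n. E n \<in> borel_measurable lebesgue" "\<And>n x. norm (E n x) \<le> M * indicator K x * norm (D n x)"
  shows "(\<lambda>n. LINT x|lebesgue. E n x) \<longlonglongrightarrow> 0"
proof -
  obtain N :: nat where N: "\<And>f :: real ^ 'd \<Rightarrow> 'b. f \<in> borel_measurable lebesgue \<Longrightarrow>
    set_integrable lebesgue unit_cell f \<Longrightarrow> (\<forall>k\<in>int_vecs. AE x in lebesgue. f (x + k) = f x) \<Longrightarrow>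
    (LINT x:K|lebesgue. norm (f x)) \<le> real N * (LINT x:unit_cell|lebesgue. norm (f x))"
    using compact_L1_le_cell[OF K, where 'b = 'b] by blast
  have Dm: "D n \<in> borel_measurable lebesgue" for n using D[of n] by (simp add: square_integrable_on_def)
  have Di: "set_integrable lebesgue unit_cell (D n)" for n by (rule square_integrable_imp_integrable[OF D])
  have Dl: "locally_integrable (D n)" for n by (rule periodic_locally_integrable[OF Dm Di per])
  have bound: "norm (LINT x|lebesgue. E n x) \<le> \<bar>M\<bar> * (real N * sqrt (LINT x:unit_cell|lebesgue. (norm (D n x))\<^sup>2))" for n
  proof -
    have DK: "set_integrable lebesgue K (\<lambda>x. norm (D n x))"
      using Dl[of n] K unfolding locally_integrable_def by (auto intro: set_integrable_norm)
    have "norm (LINT x|lebesgue. E n x) \<le> (LINT x|lebesgue. norm (E n x))" by (rule integral_norm_bound)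
    also have "\<dots> \<le> (LINT x|lebesgue. \<bar>M\<bar> * (indicator K x *\<^sub>R norm (D n x)))"
    proof (rule integral_mono)
      show "integrable lebesgue (\<lambda>x. norm (E n x))"
        by (rule integrable_norm[OF integrable_of_bound_on_compact[OF Dl K E]])
      show "integrable lebesgue (\<lambda>x. \<bar>M\<bar> * (indicator K x *\<^sub>R norm (D n x)))"
        using DK unfolding set_integrable_def by (rule integrable_mult_right)
      fix x
      have "norm (E n x) \<le> M * (indicator K x * norm (D n x))" using E(2)[of n x] by (simp add: mult.assoc)
      also have "\<dots> \<le> \<bar>M\<bar> * (indicator K x * norm (D n x))" by (intro mult_right_mono) auto
      finally show "norm (E n x) \<le> \<bar>M\<bar> * (indicator K x *\<^sub>R norm (D n x))" by simp
    qed
    also have "\<dots> = \<bar>M\<bar> * (LINT x:K|lebesgue. norm (D n x))"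
      unfolding set_lebesgue_integral_def by (rule integral_mult_right_zero)
    also have "\<dots> \<le> \<bar>M\<bar> * (real N * (LINT x:unit_cell|lebesgue. norm (D n x)))"
      using N[OF Dm Di] per by (intro mult_left_mono) auto
    also have "\<dots> \<le> \<bar>M\<bar> * (real N * sqrt (LINT x:unit_cell|lebesgue. (norm (D n x))\<^sup>2))"
      using L1_le_L2_unit_cell[OF D] by (intro mult_left_mono) auto
    finally show ?thesis .
  qed
  have "(\<lambda>n. \<bar>M\<bar> * (real N * sqrt (LINT x:unit_cell|lebesgue. (norm (D n x))\<^sup>2))) \<longlonglongrightarrow> \<bar>M\<bar> * (real N * sqrt 0)"
    by (intro tendsto_mult tendsto_const tendsto_real_sqrt lim)
  then have l0: "(\<lambda>n. \<bar>M\<bar> * (real N * sqrt (LINT x:unit_cell|lebesgue. (norm (D n x))\<^sup>2))) \<longlonglongrightarrow> 0" by simp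
  show ?thesis
    by (rule Lim_null_comparison[OF always_eventually l0]) (use bound in blast)
qed

lemma is_weak_grad_L2_limit:
  fixes w :: "nat \<Rightarrow> real ^ 'd \<Rightarrow> real"
  assumes w: "\<And>n. w n \<in> H1_per0"
    and u: "square_integrable_on u unit_cell" "\<And>k. k \<in> int_vecs \<Longrightarrow> AE x in lebesgue. u (x + k) = u x"
    and g: "square_integrable_on g unit_cell" "\<And>k. k \<in> int_vecs \<Longrightarrow> AE x in lebesgue. g (x + k) = g x"
    and lu: "(\<lambda>n. LINT x:unit_cell|lebesgue. (norm (w n x - u x))\<^sup>2) \<longlonglongrightarrow> 0"
    and lg: "(\<lambda>n. LINT x:unit_cell|lebesgue. (norm (weak_grad (w n) x - g x))\<^sup>2) \<longlonglongrightarrow> 0"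
  shows "is_weak_grad u g" and "(LINT x:unit_cell|lebesgue. u x) = 0"
proof -
  note W = H1_per0D[OF w]
  have um: "u \<in> borel_measurable lebesgue" and gm: "g \<in> borel_measurable lebesgue"
    using u g by (auto simp: square_integrable_on_def)
  have wm: "w n \<in> borel_measurable lebesgue" and wgm: "weak_grad (w n) \<in> borel_measurable lebesgue" for n
    using W(2,4)[of n] by (auto simp: square_integrable_on_def)
  have Du: "square_integrable_on (\<lambda>x. w n x - u x) unit_cell" for n
    using square_integrable_axpy[OF unit_cell_sets W(2) u(1), of n "-1"] by simp
  have Dg: "square_integrable_on (\<lambda>x. weak_grad (w n) x - g x) unit_cell" for n
    using square_integrable_axpy[OF unit_cell_sets W(4) g(1), of n "-1"] by simp
  have Pu: "AE x in lebesgue. w n (x + k) - u (x + k) = w n x - u x" if k: "k \<in> int_vecs" for n k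
  proof -
    have "AE x in lebesgue. w n (x + k) = w n x" using W(1)[of n] k by (auto simp: ae_periodic_def)
    then show ?thesis using u(2)[OF k] by eventually_elim simp
  qed
  have Pg: "AE x in lebesgue. weak_grad (w n) (x + k) - g (x + k) = weak_grad (w n) x - g x" if k: "k \<in> int_vecs" for n k
    using weak_grad_periodic[OF W(3,1) k, of n] g(2)[OF k] by eventually_elim simp
  have lu': "locally_integrable u"
    by (rule periodic_locally_integrable[OF um square_integrable_imp_integrable[OF u(1)] u(2)])
  have lg': "locally_integrable g"
    by (rule periodic_locally_integrable[OF gm square_integrable_imp_integrable[OF g(1)] g(2)])
  have lw: "locally_integrable (w n)" "locally_integrable (weak_grad (w n))" for n
    using W(3)[of n] by (auto simp: is_weak_grad_def)
  show "is_weak_grad u g"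
    unfolding is_weak_grad_def
  proof (intro conjI allI impI lu' lg')
    fix \<phi> :: "real ^ 'd \<Rightarrow> real" and \<psi>
    assume test: "(\<forall>x. GDERIV \<phi> x :> \<psi> x) \<and> continuous_on UNIV \<psi> \<and> (\<exists>K. compact K \<and> (\<forall>x. x \<notin> K \<longrightarrow> \<phi> x = 0))"
    then obtain K where K: "compact K" "\<And>x. x \<notin> K \<Longrightarrow> \<phi> x = 0" by blast
    have \<psi>: "\<And>x. GDERIV \<phi> x :> \<psi> x" "continuous_on UNIV \<psi>" using test by auto
    have \<phi>c: "continuous_on UNIV \<phi>" using test by (intro C1_continuous) (auto simp: C1_def)
    have \<psi>0: "\<psi> x = 0" if "x \<notin> K" for x
      by (rule gradient_zero_off_support[OF \<psi>(1) compact_imp_closed[OF K(1)] K(2) that])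
    obtain M1 where M1: "M1 \<ge> 0" "\<And>x. norm (\<psi> x) \<le> M1 * indicator K x"
      using continuous_support_bounded[OF \<psi>(2) K(1) \<psi>0] by blast
    obtain M2 where M2: "M2 \<ge> 0" "\<And>x. norm (\<phi> x) \<le> M2 * indicator K x"
      using continuous_support_bounded[OF \<phi>c K] by blast
    have A: "(\<lambda>n. LINT x|lebesgue. (w n x - u x) *\<^sub>R \<psi> x) \<longlonglongrightarrow> 0"
    proof (rule periodic_L2_null_tested[OF K(1) Du Pu lu])
      show "(\<lambda>x. (w n x - u x) *\<^sub>R \<psi> x) \<in> borel_measurable lebesgue" for n
        using wm um continuous_lebesgue_measurable[OF \<psi>(2)] by (intro borel_measurable_scaleR borel_measurable_diff)
      show "norm ((w n x - u x) *\<^sub>R \<psi> x) \<le> M1 * indicator K x * norm (w n x - u x)" for n x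
        using mult_left_mono[OF M1(2)[of x], of "\<bar>w n x - u x\<bar>"] by (simp add: mult.commute)
    qed
    have B: "(\<lambda>n. LINT x|lebesgue. \<phi> x *\<^sub>R (weak_grad (w n) x - g x)) \<longlonglongrightarrow> 0"
    proof (rule periodic_L2_null_tested[OF K(1) Dg Pg lg])
      show "(\<lambda>x. \<phi> x *\<^sub>R (weak_grad (w n) x - g x)) \<in> borel_measurable lebesgue" for n
        using wgm gm continuous_lebesgue_measurable[OF \<phi>c] by (intro borel_measurable_scaleR borel_measurable_diff)
      show "norm (\<phi> x *\<^sub>R (weak_grad (w n) x - g x)) \<le> M2 * indicator K x * norm (weak_grad (w n) x - g x)" for n x
        using mult_right_mono[OF M2(2)[of x], of "norm (weak_grad (w n) x - g x)"] by simp
    qed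
    have A': "(LINT x|lebesgue. (w n x - u x) *\<^sub>R \<psi> x) = (LINT x|lebesgue. w n x *\<^sub>R \<psi> x) - (LINT x|lebesgue. u x *\<^sub>R \<psi> x)" for n
      unfolding scaleR_diff_left
      by (intro Bochner_Integration.integral_diff integrable_scaleR_test[OF _ \<psi>(2) K(1) \<psi>0] lw lu')
    have B': "(LINT x|lebesgue. \<phi> x *\<^sub>R (weak_grad (w n) x - g x)) = (LINT x|lebesgue. \<phi> x *\<^sub>R weak_grad (w n) x) - (LINT x|lebesgue. \<phi> x *\<^sub>R g x)" for n
      unfolding scaleR_diff_right
      by (intro Bochner_Integration.integral_diff integrable_test_scaleR[OF _ \<phi>c K] lw lg')
    have "(\<lambda>n. (LINT x|lebesgue. (w n x - u x) *\<^sub>R \<psi> x) + (LINT x|lebesgue. \<phi> x *\<^sub>R (weak_grad (w n) x - g x))) \<longlonglongrightarrow> 0 + 0"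
      by (rule tendsto_add[OF A B])
    moreover have "(LINT x|lebesgue. (w n x - u x) *\<^sub>R \<psi> x) + (LINT x|lebesgue. \<phi> x *\<^sub>R (weak_grad (w n) x - g x))
        = - (LINT x|lebesgue. u x *\<^sub>R \<psi> x) - (LINT x|lebesgue. \<phi> x *\<^sub>R g x)" for n
      unfolding A' B' using weak_grad_test[OF W(3) \<psi> K(1) K(2), of n] by simp
    ultimately have "- (LINT x|lebesgue. u x *\<^sub>R \<psi> x) - (LINT x|lebesgue. \<phi> x *\<^sub>R g x) = 0"
      by (simp add: LIMSEQ_const_iff)
    then show "(LINT x|lebesgue. u x *\<^sub>R \<psi> x) = - (LINT x|lebesgue. \<phi> x *\<^sub>R g x)"
      by (metis (no_types) add.inverse_inverse eq_neg_iff_add_eq_0 diff_conv_add_uminus add.commute)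
  qed
  have "(\<lambda>n. LINT x|lebesgue. indicator unit_cell x *\<^sub>R (w n x - u x)) \<longlonglongrightarrow> 0"
  proof (rule periodic_L2_null_tested[OF compact_unit_cell Du Pu lu, of _ 1])
    show "(\<lambda>x. indicat_real unit_cell x *\<^sub>R (w n x - u x)) \<in> borel_measurable lebesgue" for n
      using wm um by (intro borel_measurable_scaleR borel_measurable_diff borel_measurable_indicator) auto
  qed (auto simp: indicator_def)
  moreover have "(LINT x|lebesgue. indicator unit_cell x *\<^sub>R (w n x - u x)) = - (LINT x:unit_cell|lebesgue. u x)" for n
  proof -
    have "(LINT x:unit_cell|lebesgue. w n x - u x) = (LINT x:unit_cell|lebesgue. w n x) - (LINT x:unit_cell|lebesgue. u x)"
      by (intro set_integral_diff square_integrable_imp_integrable W u)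
    then show ?thesis using W(5)[of n] by (simp add: set_lebesgue_integral_def)
  qed
  ultimately show "(LINT x:unit_cell|lebesgue. u x) = 0" by (simp add: LIMSEQ_const_iff)
qed

text \<open>The limits are taken pointwise, so that they are defined on the whole space and inherit periodicity. The
  almost-everywhere convergence is part of the conclusion because vanishing on a set passes to the limit
  through it.\<close>

lemma H1_per0_complete:
  fixes w :: "nat \<Rightarrow> real ^ 'd \<Rightarrow> real"
  assumes w: "\<And>n. w n \<in> H1_per0"
    and K1: "\<And>n. (LINT x:unit_cell|lebesgue. (norm (w (Suc n) x - w n x))\<^sup>2) \<le> K * (1/4) ^ n"
    and K2: "\<And>n. (LINT x:unit_cell|lebesgue. (norm (weak_grad (w (Suc n)) x - weak_grad (w n) x))\<^sup>2) \<le> K * (1/4) ^ n"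
  shows "\<exists>u\<in>H1_per0. (AE x in lebesgue. (\<lambda>n. w n x) \<longlonglongrightarrow> u x) \<and>
    (\<lambda>n. LINT x:unit_cell|lebesgue. (norm (w n x - u x))\<^sup>2) \<longlonglongrightarrow> 0 \<and>
    (\<lambda>n. LINT x:unit_cell|lebesgue. (norm (weak_grad (w n) x - weak_grad u x))\<^sup>2) \<longlonglongrightarrow> 0"
proof -
  note W = H1_per0D[OF w]
  have wm[measurable]: "w n \<in> borel_measurable lebesgue" and wgm[measurable]: "weak_grad (w n) \<in> borel_measurable lebesgue" for n
    using W(2,4)[of n] by (auto simp: square_integrable_on_def)
  have i1: "set_integrable lebesgue unit_cell (\<lambda>x. (norm (w (Suc n) x - w n x))\<^sup>2)" for n
    using square_integrable_axpy[OF unit_cell_sets W(2) W(2), of "Suc n" "-1" n] by (simp add: square_integrable_on_def)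
  have i2: "set_integrable lebesgue unit_cell (\<lambda>x. (norm (weak_grad (w (Suc n)) x - weak_grad (w n) x))\<^sup>2)" for n
    using square_integrable_axpy[OF unit_cell_sets W(4) W(4), of "Suc n" "-1" n] by (simp add: square_integrable_on_def)
  obtain G1 where G1: "set_integrable lebesgue unit_cell G1"
    "AE x in lebesgue. x \<in> unit_cell \<longrightarrow> (\<forall>n m. n \<le> m \<longrightarrow> (norm (w m x - w n x))\<^sup>2 \<le> 2 * (1/2) ^ n * G1 x)"
    using rapidly_Cauchy_dominated[OF unit_cell_sets wm i1 K1] by blast
  obtain G2 where G2: "set_integrable lebesgue unit_cell G2"
    "AE x in lebesgue. x \<in> unit_cell \<longrightarrow> (\<forall>n m. n \<le> m \<longrightarrow> (norm (weak_grad (w m) x - weak_grad (w n) x))\<^sup>2 \<le> 2 * (1/2) ^ n * G2 x)"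
    using rapidly_Cauchy_dominated[OF unit_cell_sets wgm i2 K2] by blast
  \<comment> \<open>off the set of convergence \<open>lim\<close> is an unspecified value, on a null set only\<close>
  define u where "u = (\<lambda>x. lim (\<lambda>n. w n x))"
  define g where "g = (\<lambda>x. lim (\<lambda>n. weak_grad (w n) x))"
  have um: "u \<in> borel_measurable lebesgue" unfolding u_def by (rule borel_measurable_lim_metric[OF wm])
  have gm: "g \<in> borel_measurable lebesgue" unfolding g_def by (rule borel_measurable_lim_metric[OF wgm])
  have P1: "AE x in lebesgue. \<forall>n. w n (x + k) = w n x" if "k \<in> int_vecs" for k
    unfolding AE_all_countable using W(1) that by (auto simp: ae_periodic_def)
  have P2: "AE x in lebesgue. \<forall>n. weak_grad (w n) (x + k) = weak_grad (w n) x" if "k \<in> int_vecs" for k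
    unfolding AE_all_countable using weak_grad_periodic[OF W(3,1) that] by blast
  have c1: "AE x in lebesgue. convergent (\<lambda>n. w n x)"
  proof (rule AE_from_cell)
    show "AE x in lebesgue. x \<in> unit_cell \<longrightarrow> convergent (\<lambda>n. w n x)"
      using G1(2) by eventually_elim (intro impI Cauchy_of_half_powers, blast)
    show "AE x in lebesgue. convergent (\<lambda>n. w n x) \<longrightarrow> convergent (\<lambda>n. w n (x + k))" if "k \<in> int_vecs" for k
      using P1[OF that] by eventually_elim simp
  qed
  have c2: "AE x in lebesgue. convergent (\<lambda>n. weak_grad (w n) x)"
  proof (rule AE_from_cell)
    show "AE x in lebesgue. x \<in> unit_cell \<longrightarrow> convergent (\<lambda>n. weak_grad (w n) x)"
      using G2(2) by eventually_elim (intro impI Cauchy_of_half_powers, blast)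
    show "AE x in lebesgue. convergent (\<lambda>n. weak_grad (w n) x) \<longrightarrow> convergent (\<lambda>n. weak_grad (w n) (x + k))" if "k \<in> int_vecs" for k
      using P2[OF that] by eventually_elim simp
  qed
  have l1: "AE x in lebesgue. (\<lambda>n. w n x) \<longlonglongrightarrow> u x"
    using c1 by eventually_elim (simp add: u_def convergent_LIMSEQ_iff)
  have l2: "AE x in lebesgue. (\<lambda>n. weak_grad (w n) x) \<longlonglongrightarrow> g x"
    using c2 by eventually_elim (simp add: g_def convergent_LIMSEQ_iff)
  have l1': "AE x in lebesgue. x \<in> unit_cell \<longrightarrow> (\<lambda>n. w n x) \<longlonglongrightarrow> u x" using l1 by eventually_elim simp
  have l2': "AE x in lebesgue. x \<in> unit_cell \<longrightarrow> (\<lambda>n. weak_grad (w n) x) \<longlonglongrightarrow> g x" using l2 by eventually_elim simp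
  note R1 = Riesz_Fischer_limit[OF unit_cell_sets wm um G1 l1']
  note R2 = Riesz_Fischer_limit[OF unit_cell_sets wgm gm G2 l2']
  have su: "square_integrable_on u unit_cell"
  proof -
    have "square_integrable_on (\<lambda>x. w 0 x - u x) unit_cell"
      using R1(1)[of 0] um wm[of 0] by (simp add: square_integrable_on_def)
    from square_integrable_axpy[OF unit_cell_sets W(2)[of 0] this, of "-1"] show ?thesis by simp
  qed
  have sg: "square_integrable_on g unit_cell"
  proof -
    have "square_integrable_on (\<lambda>x. weak_grad (w 0) x - g x) unit_cell"
      using R2(1)[of 0] gm wgm[of 0] by (simp add: square_integrable_on_def)
    from square_integrable_axpy[OF unit_cell_sets W(4)[of 0] this, of "-1"] show ?thesis by simp
  qed
  have pu: "AE x in lebesgue. u (x + k) = u x" if "k \<in> int_vecs" for k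
    using P1[OF that] by eventually_elim (simp add: u_def)
  have pg: "AE x in lebesgue. g (x + k) = g x" if "k \<in> int_vecs" for k
    using P2[OF that] by eventually_elim (simp add: g_def)
  have lim: "is_weak_grad u g" "(LINT x:unit_cell|lebesgue. u x) = 0"
    by (rule is_weak_grad_L2_limit[OF w su pu sg pg R1(2) R2(2)]; assumption)+
  have uH: "u \<in> H1_per0"
    by (rule H1_per0I[OF _ su lim(1) sg lim(2)]) (simp add: ae_periodic_def pu)
  have "(LINT x:unit_cell|lebesgue. (norm (weak_grad (w n) x - weak_grad u x))\<^sup>2)
      = (LINT x:unit_cell|lebesgue. (norm (weak_grad (w n) x - g x))\<^sup>2)" for n
  proof (rule set_lebesgue_integral_cong_AE)
    show "AE x\<in>unit_cell in lebesgue. (norm (weak_grad (w n) x - weak_grad u x))\<^sup>2 = (norm (weak_grad (w n) x - g x))\<^sup>2"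
      using weak_grad_AE_eq[OF lim(1)] by eventually_elim simp
    show "(\<lambda>x. (norm (weak_grad (w n) x - weak_grad u x))\<^sup>2) \<in> borel_measurable lebesgue"
      using H1_per0D(4)[OF uH] by (auto simp: square_integrable_on_def)
    show "(\<lambda>x. (norm (weak_grad (w n) x - g x))\<^sup>2) \<in> borel_measurable lebesgue" using gm by measurable
  qed simp
  then show ?thesis using uH l1 R1(2) R2(2) by (intro bexI[of _ u]) simp_all
qed

section \<open>Bounded coefficients and energy forms\<close>

text \<open>A coefficient is controlled on the cell only. Outside it may even be nonmeasurable, hence the indicator
  functions in the measurability statements.\<close>

definition bounded_coeff :: "(real ^ 'd \<Rightarrow> real) \<Rightarrow> bool" where
  "bounded_coeff a \<longleftrightarrow> a \<in> borel_measurable (lebesgue_on unit_cell) \<and>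
     (\<exists>M. AE x in lebesgue. x \<in> unit_cell \<longrightarrow> \<bar>a x\<bar> \<le> M)"

lemma measurable_on_cell_iff:
  "a \<in> borel_measurable (lebesgue_on unit_cell) \<longleftrightarrow> (\<lambda>x. indicator unit_cell x * a x :: real) \<in> borel_measurable lebesgue"
  by (simp add: borel_measurable_restrict_space_iff mult.commute)

lemma bounded_coeff_measurable:
  assumes "bounded_coeff a" "S \<in> sets lebesgue" "S \<subseteq> unit_cell"
  shows "(\<lambda>x. indicator S x * a x) \<in> borel_measurable lebesgue"
proof -
  have "(\<lambda>x. indicator S x * (indicator unit_cell x * a x)) \<in> borel_measurable lebesgue"
    by (rule borel_measurable_times) (use assms in \<open>auto simp: bounded_coeff_def measurable_on_cell_iff\<close>)
  moreover have "indicator S x * (indicator unit_cell x * a x) = indicator S x * a x" for x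
    using assms(3) by (auto simp: indicator_def)
  ultimately show ?thesis by simp
qed

lemma bounded_coeff_mult:
  assumes "bounded_coeff a" "bounded_coeff b" shows "bounded_coeff (\<lambda>x. a x * b x)"
proof -
  obtain M N where M: "AE x in lebesgue. x \<in> unit_cell \<longrightarrow> \<bar>a x\<bar> \<le> M" "AE x in lebesgue. x \<in> unit_cell \<longrightarrow> \<bar>b x\<bar> \<le> N"
    using assms by (auto simp: bounded_coeff_def)
  then have "AE x in lebesgue. x \<in> unit_cell \<longrightarrow> \<bar>a x * b x\<bar> \<le> M * N"
    by eventually_elim (auto simp: abs_mult intro!: mult_mono)
  then show ?thesis using assms unfolding bounded_coeff_def by (auto intro!: borel_measurable_times exI)
qed

lemma bounded_coeff_add:
  assumes "bounded_coeff a" "bounded_coeff b" shows "bounded_coeff (\<lambda>x. a x + b x)"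
proof -
  obtain M N where M: "AE x in lebesgue. x \<in> unit_cell \<longrightarrow> \<bar>a x\<bar> \<le> M" "AE x in lebesgue. x \<in> unit_cell \<longrightarrow> \<bar>b x\<bar> \<le> N"
    using assms by (auto simp: bounded_coeff_def)
  then have "AE x in lebesgue. x \<in> unit_cell \<longrightarrow> \<bar>a x + b x\<bar> \<le> M + N"
    by eventually_elim auto
  then show ?thesis using assms unfolding bounded_coeff_def by (auto intro!: borel_measurable_add exI)
qed

lemma bounded_coeff_const: "bounded_coeff (\<lambda>x. c)"
  by (auto simp: bounded_coeff_def intro!: exI[of _ "\<bar>c\<bar>"])

lemma bounded_coeff_indicator:
  assumes "T \<in> sets lebesgue" shows "bounded_coeff (indicator T)"
  unfolding bounded_coeff_def measurable_on_cell_iff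
  using assms by (auto simp: indicator_def intro!: exI[of _ 1] borel_measurable_times borel_measurable_indicator)

lemma bounded_coeff_sum:
  "finite F \<Longrightarrow> (\<And>i. i \<in> F \<Longrightarrow> bounded_coeff (a i)) \<Longrightarrow> bounded_coeff (\<lambda>x. \<Sum>i\<in>F. a i x)"
proof (induction F rule: finite_induct)
  case (insert i F)
  have "bounded_coeff (\<lambda>x. a i x + (\<Sum>i\<in>F. a i x))"
    by (rule bounded_coeff_add) (use insert in auto)
  then show ?case using insert by simp
qed (simp add: bounded_coeff_const)

lemma sqrt_measurable:
  "a \<in> borel_measurable M \<Longrightarrow> (\<lambda>x. sqrt (a x)) \<in> borel_measurable M"
  by measurable

lemma admissible_coeff_AE:
  "admissible_coeff A \<longleftrightarrow> A \<in> borel_measurable (lebesgue_on unit_cell) \<and>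
     (\<exists>c>0. AE x in lebesgue. x \<in> unit_cell \<longrightarrow> c \<le> A x) \<and> (\<exists>M. AE x in lebesgue. x \<in> unit_cell \<longrightarrow> A x \<le> M)"
  unfolding admissible_coeff_def by (simp add: AE_restrict_space_iff)

lemma admissible_imp_bounded:
  assumes "admissible_coeff A" shows "bounded_coeff A"
proof -
  obtain c M where "c > 0" "AE x in lebesgue. x \<in> unit_cell \<longrightarrow> c \<le> A x" "AE x in lebesgue. x \<in> unit_cell \<longrightarrow> A x \<le> M"
    using assms by (auto simp: admissible_coeff_AE)
  then have "AE x in lebesgue. x \<in> unit_cell \<longrightarrow> \<bar>A x\<bar> \<le> M" by (auto elim: eventually_elim2)
  then show ?thesis using assms by (auto simp: bounded_coeff_def admissible_coeff_AE)
qed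

lemma admissible_pos:
  assumes "admissible_coeff A" shows "AE x in lebesgue. x \<in> unit_cell \<longrightarrow> 0 < A x"
proof -
  obtain c where "c > 0" "AE x in lebesgue. x \<in> unit_cell \<longrightarrow> c \<le> A x"
    using assms by (auto simp: admissible_coeff_AE)
  from this(2) show ?thesis by eventually_elim (use \<open>c > 0\<close> in auto)
qed

lemma admissible_nonneg: "admissible_coeff a \<Longrightarrow> AE x in lebesgue. x \<in> unit_cell \<longrightarrow> 0 \<le> a x"
  using admissible_pos[of a] by (auto elim: eventually_mono)

lemma bounded_coeff_sqrt:
  assumes "admissible_coeff A" shows "bounded_coeff (\<lambda>x. sqrt (A x))"
proof -
  obtain M where "AE x in lebesgue. x \<in> unit_cell \<longrightarrow> A x \<le> M" using assms by (auto simp: admissible_coeff_AE)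
  then have "AE x in lebesgue. x \<in> unit_cell \<longrightarrow> \<bar>sqrt (A x)\<bar> \<le> sqrt M"
    using admissible_pos[OF assms] by eventually_elim auto
  moreover have "(\<lambda>x. sqrt (A x)) \<in> borel_measurable (lebesgue_on unit_cell)"
    using assms by (intro sqrt_measurable) (auto simp: admissible_coeff_def)
  ultimately show ?thesis by (auto simp: bounded_coeff_def)
qed

lemma bounded_coeff_inverse_sqrt:
  assumes "admissible_coeff A" shows "bounded_coeff (\<lambda>x. inverse (sqrt (A x)))"
proof -
  obtain c where c: "c > 0" "AE x in lebesgue. x \<in> unit_cell \<longrightarrow> c \<le> A x" using assms by (auto simp: admissible_coeff_AE)
  have "AE x in lebesgue. x \<in> unit_cell \<longrightarrow> \<bar>inverse (sqrt (A x))\<bar> \<le> inverse (sqrt c)"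
    using c(2)
  proof eventually_elim
    case (elim x)
    then show ?case using c(1) by (auto intro!: le_imp_inverse_le)
  qed
  moreover have "(\<lambda>x. inverse (sqrt (A x))) \<in> borel_measurable (lebesgue_on unit_cell)"
    using assms by (intro borel_measurable_inverse sqrt_measurable) (auto simp: admissible_coeff_def)
  ultimately show ?thesis unfolding bounded_coeff_def by blast
qed

lemma weighted_inner_integrable:
  fixes f g :: "real ^ 'd \<Rightarrow> 'b::euclidean_space"
  assumes S: "S \<in> sets lebesgue" "S \<subseteq> unit_cell" and a: "bounded_coeff a"
    and f: "square_integrable_on f unit_cell" and g: "square_integrable_on g unit_cell"
  shows "set_integrable lebesgue S (\<lambda>x. a x * (f x \<bullet> g x))"
proof -
  obtain M where M: "AE x in lebesgue. x \<in> unit_cell \<longrightarrow> \<bar>a x\<bar> \<le> M" using a by (auto simp: bounded_coeff_def)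
  have fm: "f \<in> borel_measurable lebesgue" "g \<in> borel_measurable lebesgue"
    using f g by (auto simp: square_integrable_on_def)
  have "set_integrable lebesgue unit_cell (\<lambda>x. \<bar>M\<bar> * ((norm (f x))\<^sup>2 + (norm (g x))\<^sup>2))"
    using f g by (intro set_integrable_mult_right set_integral_add) (auto simp: square_integrable_on_def)
  then have i: "integrable lebesgue (\<lambda>x. indicator unit_cell x *\<^sub>R (\<bar>M\<bar> * ((norm (f x))\<^sup>2 + (norm (g x))\<^sup>2)))"
    by (simp add: set_integrable_def)
  show ?thesis
    unfolding set_integrable_def
  proof (rule Bochner_Integration.integrable_bound[OF i])
    have "(\<lambda>x. (indicator S x * a x) * (f x \<bullet> g x)) \<in> borel_measurable lebesgue"
      by (rule borel_measurable_times[OF bounded_coeff_measurable[OF a S] borel_measurable_inner[OF fm]])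
    then show "(\<lambda>x. indicator S x *\<^sub>R (a x * (f x \<bullet> g x))) \<in> borel_measurable lebesgue"
      by (simp add: mult.assoc)
    show "AE x in lebesgue. norm (indicator S x *\<^sub>R (a x * (f x \<bullet> g x)))
       \<le> norm (indicator unit_cell x *\<^sub>R (\<bar>M\<bar> * ((norm (f x))\<^sup>2 + (norm (g x))\<^sup>2)))"
      using M
    proof eventually_elim
      case (elim x)
      have fg: "\<bar>f x \<bullet> g x\<bar> \<le> (norm (f x))\<^sup>2 + (norm (g x))\<^sup>2"
      proof -
        have "\<bar>f x \<bullet> g x\<bar> \<le> norm (f x) * norm (g x)" by (rule Cauchy_Schwarz_ineq2)
        moreover have "0 \<le> (norm (f x) - norm (g x))\<^sup>2" "0 \<le> norm (f x) * norm (g x)" by simp_all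
        ultimately show ?thesis unfolding power2_diff by linarith
      qed
      show ?case
      proof (cases "x \<in> S")
        case True
        then have "\<bar>a x\<bar> \<le> \<bar>M\<bar>" using elim S(2) by auto
        then have "\<bar>a x\<bar> * \<bar>f x \<bullet> g x\<bar> \<le> \<bar>M\<bar> * ((norm (f x))\<^sup>2 + (norm (g x))\<^sup>2)"
          using fg by (intro mult_mono) auto
        also have "\<dots> \<le> \<bar>\<bar>M\<bar> * ((norm (f x))\<^sup>2 + (norm (g x))\<^sup>2)\<bar>" by (rule abs_ge_self)
        finally show ?thesis using True S(2) by (auto simp: abs_mult)
      qed simp
    qed
  qed
qed

lemma square_integrable_sum:
  fixes f :: "'i \<Rightarrow> real ^ 'd \<Rightarrow> 'b::euclidean_space"
  shows "finite F \<Longrightarrow> (\<And>i. i \<in> F \<Longrightarrow> square_integrable_on (f i) unit_cell) \<Longrightarrow>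
     square_integrable_on (\<lambda>x. \<Sum>i\<in>F. f i x) unit_cell"
proof (induction F rule: finite_induct)
  case empty
  then show ?case by (simp add: square_integrable_on_def set_integrable_def)
next
  case (insert i F)
  then show ?case using square_integrable_axpy[OF unit_cell_sets, of "f i" "\<lambda>x. \<Sum>i\<in>F. f i x" 1] by simp
qed

lemma square_integrable_weighted:
  fixes f :: "real ^ 'd \<Rightarrow> 'b::euclidean_space"
  assumes a: "bounded_coeff a" and f: "square_integrable_on f unit_cell"
  shows "square_integrable_on (\<lambda>x. (indicator unit_cell x * a x) *\<^sub>R f x) unit_cell"
proof -
  have "set_integrable lebesgue unit_cell (\<lambda>x. (a x * a x) * (f x \<bullet> f x))"
    by (rule weighted_inner_integrable[OF unit_cell_sets subset_refl bounded_coeff_mult[OF a a] f f])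
  moreover have "indicator unit_cell x *\<^sub>R ((a x * a x) * (f x \<bullet> f x))
      = indicator unit_cell x *\<^sub>R (norm ((indicator unit_cell x * a x) *\<^sub>R f x))\<^sup>2" for x
    unfolding power2_norm_eq_inner by (auto simp: indicator_def)
  moreover have "(\<lambda>x. (indicator unit_cell x * a x) *\<^sub>R f x) \<in> borel_measurable lebesgue"
    using bounded_coeff_measurable[OF a unit_cell_sets subset_refl] f
    by (intro borel_measurable_scaleR) (auto simp: square_integrable_on_def)
  ultimately show ?thesis unfolding square_integrable_on_def set_integrable_def by (simp only: simp_thms)
qed

lemma set_integral_cong_AE_integrable:
  fixes f g :: "'a \<Rightarrow> 'b::{banach, second_countable_topology}"
  assumes "set_integrable M S f" "set_integrable M S g" "AE x in M. x \<in> S \<longrightarrow> f x = g x"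
  shows "(LINT x:S|M. f x) = (LINT x:S|M. g x)"
  unfolding set_lebesgue_integral_def
proof (rule integral_cong_AE)
  show "AE x in M. indicator S x *\<^sub>R f x = indicator S x *\<^sub>R g x"
    using assms(3) by eventually_elim (auto simp: indicator_def)
qed (use assms in \<open>auto simp: set_integrable_def\<close>)

definition energy_form :: "(real ^ 'd \<Rightarrow> real) \<Rightarrow> (real ^ 'd) set \<Rightarrow> (real ^ 'd \<Rightarrow> real) \<Rightarrow> (real ^ 'd \<Rightarrow> real) \<Rightarrow> real" where
  "energy_form a S u w = (LINT x:S|lebesgue. a x * (weak_grad u x \<bullet> weak_grad w x))"

lemma energy_form_integrable:
  assumes "S \<in> sets lebesgue" "S \<subseteq> unit_cell" "bounded_coeff a" "u \<in> H1_per0" "w \<in> H1_per0"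
  shows "set_integrable lebesgue S (\<lambda>x. a x * (weak_grad u x \<bullet> weak_grad w x))"
  by (rule weighted_inner_integrable[OF assms(1-3) H1_per0D(4)[OF assms(4)] H1_per0D(4)[OF assms(5)]])

lemma energy_form_psd:
  assumes S: "S \<in> sets lebesgue" "S \<subseteq> unit_cell" and a: "bounded_coeff a"
    and nn: "AE x in lebesgue. x \<in> unit_cell \<longrightarrow> 0 \<le> a x"
  shows "psd_form H1_per0 (energy_form a S)"
proof unfold_locales
  note i = energy_form_integrable[OF S a]
  show "energy_form a S u v = energy_form a S v u" for u v
    by (simp add: energy_form_def inner_commute)
  show "(\<lambda>x. 0) \<in> H1_per0" by (rule H1_zero)
  show "(\<lambda>x. u x + v x) \<in> H1_per0" if "u \<in> H1_per0" "v \<in> H1_per0" for u v :: "real ^ 'a \<Rightarrow> real"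
    by (rule H1_add(1)[OF that])
  show "(\<lambda>x. s * v x) \<in> H1_per0" if "v \<in> H1_per0" for v :: "real ^ 'a \<Rightarrow> real" and s
    by (rule H1_scale(1)[OF that])
  show "energy_form a S (\<lambda>x. u x + v x) w = energy_form a S u w + energy_form a S v w"
    if u: "u \<in> H1_per0" and v: "v \<in> H1_per0" and w: "w \<in> H1_per0" for u v w
  proof -
    have "energy_form a S (\<lambda>x. u x + v x) w
        = (LINT x:S|lebesgue. a x * (weak_grad u x \<bullet> weak_grad w x) + a x * (weak_grad v x \<bullet> weak_grad w x))"
      unfolding energy_form_def
    proof (rule set_integral_cong_AE_integrable[OF i[OF H1_add(1)[OF u v] w] set_integral_add(1)[OF i[OF u w] i[OF v w]]])
      show "AE x in lebesgue. x \<in> S \<longrightarrow> a x * (weak_grad (\<lambda>x. u x + v x) x \<bullet> weak_grad w x)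
          = a x * (weak_grad u x \<bullet> weak_grad w x) + a x * (weak_grad v x \<bullet> weak_grad w x)"
        using H1_add(2)[OF u v] by eventually_elim (simp add: inner_add_left algebra_simps)
    qed
    then show ?thesis unfolding energy_form_def by (simp only: set_integral_add(2)[OF i[OF u w] i[OF v w]])
  qed
  show "energy_form a S (\<lambda>x. s * v x) w = s * energy_form a S v w"
    if v: "v \<in> H1_per0" and w: "w \<in> H1_per0" for s v w
  proof -
    have "energy_form a S (\<lambda>x. s * v x) w = (LINT x:S|lebesgue. s * (a x * (weak_grad v x \<bullet> weak_grad w x)))"
      unfolding energy_form_def
    proof (rule set_integral_cong_AE_integrable[OF i[OF H1_scale(1)[OF v] w] set_integrable_mult_right[OF i[OF v w]]])
      show "AE x in lebesgue. x \<in> S \<longrightarrow> a x * (weak_grad (\<lambda>x. s * v x) x \<bullet> weak_grad w x)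
          = s * (a x * (weak_grad v x \<bullet> weak_grad w x))"
        using H1_scale(2)[OF v, of s] by eventually_elim simp
    qed
    then show ?thesis by (simp add: energy_form_def)
  qed
  show "0 \<le> energy_form a S v v" for v
    unfolding energy_form_def set_lebesgue_integral_def
  proof (rule integral_nonneg_AE)
    show "AE x in lebesgue. 0 \<le> indicator S x *\<^sub>R (a x * (weak_grad v x \<bullet> weak_grad v x))"
      using nn by eventually_elim (use S(2) in \<open>auto simp: indicator_def\<close>)
  qed
qed

lemma energy_form_mono:
  assumes S: "S \<in> sets lebesgue" "T \<in> sets lebesgue" "S \<subseteq> T" "T \<subseteq> unit_cell" and a: "bounded_coeff a"
    and nn: "AE x in lebesgue. x \<in> unit_cell \<longrightarrow> 0 \<le> a x" and v: "v \<in> H1_per0"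
  shows "energy_form a S v v \<le> energy_form a T v v"
  unfolding energy_form_def set_lebesgue_integral_def
proof (rule integral_mono_AE)
  show "AE x in lebesgue. indicator S x *\<^sub>R (a x * (weak_grad v x \<bullet> weak_grad v x))
     \<le> indicator T x *\<^sub>R (a x * (weak_grad v x \<bullet> weak_grad v x))"
    using nn by eventually_elim (use S in \<open>auto simp: indicator_def\<close>)
qed (use energy_form_integrable[OF _ _ a v v] S in \<open>auto simp: set_integrable_def\<close>)

text \<open>Uniqueness of correctors has this form: the energy determines the gradient almost everywhere on the
  domain of integration, and nothing else.\<close>

lemma energy_form_null:
  assumes S: "S \<in> sets lebesgue" "S \<subseteq> unit_cell" and a: "bounded_coeff a"
    and p: "AE x in lebesgue. x \<in> unit_cell \<longrightarrow> 0 < a x" and v: "v \<in> H1_per0" and z: "energy_form a S v v = 0"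
  shows "AE x in lebesgue. x \<in> S \<longrightarrow> weak_grad v x = 0"
proof -
  have "AE x in lebesgue. indicator S x *\<^sub>R (a x * (weak_grad v x \<bullet> weak_grad v x)) = 0"
  proof (subst integral_nonneg_eq_0_iff_AE[symmetric])
    show "integrable lebesgue (\<lambda>x. indicator S x *\<^sub>R (a x * (weak_grad v x \<bullet> weak_grad v x)))"
      using energy_form_integrable[OF S a v v] by (simp add: set_integrable_def)
    show "AE x in lebesgue. 0 \<le> indicator S x *\<^sub>R (a x * (weak_grad v x \<bullet> weak_grad v x))"
      using p by eventually_elim (use S(2) in \<open>auto simp: indicator_def less_imp_le\<close>)
    show "(LINT x|lebesgue. indicator S x *\<^sub>R (a x * (weak_grad v x \<bullet> weak_grad v x))) = 0"
      using z by (simp add: energy_form_def set_lebesgue_integral_def)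
  qed
  then show ?thesis using p by eventually_elim (use S(2) in \<open>auto simp: indicator_def\<close>)
qed

lemma energy_form_zero_of_grad_zero:
  assumes "AE x in lebesgue. x \<in> S \<longrightarrow> weak_grad v x = 0"
  shows "energy_form a S v w = 0"
proof -
  have "AE x in lebesgue. indicator S x *\<^sub>R (a x * (weak_grad v x \<bullet> weak_grad w x)) = 0"
    using assms by eventually_elim (auto simp: indicator_def)
  then show ?thesis unfolding energy_form_def set_lebesgue_integral_def by (rule integral_eq_zero_AE)
qed

lemma H1_AE_zero_grad:
  assumes "v \<in> H1_per0" "AE x in lebesgue_on unit_cell. v x = 0"
  shows "AE x in lebesgue. weak_grad v x = 0"
proof -
  have "AE x in lebesgue. x \<in> unit_cell \<longrightarrow> v x = 0" using assms(2) by (simp add: AE_restrict_space_iff)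
  then have "AE x in lebesgue. v x = 0" by (rule H1_AE_zero_from_cell[OF assms(1)])
  then show ?thesis using weak_grad_zero_on[OF assms(1) open_UNIV] by simp
qed

section \<open>Piecewise polynomials\<close>

text \<open>The spanning functions are monomials cut off to disjoint pieces. The pieces come from an arbitrary choice
  \<open>\<rho>\<close> of an element containing each point, which disposes of the common boundaries of the elements.\<close>

lemma piecewise_Q_finite_span:
  fixes \<T> :: "(real ^ 'd) set set"
  assumes T: "finite \<T>" "\<Union>\<T> = unit_cell"
  shows "\<exists>b. piecewise_Q p \<T> \<subseteq> ae_span (lebesgue_on unit_cell) b (\<T> \<times> {\<alpha> :: 'd \<Rightarrow> nat. \<forall>j. \<alpha> j \<le> p})"
proof -
  let ?I = "{\<alpha> :: 'd \<Rightarrow> nat. \<forall>j. \<alpha> j \<le> p}"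
  have "\<exists>\<rho>. \<forall>x\<in>unit_cell. \<rho> x \<in> \<T> \<and> x \<in> \<rho> x" using T(2) by (intro bchoice) blast
  then obtain \<rho> where \<rho>: "\<And>x. x \<in> unit_cell \<Longrightarrow> \<rho> x \<in> \<T>" "\<And>x. x \<in> unit_cell \<Longrightarrow> x \<in> \<rho> x" by blast
  define b where "b = (\<lambda>(R, \<alpha>) x. if \<rho> x = R then (\<Prod>j\<in>UNIV. x $ j ^ \<alpha> j) else (0::real))"
  have "v \<in> ae_span (lebesgue_on unit_cell) b (\<T> \<times> ?I)" if v: "v \<in> piecewise_Q p \<T>" for v
  proof -
    have "\<forall>R\<in>\<T>. \<exists>c. AE x in lebesgue. x \<in> R \<longrightarrow> v x = (\<Sum>\<alpha>\<in>?I. c \<alpha> * (\<Prod>j\<in>UNIV. x $ j ^ \<alpha> j))"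
    proof
      fix R assume "R \<in> \<T>"
      then obtain f where f: "coord_poly p f" "AE x in lebesgue. x \<in> R \<longrightarrow> v x = f x"
        using v by (auto simp: piecewise_Q_def)
      then obtain c where "\<And>x. f x = (\<Sum>\<alpha>\<in>?I. c \<alpha> * (\<Prod>j\<in>UNIV. x $ j ^ \<alpha> j))" by (auto simp: coord_poly_def)
      with f(2) show "\<exists>c. AE x in lebesgue. x \<in> R \<longrightarrow> v x = (\<Sum>\<alpha>\<in>?I. c \<alpha> * (\<Prod>j\<in>UNIV. x $ j ^ \<alpha> j))" by auto
    qed
    from bchoice[OF this] obtain c where c: "\<And>R. R \<in> \<T> \<Longrightarrow> AE x in lebesgue. x \<in> R \<longrightarrow> v x = (\<Sum>\<alpha>\<in>?I. c R \<alpha> * (\<Prod>j\<in>UNIV. x $ j ^ \<alpha> j))"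
      by auto
    have "AE x in lebesgue. \<forall>R\<in>\<T>. x \<in> R \<longrightarrow> v x = (\<Sum>\<alpha>\<in>?I. c R \<alpha> * (\<Prod>j\<in>UNIV. x $ j ^ \<alpha> j))"
      using AE_finite_allI[OF T(1) c] .
    then have "AE x in lebesgue. x \<in> unit_cell \<longrightarrow> v x = (\<Sum>i\<in>\<T> \<times> ?I. c (fst i) (snd i) * b i x)"
    proof eventually_elim
      case (elim x)
      show ?case
      proof
        assume x: "x \<in> unit_cell"
        have "(\<Sum>i\<in>\<T> \<times> ?I. c (fst i) (snd i) * b i x) = (\<Sum>R\<in>\<T>. \<Sum>\<alpha>\<in>?I. c R \<alpha> * b (R, \<alpha>) x)"
          by (simp add: sum.cartesian_product case_prod_unfold)
        also have "\<dots> = (\<Sum>R\<in>\<T>. if \<rho> x = R then \<Sum>\<alpha>\<in>?I. c R \<alpha> * (\<Prod>j\<in>UNIV. x $ j ^ \<alpha> j) else 0)"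
          by (intro sum.cong refl) (simp add: b_def)
        also have "\<dots> = (\<Sum>\<alpha>\<in>?I. c (\<rho> x) \<alpha> * (\<Prod>j\<in>UNIV. x $ j ^ \<alpha> j))"
          using T(1) \<rho>(1)[OF x] by simp
        also have "\<dots> = v x" using elim \<rho>[OF x] by simp
        finally show "v x = (\<Sum>i\<in>\<T> \<times> ?I. c (fst i) (snd i) * b i x)" by simp
      qed
    qed
    then have "AE x in lebesgue_on unit_cell. v x = (\<Sum>i\<in>\<T> \<times> ?I. c (fst i) (snd i) * b i x)"
      by (simp add: AE_restrict_space_iff)
    then show ?thesis
      unfolding ae_span_def by (intro CollectI exI[of _ "\<lambda>i. c (fst i) (snd i)"])
  qed
  then show ?thesis by blast
qed

lemma finite_multi_indices: "finite {\<alpha> :: 'd::finite \<Rightarrow> nat. \<forall>j. \<alpha> j \<le> p}"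
proof -
  have "{\<alpha> :: 'd \<Rightarrow> nat. \<forall>j. \<alpha> j \<le> p} = UNIV \<rightarrow>\<^sub>E {..p}" by (auto simp: PiE_def)
  then show ?thesis by (simp add: finite_PiE)
qed

section \<open>Fine-scale spaces and correctors\<close>

lemma coord_poly_continuous: "coord_poly p f \<Longrightarrow> continuous_on S f"
  unfolding coord_poly_def
proof -
  assume "\<exists>c. \<forall>x. f x = (\<Sum>\<alpha>\<in>{\<alpha>. \<forall>j. \<alpha> j \<le> p}. c \<alpha> * (\<Prod>j\<in>UNIV. x $ j ^ \<alpha> j))"
  then obtain c where "f = (\<lambda>x. \<Sum>\<alpha>\<in>{\<alpha>. \<forall>j. \<alpha> j \<le> p}. c \<alpha> * (\<Prod>j\<in>UNIV. x $ j ^ \<alpha> j))" by auto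
  then show "continuous_on S f" by (auto intro!: continuous_intros)
qed

lemma quadrilateral_compact:
  assumes "quadrilateral T" shows "compact T" "T \<noteq> {}"
proof -
  obtain F where "quad_map F T" using assms unfolding quadrilateral_def by (rule exE)
  then have F: "\<And>j. coord_poly 1 (\<lambda>x. F x $ j)" "T = F ` unit_cell"
    by (simp_all add: quad_map_def)
  have "continuous_on unit_cell (\<lambda>x. \<chi> j. F x $ j)"
    by (intro continuous_on_vec_lambda coord_poly_continuous[OF F(1)])
  then have "continuous_on unit_cell F" by simp
  then show "compact T" unfolding F(2) by (rule compact_continuous_image[OF _ compact_unit_cell])
  have "0 \<in> unit_cell" by (simp add: unit_cell_def mem_box_cart)
  then show "T \<noteq> {}" unfolding F(2) by blast
qed

text \<open>The localized orthogonal decomposition for one mesh. A mesh size of zero would make the square-mean part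
  of the interpolation estimate void, because quotients by zero are zero.\<close>

locale lod =
  fixes \<T> :: "(real ^ 'd) set set" and V :: "(real ^ 'd \<Rightarrow> real) set" and C\<^sub>I :: real
    and I :: "(real ^ 'd \<Rightarrow> real) \<Rightarrow> real ^ 'd \<Rightarrow> real"
  assumes mesh: "quad_mesh \<T>" and size_pos: "mesh_size \<T> > 0"
    and ansatz: "ansatz_space \<T> V" and interp: "interpolation \<T> V C\<^sub>I I"
begin

lemma finite_mesh: "finite \<T>" and mesh_cover: "\<Union>\<T> = unit_cell"
  using mesh by (auto simp: quad_mesh_def)

lemma elem_compact: "T \<in> \<T> \<Longrightarrow> compact T" and elem_nonempty: "T \<in> \<T> \<Longrightarrow> T \<noteq> {}"
  using mesh quadrilateral_compact by (auto simp: quad_mesh_def)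

lemma elem_sub: "T \<in> \<T> \<Longrightarrow> T \<subseteq> unit_cell"
  using mesh_cover by blast

lemma elem_sets: "T \<in> \<T> \<Longrightarrow> T \<in> sets lebesgue"
  using elem_compact by (auto intro: fmeasurableD lmeasurable_compact)

lemma patch_closed: "T \<in> \<T> \<Longrightarrow> closed (patch \<T> m T)"
proof (induction m)
  case 0
  then show ?case using elem_compact compact_imp_closed by auto
next
  case (Suc m)
  show ?case
    using finite_mesh elem_compact by (auto intro!: closed_Union dest: compact_imp_closed)
qed

lemma patch_sub: "T \<in> \<T> \<Longrightarrow> patch \<T> m T \<subseteq> unit_cell"
  by (cases m) (use elem_sub in auto)

lemma patch_sets: "T \<in> \<T> \<Longrightarrow> patch \<T> m T \<in> sets lebesgue"
  using patch_closed by (auto intro: borel_closed)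

lemma elem_sub_patch: "T \<in> \<T> \<Longrightarrow> T \<subseteq> patch \<T> m T"
proof (induction m)
  case (Suc m)
  have "translate 0 (closure T) = closure T" by (simp add: translate_def)
  moreover have "(0 :: real ^ 'd) \<in> int_vecs" by (simp add: int_vecs_def)
  moreover have "closure (patch \<T> m T) \<inter> closure T \<noteq> {}"
    using Suc elem_nonempty[OF Suc.prems] closure_subset by blast
  ultimately have "T \<in> {T' \<in> \<T>. \<exists>k\<in>int_vecs. closure (patch \<T> m T) \<inter> translate k (closure T') \<noteq> {}}"
    using Suc.prems by force
  then show ?case by auto
qed simp

lemma V_sub: "V \<subseteq> H1_per0"
  using ansatz by (auto simp: ansatz_space_def fe_space_def)

lemma coarse_H1: "v \<in> coarse_space \<T> \<Longrightarrow> v \<in> H1_per0"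
  by (simp add: coarse_space_def)

lemma V_zero: "(\<lambda>x. 0) \<in> V"
  and V_add: "u \<in> V \<Longrightarrow> v \<in> V \<Longrightarrow> (\<lambda>x. u x + v x) \<in> V"
  and V_scale: "v \<in> V \<Longrightarrow> (\<lambda>x. s * v x) \<in> V"
proof -
  consider "V = H1_per0" | "fe_space \<T> V" using ansatz by (auto simp: ansatz_space_def)
  then have "(\<lambda>x. 0) \<in> V \<and> (\<forall>u\<in>V. \<forall>v\<in>V. (\<lambda>x. u x + v x) \<in> V) \<and> (\<forall>s. \<forall>v\<in>V. (\<lambda>x. s * v x) \<in> V)"
  proof cases
    case 1
    then show ?thesis by (auto intro: H1_zero H1_add(1) H1_scale(1))
  next
    case 2
    then obtain \<S> p where "(\<lambda>x. 0) \<in> V" "\<forall>u\<in>V. \<forall>v\<in>V. (\<lambda>x. u x + v x) \<in> V" "\<forall>s. \<forall>v\<in>V. (\<lambda>x. s * v x) \<in> V"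
      unfolding fe_space_def by (elim exE conjE) rule
    then show ?thesis by simp
  qed
  then show "(\<lambda>x. 0) \<in> V" "u \<in> V \<Longrightarrow> v \<in> V \<Longrightarrow> (\<lambda>x. u x + v x) \<in> V" "v \<in> V \<Longrightarrow> (\<lambda>x. s * v x) \<in> V"
    by simp_all
qed

lemma I_coarse: "v \<in> V \<Longrightarrow> I v \<in> coarse_space \<T>"
  and I_add: "u \<in> V \<Longrightarrow> v \<in> V \<Longrightarrow> AE x in lebesgue. I (\<lambda>y. u y + v y) x = I u x + I v x"
  and I_scale: "v \<in> V \<Longrightarrow> AE x in lebesgue. I (\<lambda>y. s * v y) x = s * I v x"
  and I_bound: "v \<in> V \<Longrightarrow> T \<in> \<T> \<Longrightarrow> L2_norm T (\<lambda>x. v x - I v x) / mesh_size \<T> + L2_norm T (weak_grad (I v))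
          \<le> C\<^sub>I * L2_norm (patch \<T> 1 T) (weak_grad v)"
  using interp unfolding interpolation_def by simp_all

lemma I_zero: "AE x in lebesgue. I (\<lambda>y. 0) x = 0"
  using I_scale[OF V_zero, of 0] by simp

lemma fine_zero: "(\<lambda>x. 0) \<in> fine_space_on V I S"
  using V_zero I_zero by (simp add: fine_space_on_def fine_space_def)

lemma fine_add:
  assumes "u \<in> fine_space_on V I S" "v \<in> fine_space_on V I S"
  shows "(\<lambda>x. u x + v x) \<in> fine_space_on V I S"
proof -
  have uv: "u \<in> V" "v \<in> V" and z: "AE x in lebesgue. I u x = 0" "AE x in lebesgue. I v x = 0"
    "AE x in lebesgue. x \<in> unit_cell - S \<longrightarrow> u x = 0" "AE x in lebesgue. x \<in> unit_cell - S \<longrightarrow> v x = 0"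
    using assms by (auto simp: fine_space_on_def fine_space_def)
  have "AE x in lebesgue. I (\<lambda>x. u x + v x) x = 0" using I_add[OF uv] z(1,2) by eventually_elim simp
  moreover have "AE x in lebesgue. x \<in> unit_cell - S \<longrightarrow> u x + v x = 0" using z(3,4) by eventually_elim simp
  ultimately show ?thesis using V_add[OF uv] by (simp add: fine_space_on_def fine_space_def)
qed

lemma fine_scale:
  assumes "v \<in> fine_space_on V I S"
  shows "(\<lambda>x. s * v x) \<in> fine_space_on V I S"
proof -
  have v: "v \<in> V" and z: "AE x in lebesgue. I v x = 0" "AE x in lebesgue. x \<in> unit_cell - S \<longrightarrow> v x = 0"
    using assms by (auto simp: fine_space_on_def fine_space_def)
  have "AE x in lebesgue. I (\<lambda>x. s * v x) x = 0" using I_scale[OF v, of s] z(1) by eventually_elim simp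
  moreover have "AE x in lebesgue. x \<in> unit_cell - S \<longrightarrow> s * v x = 0" using z(2) by eventually_elim simp
  ultimately show ?thesis using V_scale[OF v, of s] by (simp add: fine_space_on_def fine_space_def)
qed

lemma fine_V: "v \<in> fine_space_on V I S \<Longrightarrow> v \<in> V"
  by (simp add: fine_space_on_def fine_space_def)

lemma fine_H1: "v \<in> fine_space_on V I S \<Longrightarrow> v \<in> H1_per0"
  using fine_V V_sub by blast

lemma fine_psd:
  assumes "psd_form H1_per0 B" shows "psd_form (fine_space_on V I S) B"
  by (rule psd_form.subspace[OF assms]) (auto intro: fine_H1 fine_zero fine_add fine_scale)

text \<open>The elementwise estimates, summed over the mesh. The number of elements enters because the patches are
  simply replaced by the whole cell; the constant serves only for completeness and does not reach the final
  estimate.\<close>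

lemma interp_L2_estimate:
  assumes v: "v \<in> V"
  shows "(LINT x:unit_cell|lebesgue. (norm (v x - I v x))\<^sup>2)
    \<le> real (card \<T>) * (C\<^sub>I * mesh_size \<T>)\<^sup>2 * (LINT x:unit_cell|lebesgue. (norm (weak_grad v x))\<^sup>2)"
proof -
  let ?G = "LINT x:unit_cell|lebesgue. (norm (weak_grad v x))\<^sup>2"
  have vH: "v \<in> H1_per0" using v V_sub by blast
  have IH: "I v \<in> H1_per0" using I_coarse[OF v] by (rule coarse_H1)
  have d: "square_integrable_on (\<lambda>x. v x - I v x) unit_cell"
    using square_integrable_axpy[OF unit_cell_sets H1_per0D(2)[OF vH] H1_per0D(2)[OF IH], of "-1"] by simp
  have iS: "set_integrable lebesgue S (\<lambda>x. (norm (v x - I v x))\<^sup>2)" if "S \<in> sets lebesgue" "S \<subseteq> unit_cell" for S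
    using square_integrable_subset[OF d that] by (simp add: square_integrable_on_def)
  have est: "(LINT x:T|lebesgue. (norm (v x - I v x))\<^sup>2) \<le> (C\<^sub>I * mesh_size \<T>)\<^sup>2 * ?G" if T: "T \<in> \<T>" for T
  proof -
    have pm: "(LINT x:patch \<T> 1 T|lebesgue. (norm (weak_grad v x))\<^sup>2) \<le> ?G"
      unfolding set_lebesgue_integral_def
    proof (rule integral_mono)
      show "integrable lebesgue (\<lambda>x. indicator (patch \<T> 1 T) x *\<^sub>R (norm (weak_grad v x))\<^sup>2)"
        using square_integrable_subset[OF H1_per0D(4)[OF vH] patch_sets[OF T] patch_sub[OF T]]
        unfolding square_integrable_on_def set_integrable_def by blast
      show "integrable lebesgue (\<lambda>x. indicator unit_cell x *\<^sub>R (norm (weak_grad v x))\<^sup>2)"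
        using H1_per0D(4)[OF vH] by (simp add: square_integrable_on_def set_integrable_def)
      show "indicator (patch \<T> 1 T) x *\<^sub>R (norm (weak_grad v x))\<^sup>2 \<le> indicator unit_cell x *\<^sub>R (norm (weak_grad v x))\<^sup>2" for x
        using patch_sub[OF T, of 1] by (intro scaleR_right_mono) (auto simp: indicator_def)
    qed
    have nn: "0 \<le> (LINT x:S|lebesgue. (norm (f x))\<^sup>2)" for S and f :: "real ^ 'd \<Rightarrow> 'e::euclidean_space"
      by (simp add: set_lebesgue_integral_def)
    have "L2_norm T (\<lambda>x. v x - I v x) / mesh_size \<T> \<le> C\<^sub>I * L2_norm (patch \<T> 1 T) (weak_grad v)"
    proof -
      have "0 \<le> L2_norm T (weak_grad (I v))" unfolding L2_norm_def by (intro real_sqrt_ge_zero nn)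
      then show ?thesis using I_bound[OF v T] by linarith
    qed
    also have "\<dots> \<le> \<bar>C\<^sub>I\<bar> * L2_norm (patch \<T> 1 T) (weak_grad v)"
      using nn[of "patch \<T> 1 T" "weak_grad v"] by (intro mult_right_mono) (auto simp: L2_norm_def)
    also have "\<dots> \<le> \<bar>C\<^sub>I\<bar> * sqrt ?G"
      using pm unfolding L2_norm_def by (intro mult_left_mono real_sqrt_le_mono) auto
    finally have "L2_norm T (\<lambda>x. v x - I v x) \<le> \<bar>C\<^sub>I\<bar> * mesh_size \<T> * sqrt ?G"
      using size_pos by (simp add: divide_le_eq algebra_simps)
    then have "(L2_norm T (\<lambda>x. v x - I v x))\<^sup>2 \<le> (\<bar>C\<^sub>I\<bar> * mesh_size \<T> * sqrt ?G)\<^sup>2"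
      using nn[of T "\<lambda>x. v x - I v x"] by (intro power_mono) (auto simp: L2_norm_def)
    then show ?thesis
      using nn[of T "\<lambda>x. v x - I v x"] nn[of unit_cell "weak_grad v"]
      by (simp add: L2_norm_def power_mult_distrib)
  qed
  have "(LINT x:unit_cell|lebesgue. (norm (v x - I v x))\<^sup>2) \<le> (\<Sum>T\<in>\<T>. (LINT x:T|lebesgue. (norm (v x - I v x))\<^sup>2))"
  proof -
    have "(LINT x:unit_cell|lebesgue. (norm (v x - I v x))\<^sup>2)
        \<le> (LINT x|lebesgue. (\<Sum>T\<in>\<T>. indicator T x *\<^sub>R (norm (v x - I v x))\<^sup>2))"
      unfolding set_lebesgue_integral_def
    proof (rule integral_mono)
      show "integrable lebesgue (\<lambda>x. indicator unit_cell x *\<^sub>R (norm (v x - I v x))\<^sup>2)"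
        using iS[OF unit_cell_sets] by (simp add: set_integrable_def)
      show "integrable lebesgue (\<lambda>x. \<Sum>T\<in>\<T>. indicator T x *\<^sub>R (norm (v x - I v x))\<^sup>2)"
        using iS[OF elem_sets elem_sub] unfolding set_integrable_def by (intro Bochner_Integration.integrable_sum) 
      fix x
      show "indicator unit_cell x *\<^sub>R (norm (v x - I v x))\<^sup>2 \<le> (\<Sum>T\<in>\<T>. indicator T x *\<^sub>R (norm (v x - I v x))\<^sup>2)"
      proof (cases "x \<in> unit_cell")
        case True
        then obtain T where T: "T \<in> \<T>" "x \<in> T" using mesh_cover by blast
        have "indicator T x *\<^sub>R (norm (v x - I v x))\<^sup>2 \<le> (\<Sum>T\<in>\<T>. indicator T x *\<^sub>R (norm (v x - I v x))\<^sup>2)"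
          by (rule member_le_sum[OF T(1)]) (auto intro: finite_mesh)
        then show ?thesis using T(2) True by simp
      qed (auto intro: sum_nonneg)
    qed
    also have "\<dots> = (\<Sum>T\<in>\<T>. (LINT x:T|lebesgue. (norm (v x - I v x))\<^sup>2))"
      unfolding set_lebesgue_integral_def
      by (rule Bochner_Integration.integral_sum) (use iS[OF elem_sets elem_sub] in \<open>simp add: set_integrable_def\<close>)
    finally show ?thesis .
  qed
  also have "\<dots> \<le> (\<Sum>T\<in>\<T>. (C\<^sub>I * mesh_size \<T>)\<^sup>2 * ?G)" by (rule sum_mono) (rule est)
  finally show ?thesis by simp
qed

text \<open>Functions in the kernel of the interpolation equal their own interpolation error.\<close>

lemma fine_Poincare:
  assumes v: "v \<in> fine_space_on V I S"
  shows "(LINT x:unit_cell|lebesgue. (norm (v x))\<^sup>2)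
    \<le> real (card \<T>) * (C\<^sub>I * mesh_size \<T>)\<^sup>2 * (LINT x:unit_cell|lebesgue. (norm (weak_grad v x))\<^sup>2)"
proof -
  have vV: "v \<in> V" and z: "AE x in lebesgue. I v x = 0" using v by (auto simp: fine_space_on_def fine_space_def)
  have vH: "v \<in> H1_per0" using v by (rule fine_H1)
  have IH: "I v \<in> H1_per0" using I_coarse[OF vV] by (rule coarse_H1)
  have d: "square_integrable_on (\<lambda>x. v x - I v x) unit_cell"
    using square_integrable_axpy[OF unit_cell_sets H1_per0D(2)[OF vH] H1_per0D(2)[OF IH], of "-1"] by simp
  have "(LINT x:unit_cell|lebesgue. (norm (v x))\<^sup>2) = (LINT x:unit_cell|lebesgue. (norm (v x - I v x))\<^sup>2)"
  proof (rule set_integral_cong_AE_integrable)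
    show "AE x in lebesgue. x \<in> unit_cell \<longrightarrow> (norm (v x))\<^sup>2 = (norm (v x - I v x))\<^sup>2"
      using z by eventually_elim simp
  qed (use H1_per0D(2)[OF vH] d in \<open>simp_all add: square_integrable_on_def\<close>)
  then show ?thesis using interp_L2_estimate[OF vV] by simp
qed

text \<open>The complement of a closed patch in the open cell is open, and the boundary of the cell is a null set.\<close>

lemma fine_grad_zero_off:
  assumes U: "closed U" and v: "v \<in> fine_space_on V I U"
  shows "AE x in lebesgue. x \<in> unit_cell \<longrightarrow> x \<notin> U \<longrightarrow> weak_grad v x = 0"
proof -
  have "AE x in lebesgue. x \<in> box 0 1 - U \<longrightarrow> weak_grad v x = 0"
  proof (rule weak_grad_zero_on[OF fine_H1[OF v]])
    show "open (box 0 1 - U)" using U by (intro open_Diff) auto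
    have "AE x in lebesgue. x \<in> unit_cell - U \<longrightarrow> v x = 0" using v by (auto simp: fine_space_on_def)
    then show "AE x in lebesgue. x \<in> box 0 1 - U \<longrightarrow> v x = 0"
      by eventually_elim (use box_subset_cbox[of 0 "1 :: real ^ 'd"] in \<open>auto simp: unit_cell_def\<close>)
  qed
  moreover have "AE x in lebesgue. x \<notin> cbox 0 (1 :: real ^ 'd) - box 0 1"
    by (rule AE_not_in) (simp add: negligible_iff_null_sets[symmetric] negligible_frontier_interval)
  ultimately show ?thesis by eventually_elim (auto simp: unit_cell_def)
qed

lemma fine_diff: "u \<in> fine_space_on V I S \<Longrightarrow> v \<in> fine_space_on V I S \<Longrightarrow> (\<lambda>x. u x - v x) \<in> fine_space_on V I S"
  using fine_add[of u S "\<lambda>x. (-1) * v x"] fine_scale[of v S "-1"] by simp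

text \<open>Since gradients vanish off \<open>U\<close>, the energy on \<open>U\<close> controls them on the whole cell, and the Poincare
  inequality controls the functions. So the sequence converges in the Sobolev space. The interpolation of
  the limit \<open>u\<close> equals minus the interpolation of \<open>w n - u\<close>, which tends to zero because \<open>w n - u\<close> and its
  interpolation error do, so the limit is again a fine-scale function.\<close>

lemma fine_space_complete:
  assumes VH: "V = H1_per0" and U: "closed U" "U \<subseteq> unit_cell" and a: "admissible_coeff a"
    and w: "\<And>n. w n \<in> fine_space_on V I U"
    and rapid: "\<And>n. energy_form a U (\<lambda>x. w (Suc n) x - w n x) (\<lambda>x. w (Suc n) x - w n x) \<le> (1/4) ^ n"
  shows "\<exists>u\<in>fine_space_on V I U. (\<lambda>n. energy_form a U (\<lambda>x. w n x - u x) (\<lambda>x. w n x - u x)) \<longlonglongrightarrow> 0"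
proof -
  have Us: "U \<in> sets lebesgue" using U(1) by (auto intro: borel_closed)
  obtain c where c: "c > 0" "AE x in lebesgue. x \<in> unit_cell \<longrightarrow> c \<le> a x" using a by (auto simp: admissible_coeff_AE)
  obtain M where M: "AE x in lebesgue. x \<in> unit_cell \<longrightarrow> \<bar>a x\<bar> \<le> M"
    using admissible_imp_bounded[OF a] by (auto simp: bounded_coeff_def)
  note ab = admissible_imp_bounded[OF a]
  have wH: "w n \<in> H1_per0" for n using w by (rule fine_H1)
  let ?P = "real (card \<T>) * (C\<^sub>I * mesh_size \<T>)\<^sup>2"
  \<comment> \<open>one constant for the increments of the functions (\<open>?P / c\<close>) and of their gradients (\<open>1 / c\<close>)\<close>
  define K where "K = (1 + ?P) * inverse c"
  have P0: "0 \<le> ?P" by simp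
  let ?d = "\<lambda>n x. w (Suc n) x - w n x"
  have d: "?d n \<in> fine_space_on V I U" for n by (rule fine_diff[OF w w])
  have dH: "?d n \<in> H1_per0" for n using d by (rule fine_H1)
  have dgrad: "(LINT x:unit_cell|lebesgue. (norm (weak_grad (?d n) x))\<^sup>2) \<le> inverse c * (1/4) ^ n" for n
  proof -
    have "(LINT x:unit_cell|lebesgue. (norm (weak_grad (?d n) x))\<^sup>2) \<le> (LINT x|lebesgue. inverse c * (indicator U x *\<^sub>R (a x * (weak_grad (?d n) x \<bullet> weak_grad (?d n) x))))"
      unfolding set_lebesgue_integral_def
    proof (rule integral_mono_AE)
      show "integrable lebesgue (\<lambda>x. indicator unit_cell x *\<^sub>R (norm (weak_grad (?d n) x))\<^sup>2)"
        using H1_per0D(4)[OF dH] by (simp add: square_integrable_on_def set_integrable_def)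
      show "integrable lebesgue (\<lambda>x. inverse c * (indicator U x *\<^sub>R (a x * (weak_grad (?d n) x \<bullet> weak_grad (?d n) x))))"
        using energy_form_integrable[OF Us U(2) ab dH dH] unfolding set_integrable_def by (rule integrable_mult_right)
      show "AE x in lebesgue. indicator unit_cell x *\<^sub>R (norm (weak_grad (?d n) x))\<^sup>2
          \<le> inverse c * (indicator U x *\<^sub>R (a x * (weak_grad (?d n) x \<bullet> weak_grad (?d n) x)))"
        using fine_grad_zero_off[OF U(1) d[of n]] c(2)
      proof eventually_elim
        case (elim x)
        show ?case
        proof (cases "x \<in> U")
          case True
          then have "c * (weak_grad (?d n) x \<bullet> weak_grad (?d n) x) \<le> a x * (weak_grad (?d n) x \<bullet> weak_grad (?d n) x)"
            using elim(2) U(2) by (intro mult_right_mono) auto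
          then have "weak_grad (?d n) x \<bullet> weak_grad (?d n) x \<le> inverse c * (a x * (weak_grad (?d n) x \<bullet> weak_grad (?d n) x))"
            using c(1) by (simp add: field_simps)
          then show ?thesis using True U(2) by (auto simp: power2_norm_eq_inner)
        next
          case False
          then show ?thesis using elim(1) by (cases "x \<in> unit_cell") auto
        qed
      qed
    qed
    also have "\<dots> = inverse c * energy_form a U (?d n) (?d n)"
      unfolding energy_form_def set_lebesgue_integral_def by (rule integral_mult_right_zero)
    also have "\<dots> \<le> inverse c * (1/4) ^ n" using rapid c(1) by (intro mult_left_mono) auto
    finally show ?thesis .
  qed
  have ic: "0 \<le> inverse c * (1/4) ^ n" for n :: nat using c(1) by simp
  have K1: "(LINT x:unit_cell|lebesgue. (norm (w (Suc n) x - w n x))\<^sup>2) \<le> K * (1/4) ^ n" for n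
  proof -
    have "(LINT x:unit_cell|lebesgue. (norm (?d n x))\<^sup>2) \<le> ?P * (inverse c * (1/4) ^ n)"
      using order_trans[OF fine_Poincare[OF d] mult_left_mono[OF dgrad P0]] .
    also have "\<dots> \<le> (1 + ?P) * (inverse c * (1/4) ^ n)" using ic by (intro mult_right_mono) auto
    finally show ?thesis by (simp only: K_def mult.assoc)
  qed
  have K2: "(LINT x:unit_cell|lebesgue. (norm (weak_grad (w (Suc n)) x - weak_grad (w n) x))\<^sup>2) \<le> K * (1/4) ^ n" for n
  proof -
    have "(LINT x:unit_cell|lebesgue. (norm (weak_grad (w (Suc n)) x - weak_grad (w n) x))\<^sup>2)
        = (LINT x:unit_cell|lebesgue. (norm (weak_grad (?d n) x))\<^sup>2)"
    proof (rule set_integral_cong_AE_integrable)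
      show "set_integrable lebesgue unit_cell (\<lambda>x. (norm (weak_grad (w (Suc n)) x - weak_grad (w n) x))\<^sup>2)"
        using square_integrable_axpy[OF unit_cell_sets H1_per0D(4)[OF wH] H1_per0D(4)[OF wH], of "Suc n" "-1" n]
        by (simp add: square_integrable_on_def)
      show "set_integrable lebesgue unit_cell (\<lambda>x. (norm (weak_grad (?d n) x))\<^sup>2)"
        using H1_per0D(4)[OF dH] by (simp add: square_integrable_on_def)
      show "AE x in lebesgue. x \<in> unit_cell \<longrightarrow> (norm (weak_grad (w (Suc n)) x - weak_grad (w n) x))\<^sup>2 = (norm (weak_grad (?d n) x))\<^sup>2"
        using H1_axpy(2)[OF wH wH, of "Suc n" "-1" n] by eventually_elim simp
    qed
    also have "\<dots> \<le> 1 * (inverse c * (1/4) ^ n)" using dgrad[of n] by simp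
    also have "\<dots> \<le> (1 + ?P) * (inverse c * (1/4) ^ n)" using ic P0 by (intro mult_right_mono) auto
    finally show ?thesis by (simp only: K_def mult.assoc)
  qed
  obtain u where u: "u \<in> H1_per0" and lim_ae: "AE x in lebesgue. (\<lambda>n. w n x) \<longlonglongrightarrow> u x"
    and lim0: "(\<lambda>n. LINT x:unit_cell|lebesgue. (norm (w n x - u x))\<^sup>2) \<longlonglongrightarrow> 0"
    and lim1: "(\<lambda>n. LINT x:unit_cell|lebesgue. (norm (weak_grad (w n) x - weak_grad u x))\<^sup>2) \<longlonglongrightarrow> 0"
    using H1_per0_complete[OF wH K1 K2] by auto
  let ?e = "\<lambda>n x. w n x - u x"
  have eH: "?e n \<in> H1_per0" for n using H1_axpy(1)[OF wH u, of n "-1"] by simp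
  have egrad: "AE x in lebesgue. weak_grad (?e n) x = weak_grad (w n) x - weak_grad u x" for n
    using H1_axpy(2)[OF wH u, of n "-1"] by simp
  have eeq: "(LINT x:unit_cell|lebesgue. (norm (weak_grad (?e n) x))\<^sup>2)
      = (LINT x:unit_cell|lebesgue. (norm (weak_grad (w n) x - weak_grad u x))\<^sup>2)" for n
  proof (rule set_integral_cong_AE_integrable)
    show "set_integrable lebesgue unit_cell (\<lambda>x. (norm (weak_grad (w n) x - weak_grad u x))\<^sup>2)"
      using square_integrable_axpy[OF unit_cell_sets H1_per0D(4)[OF wH] H1_per0D(4)[OF u], of n "-1"]
      by (simp add: square_integrable_on_def)
    show "set_integrable lebesgue unit_cell (\<lambda>x. (norm (weak_grad (?e n) x))\<^sup>2)"
      using H1_per0D(4)[OF eH] by (simp add: square_integrable_on_def)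
    show "AE x in lebesgue. x \<in> unit_cell \<longrightarrow> (norm (weak_grad (?e n) x))\<^sup>2 = (norm (weak_grad (w n) x - weak_grad u x))\<^sup>2"
      using egrad[of n] by eventually_elim simp
  qed
  have lim1': "(\<lambda>n. LINT x:unit_cell|lebesgue. (norm (weak_grad (?e n) x))\<^sup>2) \<longlonglongrightarrow> 0"
    unfolding eeq by (rule lim1)
  have uV: "u \<in> V" and eV: "?e n \<in> V" for n using u eH VH by auto
  have Iu: "AE x in lebesgue. I u x = 0"
  proof -
    have IuH: "I u \<in> H1_per0" by (rule coarse_H1[OF I_coarse[OF uV]])
    have Ie: "AE x in lebesgue. I (?e n) x = - I u x" for n
    proof -
      have "AE x in lebesgue. I (\<lambda>y. w n y + (-1) * u y) x = I (w n) x + I (\<lambda>y. (-1) * u y) x"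
        by (rule I_add[OF fine_V[OF w] V_scale[OF uV]])
      moreover have "AE x in lebesgue. I (\<lambda>y. (-1) * u y) x = (-1) * I u x" by (rule I_scale[OF uV])
      moreover have "AE x in lebesgue. I (w n) x = 0" using w[of n] by (simp add: fine_space_on_def fine_space_def)
      ultimately show ?thesis by eventually_elim simp
    qed
    have IeH: "I (?e n) \<in> H1_per0" for n by (rule coarse_H1[OF I_coarse[OF eV]])
    have sq: "set_integrable lebesgue unit_cell (\<lambda>x. (norm (v x))\<^sup>2)" if "v \<in> H1_per0" for v
      using H1_per0D(2)[OF that] by (simp add: square_integrable_on_def)
    have dI: "(\<lambda>x. ?e n x - I (?e n) x) \<in> H1_per0" for n using H1_axpy(1)[OF eH IeH, of n "-1" n] by simp
    \<comment> \<open>from \<open>I u = ?e n - I (?e n) - ?e n\<close>, up to null sets\<close>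
    have le: "(LINT x:unit_cell|lebesgue. (norm (I u x))\<^sup>2)
        \<le> 2 * (LINT x:unit_cell|lebesgue. (norm (?e n x))\<^sup>2) + 2 * (?P * (LINT x:unit_cell|lebesgue. (norm (weak_grad (?e n) x))\<^sup>2))" for n
    proof -
      have "(LINT x:unit_cell|lebesgue. (norm (I u x))\<^sup>2)
          \<le> (LINT x:unit_cell|lebesgue. 2 * (norm (?e n x))\<^sup>2 + 2 * (norm (?e n x - I (?e n) x))\<^sup>2)"
        unfolding set_lebesgue_integral_def
      proof (rule integral_mono_AE)
        show "integrable lebesgue (\<lambda>x. indicator unit_cell x *\<^sub>R (norm (I u x))\<^sup>2)"
          using sq[OF IuH] by (simp add: set_integrable_def)
        show "integrable lebesgue (\<lambda>x. indicator unit_cell x *\<^sub>R (2 * (norm (?e n x))\<^sup>2 + 2 * (norm (?e n x - I (?e n) x))\<^sup>2))"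
          using set_integral_add(1)[OF set_integrable_mult_right[OF sq[OF eH]] set_integrable_mult_right[OF sq[OF dI]], of 2 n 2 n]
          by (simp add: set_integrable_def)
        show "AE x in lebesgue. indicator unit_cell x *\<^sub>R (norm (I u x))\<^sup>2
            \<le> indicator unit_cell x *\<^sub>R (2 * (norm (?e n x))\<^sup>2 + 2 * (norm (?e n x - I (?e n) x))\<^sup>2)"
          using Ie[of n]
        proof eventually_elim
          case (elim x)
          define p where "p = ?e n x"
          define q where "q = p - I (?e n) x"
          have "I u x = q - p" using elim by (simp add: q_def)
          moreover have "0 \<le> (p + q)\<^sup>2" by simp
          ultimately have "(I u x)\<^sup>2 \<le> 2 * p\<^sup>2 + 2 * q\<^sup>2" by (simp add: power2_sum power2_diff mult.commute mult.left_commute)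
          then show ?case unfolding p_def q_def by (auto simp: indicator_def)
        qed
      qed
      also have "\<dots> = 2 * (LINT x:unit_cell|lebesgue. (norm (?e n x))\<^sup>2) + 2 * (LINT x:unit_cell|lebesgue. (norm (?e n x - I (?e n) x))\<^sup>2)"
        by (subst set_integral_add(2)[OF set_integrable_mult_right[OF sq[OF eH]] set_integrable_mult_right[OF sq[OF dI]]])
          (simp only: set_integral_mult_right)
      also have "\<dots> \<le> 2 * (LINT x:unit_cell|lebesgue. (norm (?e n x))\<^sup>2) + 2 * (?P * (LINT x:unit_cell|lebesgue. (norm (weak_grad (?e n) x))\<^sup>2))"
        using interp_L2_estimate[OF eV, of n] by simp
      finally show ?thesis .
    qed
    have "(\<lambda>n. 2 * (LINT x:unit_cell|lebesgue. (norm (?e n x))\<^sup>2) + 2 * (?P * (LINT x:unit_cell|lebesgue. (norm (weak_grad (?e n) x))\<^sup>2))) \<longlonglongrightarrow> 2 * 0 + 2 * (?P * 0)"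
      by (intro tendsto_add tendsto_mult tendsto_const lim0 lim1')
    then have "(LINT x:unit_cell|lebesgue. (norm (I u x))\<^sup>2) \<le> 2 * 0 + 2 * (?P * 0)"
      by (rule LIMSEQ_le_const) (use le in blast)
    then have z: "(LINT x|lebesgue. indicator unit_cell x *\<^sub>R (norm (I u x))\<^sup>2) \<le> 0"
      by (simp add: set_lebesgue_integral_def)
    have "(LINT x|lebesgue. indicator unit_cell x *\<^sub>R (norm (I u x))\<^sup>2) = 0"
      by (rule antisym[OF z]) simp
    moreover have "integrable lebesgue (\<lambda>x. indicator unit_cell x *\<^sub>R (norm (I u x))\<^sup>2)"
      using sq[OF IuH] by (simp add: set_integrable_def)
    ultimately have "AE x in lebesgue. indicator unit_cell x *\<^sub>R (norm (I u x))\<^sup>2 = 0"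
      by (subst (asm) integral_nonneg_eq_0_iff_AE) auto
    then have "AE x in lebesgue. x \<in> unit_cell \<longrightarrow> I u x = 0"
      by eventually_elim (auto simp: indicator_def)
    then show ?thesis by (rule H1_AE_zero_from_cell[OF IuH])
  qed
  have vanish: "AE x in lebesgue. x \<in> unit_cell - U \<longrightarrow> u x = 0"
  proof -
    have "AE x in lebesgue. \<forall>n. x \<in> unit_cell - U \<longrightarrow> w n x = 0"
      unfolding AE_all_countable using w by (auto simp: fine_space_on_def)
    then show ?thesis using lim_ae by eventually_elim (auto simp: LIMSEQ_const_iff)
  qed
  have uF: "u \<in> fine_space_on V I U" using uV Iu vanish by (simp add: fine_space_on_def fine_space_def)
  have "(\<lambda>n. energy_form a U (?e n) (?e n)) \<longlonglongrightarrow> 0"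
  proof (rule tendsto_sandwich[OF _ _ tendsto_const])
    have "AE x in lebesgue. x \<in> unit_cell \<longrightarrow> 0 \<le> a x" using admissible_pos[OF a] by eventually_elim auto
    then show "\<forall>\<^sub>F n in sequentially. 0 \<le> energy_form a U (?e n) (?e n)"
      using psd_form.nonneg[OF energy_form_psd[OF Us U(2) ab] eH] by simp
    show "(\<lambda>n. \<bar>M\<bar> * (LINT x:unit_cell|lebesgue. (norm (weak_grad (?e n) x))\<^sup>2)) \<longlonglongrightarrow> 0"
      using tendsto_mult[OF tendsto_const[of "\<bar>M\<bar>"] lim1'] by simp
    have "energy_form a U (?e n) (?e n) \<le> \<bar>M\<bar> * (LINT x:unit_cell|lebesgue. (norm (weak_grad (?e n) x))\<^sup>2)" for n
    proof -
      have "energy_form a U (?e n) (?e n) \<le> (LINT x|lebesgue. \<bar>M\<bar> * (indicator unit_cell x *\<^sub>R (norm (weak_grad (?e n) x))\<^sup>2))"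
        unfolding energy_form_def set_lebesgue_integral_def
      proof (rule integral_mono_AE)
        show "integrable lebesgue (\<lambda>x. indicator U x *\<^sub>R (a x * (weak_grad (?e n) x \<bullet> weak_grad (?e n) x)))"
          using energy_form_integrable[OF Us U(2) ab eH eH] by (simp add: set_integrable_def)
        show "integrable lebesgue (\<lambda>x. \<bar>M\<bar> * (indicator unit_cell x *\<^sub>R (norm (weak_grad (?e n) x))\<^sup>2))"
          using H1_per0D(4)[OF eH] unfolding square_integrable_on_def set_integrable_def by (intro integrable_mult_right) blast
        show "AE x in lebesgue. indicator U x *\<^sub>R (a x * (weak_grad (?e n) x \<bullet> weak_grad (?e n) x))
            \<le> \<bar>M\<bar> * (indicator unit_cell x *\<^sub>R (norm (weak_grad (?e n) x))\<^sup>2)"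
          using M
        proof eventually_elim
          case (elim x)
          show ?case
          proof (cases "x \<in> U")
            case True
            then have "a x \<le> \<bar>M\<bar>" "x \<in> unit_cell" using elim U(2) by auto
            then have "a x * (weak_grad (?e n) x \<bullet> weak_grad (?e n) x) \<le> \<bar>M\<bar> * (weak_grad (?e n) x \<bullet> weak_grad (?e n) x)"
              by (intro mult_right_mono) auto
            then show ?thesis using True \<open>x \<in> unit_cell\<close> by (simp add: power2_norm_eq_inner)
          qed simp
        qed
      qed
      also have "\<dots> = \<bar>M\<bar> * (LINT x:unit_cell|lebesgue. (norm (weak_grad (?e n) x))\<^sup>2)"
        unfolding set_lebesgue_integral_def by (rule integral_mult_right_zero)
      finally show ?thesis .
    qed
    then show "\<forall>\<^sub>F n in sequentially. energy_form a U (?e n) (?e n) \<le> \<bar>M\<bar> * (LINT x:unit_cell|lebesgue. (norm (weak_grad (?e n) x))\<^sup>2)"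
      by simp
  qed
  then show ?thesis using uF by blast
qed

text \<open>The two admissible ansatz spaces need different arguments: completeness and the Riesz representation in
  the Sobolev space, finite dimension and a Galerkin solution in a finite element space.\<close>

lemma corrector_exists:
  assumes U: "closed U" "U \<subseteq> unit_cell" and T: "T \<in> sets lebesgue" "T \<subseteq> U" and a: "admissible_coeff a" and v: "v \<in> H1_per0"
  shows "\<exists>\<phi>\<in>fine_space_on V I U. \<forall>w\<in>fine_space_on V I U. energy_form a U \<phi> w = energy_form a T v w"
proof -
  have Us: "U \<in> sets lebesgue" using U(1) by (auto intro: borel_closed)
  have Tc: "T \<subseteq> unit_cell" using T U by blast
  note ab = admissible_imp_bounded[OF a]
  note nn = admissible_nonneg[OF a]
  interpret BT: psd_form H1_per0 "energy_form a T" by (rule energy_form_psd[OF T(1) Tc ab nn])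
  interpret BU: psd_form H1_per0 "energy_form a U" by (rule energy_form_psd[OF Us U(2) ab nn])
  interpret W: psd_form "fine_space_on V I U" "energy_form a U" by (rule fine_psd[OF BU.psd_form_axioms])
  have L1: "energy_form a T v (\<lambda>x. u x + w x) = energy_form a T v u + energy_form a T v w"
    if "u \<in> fine_space_on V I U" "w \<in> fine_space_on V I U" for u w
    using BT.add_left[OF that[THEN fine_H1] v] by (simp add: energy_form_def inner_commute)
  have L2: "energy_form a T v (\<lambda>x. s * w x) = s * energy_form a T v w" if "w \<in> fine_space_on V I U" for s w
    using BT.scale_left[OF fine_H1[OF that] v] by (simp add: energy_form_def inner_commute)
  have L3: "\<bar>energy_form a T v w\<bar> \<le> sqrt (energy_form a T v v) * sqrt (energy_form a U w w)"
    if "w \<in> fine_space_on V I U" for w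
  proof -
    note wH = fine_H1[OF that]
    have "(energy_form a T v w)\<^sup>2 \<le> energy_form a T v v * energy_form a T w w" by (rule BT.Cauchy_Schwarz[OF v wH])
    also have "\<dots> \<le> energy_form a T v v * energy_form a U w w"
      by (intro mult_left_mono energy_form_mono[OF T(1) Us T(2) U(2) ab nn wH] BT.nonneg v)
    finally have "sqrt ((energy_form a T v w)\<^sup>2) \<le> sqrt (energy_form a T v v * energy_form a U w w)"
      by (rule real_sqrt_le_mono)
    then show ?thesis by (simp add: real_sqrt_mult)
  qed
  consider "V = H1_per0" | "fe_space \<T> V" using ansatz by (auto simp: ansatz_space_def)
  then show ?thesis
  proof cases
    case 1
    show ?thesis
      by (rule W.Riesz_solution[OF fine_space_complete[OF 1 U a] L1 L2 L3]; assumption)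
  next
    case 2
    then obtain \<S> p where S: "quad_mesh \<S>" "V \<subseteq> H1_per0 \<inter> piecewise_Q p \<S>"
      unfolding fe_space_def by (elim exE conjE) rule
    then have S': "finite \<S>" "\<Union>\<S> = unit_cell" by (auto simp: quad_mesh_def)
    obtain b where b: "piecewise_Q p \<S> \<subseteq> ae_span (lebesgue_on unit_cell) b (\<S> \<times> {\<alpha> :: 'd \<Rightarrow> nat. \<forall>j. \<alpha> j \<le> p})"
      using piecewise_Q_finite_span[OF S'] by blast
    have sub: "fine_space_on V I U \<subseteq> ae_span (lebesgue_on unit_cell) b (\<S> \<times> {\<alpha> :: 'd \<Rightarrow> nat. \<forall>j. \<alpha> j \<le> p})"
      using b S(2) fine_V by blast
    have "energy_form a U w w = 0" if "w \<in> fine_space_on V I U" "AE x in lebesgue_on unit_cell. w x = 0" for w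
      using H1_AE_zero_grad[OF fine_H1[OF that(1)] that(2)]
      by (intro energy_form_zero_of_grad_zero) (auto elim: eventually_mono)
    from orthonormal_basis_exists[OF finite_cartesian_product[OF S'(1) finite_multi_indices] W.psd_form_axioms sub this]
    obtain e k where "W.orthonormal_basis e k" by blast
    from W.Galerkin_solution[OF this, of "energy_form a T v"] show ?thesis
      using L1 L2 L3 by fastforce
  qed
qed

end

section \<open>Overlap of the patches\<close>

lemma coord_poly_differentiable: 
  fixes f :: "real ^ 'd \<Rightarrow> real"
  assumes "coord_poly p f" shows "f differentiable (at x)"
proof -
  obtain c where f: "f = (\<lambda>x. \<Sum>\<alpha>\<in>{\<alpha>. \<forall>j. \<alpha> j \<le> p}. c \<alpha> * (\<Prod>j\<in>UNIV. x $ j ^ \<alpha> j))"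
    using assms unfolding coord_poly_def fun_eq_iff[symmetric] by blast
  have comp: "(\<lambda>x :: real ^ 'd. x $ j) differentiable (at x)" for j
    by (intro bounded_linear_imp_differentiable bounded_linear_vec_nth)
  have mon: "(\<lambda>x :: real ^ 'd. \<Prod>j\<in>J. x $ j ^ \<alpha> j) differentiable (at x)" if "finite J" for J and \<alpha> :: "'d \<Rightarrow> nat"
    using that
  proof (induction J rule: finite_induct)
    case (insert j J)
    have "(\<lambda>x :: real ^ 'd. x $ j ^ \<alpha> j * (\<Prod>j\<in>J. x $ j ^ \<alpha> j)) differentiable (at x)"
      by (rule differentiable_mult[OF differentiable_power[OF comp] insert.IH])
    then show ?case using insert by simp
  qed simp
  show ?thesis unfolding f
  proof (rule differentiable_sum[OF finite_multi_indices], intro ballI)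
    fix \<alpha> :: "'d \<Rightarrow> nat"
    show "(\<lambda>x. c \<alpha> * (\<Prod>j\<in>UNIV. x $ j ^ \<alpha> j)) differentiable (at x)"
      by (rule differentiable_mult[OF differentiable_const mon]) simp
  qed
qed

lemma axis_Basis: "axis j (1::real) \<in> Basis"
  by (auto simp: Basis_vec_def)

text \<open>A proper face of the cube lies in a hyperplane, and differentiable maps preserve null sets.\<close>

lemma quad_face_negligible:
  assumes "quad_face S T" shows "negligible S"
proof -
  obtain F f where Ff: "quad_map F T" "cube_face f" "S = F ` f"
    using assms unfolding quad_face_def by (elim exE conjE) rule
  obtain J0 J1 where J: "J0 \<union> J1 \<noteq> {}" "f = {x \<in> unit_cell. (\<forall>j\<in>J0. x $ j = 0) \<and> (\<forall>j\<in>J1. x $ j = 1)}"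
    using Ff(2) unfolding cube_face_def by (elim exE conjE) rule
  obtain j where "j \<in> J0 \<or> j \<in> J1" using J(1) by blast
  then have "f \<subseteq> {x. x $ j = 0} \<or> f \<subseteq> {x. x $ j = 1}" using J(2) by auto
  then have "negligible f"
    using negligible_subset[OF negligible_standard_hyperplane[OF axis_Basis, of j 0], of f]
      negligible_subset[OF negligible_standard_hyperplane[OF axis_Basis, of j 1], of f]
    by (elim disjE) (simp_all add: inner_axis)
  moreover have "F differentiable_on f"
    unfolding differentiable_on_def
  proof
    fix x assume "x \<in> f"
    have "F differentiable (at x)"
      unfolding differentiable_componentwise_within[of F x UNIV]
    proof
      fix i :: "real ^ 'a" assume "i \<in> Basis"
      then obtain j where "i = axis j 1" by (auto simp: Basis_vec_def)
      moreover have "coord_poly 1 (\<lambda>x. F x $ j)" using Ff(1) by (simp add: quad_map_def)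
      ultimately show "(\<lambda>x. F x \<bullet> i) differentiable (at x)"
        using coord_poly_differentiable[of 1 "\<lambda>x. F x $ j" x] by (simp add: inner_axis)
    qed
    then show "F differentiable (at x within f)" by (rule differentiable_at_withinI)
  qed
  ultimately show ?thesis unfolding Ff(3)
    by (intro negligible_differentiable_image_negligible) auto
qed

lemma diameter_translate:
  assumes "bounded S" shows "diameter (translate k S) = diameter S"
proof -
  have le: "diameter (translate k S) \<le> diameter S" if "bounded S" for k and S :: "(real ^ 'a) set"
  proof (cases "S = {}")
    case False
    show ?thesis
    proof (rule diameter_le)
      show "translate k S \<noteq> {} \<or> 0 \<le> diameter S" using False by (simp add: translate_def)
      fix x y assume "x \<in> translate k S" "y \<in> translate k S"
      then show "norm (x - y) \<le> diameter S"
        using diameter_bounded_bound[OF that] by (auto simp: translate_def dist_norm)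
    qed
  qed (simp add: translate_def)
  have "bounded (translate k S)"
    using bounded_translation[OF assms, of k] by (simp add: translate_def add.commute)
  moreover have "translate (- k) (translate k S) = S" by (auto simp: translate_def image_image)
  ultimately have "diameter S \<le> diameter (translate k S)" using le[of "translate k S" "- k"] by simp
  then show ?thesis using le[OF assms, of k] by simp
qed

context lod begin

lemma elem_diameter_pos:
  assumes T: "T \<in> \<T>" shows "diameter T > 0"
proof -
  obtain F where F: "quad_map F T" using mesh T by (auto simp: quad_mesh_def quadrilateral_def)
  have c: "0 \<in> (unit_cell :: (real ^ 'd) set)" "1 \<in> (unit_cell :: (real ^ 'd) set)"
    by (auto simp: unit_cell_def mem_box_cart)
  have "F 0 \<noteq> F 1"
  proof
    assume "F 0 = F 1"
    then have "(0 :: real ^ 'd) = 1" using F c by (auto simp: quad_map_def dest: inj_onD)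
    then show False by simp
  qed
  moreover have "F 0 \<in> T" "F 1 \<in> T" using F c by (auto simp: quad_map_def)
  then have "dist (F 0) (F 1) \<le> diameter T"
    by (intro diameter_bounded_bound compact_imp_bounded elem_compact T)
  ultimately show ?thesis by (smt (verit) zero_less_dist_iff)
qed

text \<open>Every layer of the patch adds at most one element diameter, measured on the torus.\<close>

lemma patch_chain:
  assumes T: "T \<in> \<T>" and D: "\<And>T. T \<in> \<T> \<Longrightarrow> diameter T = D"
  shows "x \<in> patch \<T> m T \<Longrightarrow> \<exists>k\<in>int_vecs. \<exists>y\<in>T. dist x (y + k) \<le> real m * D"
proof (induction m arbitrary: x)
  case 0
  then show ?case by (intro bexI[of _ 0] bexI[of _ x]) (auto simp: int_vecs_def)
next
  case (Suc m)
  then obtain T' k z where T': "T' \<in> \<T>" "x \<in> T'" and k: "k \<in> int_vecs"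
    and z: "z \<in> closure (patch \<T> m T)" "z \<in> translate k (closure T')" by auto
  have "z \<in> patch \<T> m T" using z(1) patch_closed[OF T] closure_closed by blast
  then obtain l y where ly: "l \<in> int_vecs" "y \<in> T" "dist z (y + l) \<le> real m * D" using Suc.IH by blast
  have "closure T' = T'" using elem_compact[OF T'(1)] compact_imp_closed closure_closed by blast
  then obtain z' where z': "z' \<in> T'" "z = z' + k" using z(2) by (auto simp: translate_def)
  have "dist x z' \<le> D"
    using diameter_bounded_bound[OF compact_imp_bounded[OF elem_compact[OF T'(1)]] T'(2) z'(1)] D[OF T'(1)] by simp
  moreover have "dist z' (y + (l - k)) = dist z (y + l)" by (simp add: z'(2) dist_norm algebra_simps)
  moreover have "dist x (y + (l - k)) \<le> dist x z' + dist z' (y + (l - k))" by (rule dist_triangle)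
  ultimately have "dist x (y + (l - k)) \<le> real (Suc m) * D" using ly(3) by (simp add: algebra_simps)
  then show ?case using ly(1,2) k by (intro bexI[of _ "l - k"] bexI[of _ y] diff_int_vecs)
qed

text \<open>If the elements differ on the torus, conformity makes their intersection a proper face. They cannot be
  translates of each other by a nonzero integer vector: both lie in the cell, so they would be contained in
  opposite sides of it, but an element contains a ball.\<close>

lemma shifted_elements_no_common_ball:
  assumes T: "T1 \<in> \<T>" "T2 \<in> \<T>" "T1 \<noteq> T2" and k: "k \<in> int_vecs"
    and ball: "ball c r \<subseteq> T2" "r > 0" and B: "open B" "B \<subseteq> T1 \<inter> translate k T2"
  shows "B = {}"
proof (rule ccontr)
  assume ne: "B \<noteq> {}"
  then have meet: "T1 \<inter> translate k T2 \<noteq> {}" using B by blast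
  show False
  proof (cases "T1 = translate k T2")
    case False
    then have "quad_face (T1 \<inter> translate k T2) T1"
      using mesh T(1,2) k meet unfolding quad_mesh_def by blast
    then have "negligible B" using quad_face_negligible negligible_subset B(2) by blast
    then show False using open_not_negligible[OF B(1) ne] by simp
  next
    case True
    have "k \<noteq> 0" using True T(3) by (auto simp: translate_def)
    then obtain j where j: "k $ j \<noteq> 0" by (auto simp: vec_eq_iff)
    have cellj: "0 \<le> y $ j" "y $ j \<le> 1" "0 \<le> y $ j + k $ j" "y $ j + k $ j \<le> 1" if "y \<in> T2" for y
    proof -
      have "y \<in> unit_cell" "y + k \<in> unit_cell" using that True elem_sub[OF T(1)] elem_sub[OF T(2)] by (auto simp: translate_def)
      then show "0 \<le> y $ j" "y $ j \<le> 1" "0 \<le> y $ j + k $ j" "y $ j + k $ j \<le> 1"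
        by (auto simp: unit_cell_def mem_box_cart dest: spec[of _ j])
    qed
    \<comment> \<open>The first point is off the side \<open>x $ j = 0\<close> of the cell, the second off the side \<open>x $ j = 1\<close>.\<close>
    have "c + (r/2) *\<^sub>R axis j 1 \<in> T2" "c - (r/2) *\<^sub>R axis j 1 \<in> T2"
      using ball by (auto simp: dist_norm subset_iff norm_axis_1)
    from cellj[OF this(1)] cellj[OF this(2)]
    have "- 1 < k $ j" "k $ j < 1" using ball(2) by (auto simp: axis_def)
    moreover have "k $ j \<in> \<int>" using k by (simp add: int_vecs_def)
    ultimately have "k $ j = 0" by (auto elim!: Ints_cases)
    then show False using j by simp
  qed
qed

text \<open>If \<open>x\<close> lies in the patches of several elements, then suitable integer translates of these elements lie in
  the ball about \<open>x\<close> whose radius is \<open>m + 1\<close> element diameters. By shape regularity they contain balls with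
  radius \<open>\<gamma>\<close> diameters, which are disjoint, and the volumes are compared. All elements have the same
  diameter because they are translates of each other.\<close>

lemma patch_overlap:
  assumes \<gamma>: "\<gamma> > 0" and shape: "shape_regular \<gamma> \<T>" and per: "period_compatible \<epsilon> \<T>"
  shows "real (card {T \<in> \<T>. x \<in> patch \<T> m T}) \<le> ((real m + 1) / \<gamma>) ^ CARD('d)"
proof (cases "{T \<in> \<T>. x \<in> patch \<T> m T} = {}")
  case True
  then show ?thesis using \<gamma> by (simp only: card.empty) simp
next
  case False
  define S where "S = {T \<in> \<T>. x \<in> patch \<T> m T}"
  obtain T0 where T0: "T0 \<in> \<T>" using False by blast
  define D where "D = diameter T0"
  have D: "diameter T = D" if T: "T \<in> \<T>" for T
  proof -
    have "\<exists>k\<in>int_vecs. T = translate (\<epsilon> *\<^sub>R k) T0" using per T0 T by (simp add: period_compatible_def)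
    then obtain k where "T = translate (\<epsilon> *\<^sub>R k) T0" by (rule bexE)
    then show ?thesis unfolding D_def using diameter_translate[OF compact_imp_bounded[OF elem_compact[OF T0]]] by simp
  qed
  have Dpos: "D > 0" unfolding D_def by (rule elem_diameter_pos[OF T0])
  define r where "r = \<gamma> * D"
  have r: "r > 0" using \<gamma> Dpos by (simp add: r_def)
  have "\<forall>T\<in>\<T>. \<exists>c. ball c r \<subseteq> T" using shape D by (auto simp: shape_regular_def r_def)
  then obtain c where c: "\<And>T. T \<in> \<T> \<Longrightarrow> ball (c T) r \<subseteq> T" by (auto dest!: bchoice)
  have "\<forall>T\<in>S. \<exists>k. k \<in> int_vecs \<and> (\<exists>y\<in>T. dist x (y + k) \<le> real m * D)"
  proof
    fix T assume "T \<in> S"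
    then have T: "T \<in> \<T>" "x \<in> patch \<T> m T" by (auto simp: S_def)
    show "\<exists>k. k \<in> int_vecs \<and> (\<exists>y\<in>T. dist x (y + k) \<le> real m * D)"
      using patch_chain[OF T(1) D T(2)] by blast
  qed
  from bchoice[OF this] obtain k where k: "\<And>T. T \<in> S \<Longrightarrow> k T \<in> int_vecs" "\<And>T. T \<in> S \<Longrightarrow> \<exists>y\<in>T. dist x (y + k T) \<le> real m * D"
    by auto
  define B where "B = (\<lambda>T. ball (c T + k T) r)"
  have SU: "T \<in> \<T>" if "T \<in> S" for T using that by (simp add: S_def)
  have Bsub: "B T \<subseteq> translate (k T) T" if T: "T \<in> S" for T
  proof
    fix z assume "z \<in> B T"
    then have "z - k T \<in> ball (c T) r" by (simp add: B_def dist_norm algebra_simps)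
    then have "z - k T \<in> T" using c[OF SU[OF T]] by blast
    then show "z \<in> translate (k T) T" by (auto simp: translate_def image_iff intro: bexI[of _ "z - k T"])
  qed
  have Bball: "B T \<subseteq> cball x ((real m + 1) * D)" if T: "T \<in> S" for T
  proof
    fix z assume "z \<in> B T"
    then obtain z' where z': "z' \<in> T" "z = z' + k T" using Bsub[OF T] by (auto simp: translate_def)
    obtain y where y: "y \<in> T" "dist x (y + k T) \<le> real m * D" using k(2)[OF T] by blast
    have "dist y z' \<le> D"
      using diameter_bounded_bound[OF compact_imp_bounded[OF elem_compact[OF SU[OF T]]] y(1) z'(1)] D[OF SU[OF T]] by simp
    then have "dist (y + k T) z \<le> D" by (simp add: z'(2))
    then have "dist x z \<le> real m * D + D" using y(2) dist_triangle[of x z "y + k T"] by linarith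
    then show "z \<in> cball x ((real m + 1) * D)" by (simp add: algebra_simps)
  qed
  have disj: "disjnt (B T1) (B T2)" if T: "T1 \<in> S" "T2 \<in> S" "T1 \<noteq> T2" for T1 T2
  proof -
    let ?B = "(+) (- k T1) ` (B T1 \<inter> B T2)"
    have "?B = {}"
    proof (rule shifted_elements_no_common_ball[OF SU[OF T(1)] SU[OF T(2)] T(3) _ c[OF SU[OF T(2)]] r])
      show "k T2 - k T1 \<in> int_vecs" by (intro diff_int_vecs k T)
      show "open ?B" by (intro open_translation open_Int) (auto simp: B_def)
      show "?B \<subseteq> T1 \<inter> translate (k T2 - k T1) T2"
      proof
        fix z assume "z \<in> ?B"
        then have z: "z + k T1 \<in> B T1" "z + k T1 \<in> B T2" by auto
        then have "z + k T1 \<in> translate (k T1) T1" "z + k T1 \<in> translate (k T2) T2" using Bsub T by blast+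
        then show "z \<in> T1 \<inter> translate (k T2 - k T1) T2"
          by (auto simp: translate_def image_iff algebra_simps intro: bexI)
      qed
    qed
    then show ?thesis by (auto simp: disjnt_def)
  qed
  have fS: "finite S" using finite_mesh by (simp add: S_def)
  have "measure lebesgue (\<Union>T\<in>S. B T) = (\<Sum>T\<in>S. measure lebesgue (B T))"
    by (rule measure_UNION'[OF fS]) (use disj in \<open>auto simp: B_def pairwise_def\<close>)
  also have "\<dots> = real (card S) * (unit_ball_vol (real CARD('d)) * r ^ CARD('d))"
    using r by (simp add: B_def content_ball)
  finally have "real (card S) * (unit_ball_vol (real CARD('d)) * r ^ CARD('d)) = measure lebesgue (\<Union>T\<in>S. B T)" by simp
  also have "\<dots> \<le> measure lebesgue (cball x ((real m + 1) * D))"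
  proof (rule measure_mono_fmeasurable)
    show "(\<Union>T\<in>S. B T) \<in> sets lebesgue" using fS by (auto simp: B_def)
  qed (use Bball in auto)
  also have "\<dots> = unit_ball_vol (real CARD('d)) * ((real m + 1) * D) ^ CARD('d)"
    using Dpos by (simp add: content_cball)
  finally have "real (card S) * r ^ CARD('d) \<le> ((real m + 1) * D) ^ CARD('d)"
    using unit_ball_vol_pos[of "real CARD('d)"] by (simp add: mult.left_commute)
  then have "real (card S) * \<gamma> ^ CARD('d) \<le> (real m + 1) ^ CARD('d)"
    using Dpos by (simp add: r_def power_mult_distrib)
  then show ?thesis using \<gamma> unfolding S_def[symmetric] power_divide by (simp add: field_simps)
qed

end

section \<open>The coarse space\<close>

lemma coord_poly_add:
  assumes "coord_poly p f" "coord_poly p g" shows "coord_poly p (\<lambda>x. f x + g x)"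
proof -
  obtain c d where "\<And>x. f x = (\<Sum>\<alpha>\<in>{\<alpha>. \<forall>j. \<alpha> j \<le> p}. c \<alpha> * (\<Prod>j\<in>UNIV. x $ j ^ \<alpha> j))"
    "\<And>x. g x = (\<Sum>\<alpha>\<in>{\<alpha>. \<forall>j. \<alpha> j \<le> p}. d \<alpha> * (\<Prod>j\<in>UNIV. x $ j ^ \<alpha> j))"
    using assms by (auto simp: coord_poly_def)
  then show ?thesis unfolding coord_poly_def
    by (intro exI[of _ "\<lambda>\<alpha>. c \<alpha> + d \<alpha>"]) (simp add: sum.distrib algebra_simps)
qed

lemma coord_poly_scale:
  assumes "coord_poly p f" shows "coord_poly p (\<lambda>x. s * f x)"
proof -
  obtain c where "\<And>x. f x = (\<Sum>\<alpha>\<in>{\<alpha>. \<forall>j. \<alpha> j \<le> p}. c \<alpha> * (\<Prod>j\<in>UNIV. x $ j ^ \<alpha> j))"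
    using assms by (auto simp: coord_poly_def)
  then show ?thesis unfolding coord_poly_def
    by (intro exI[of _ "\<lambda>\<alpha>. s * c \<alpha>"]) (simp add: sum_distrib_left algebra_simps)
qed

lemma piecewise_Q_add:
  assumes "u \<in> piecewise_Q p \<T>" "v \<in> piecewise_Q p \<T>" shows "(\<lambda>x. u x + v x) \<in> piecewise_Q p \<T>"
  unfolding piecewise_Q_def
proof (intro CollectI ballI)
  fix T assume "T \<in> \<T>"
  obtain f where f: "coord_poly p f" "AE x in lebesgue. x \<in> T \<longrightarrow> u x = f x"
    using assms(1) \<open>T \<in> \<T>\<close> by (auto simp: piecewise_Q_def)
  obtain g where g: "coord_poly p g" "AE x in lebesgue. x \<in> T \<longrightarrow> v x = g x"
    using assms(2) \<open>T \<in> \<T>\<close> by (auto simp: piecewise_Q_def)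
  from coord_poly_add[OF f(1) g(1)] eventually_conj[OF f(2) g(2)]
  show "\<exists>f. coord_poly p f \<and> (AE x in lebesgue. x \<in> T \<longrightarrow> u x + v x = f x)"
    by (intro exI[of _ "\<lambda>x. f x + g x"] conjI) (auto elim: eventually_mono)
qed

lemma piecewise_Q_scale:
  assumes "v \<in> piecewise_Q p \<T>" shows "(\<lambda>x. s * v x) \<in> piecewise_Q p \<T>"
  unfolding piecewise_Q_def
proof (intro CollectI ballI)
  fix T assume "T \<in> \<T>"
  then obtain f where "coord_poly p f" "AE x in lebesgue. x \<in> T \<longrightarrow> v x = f x"
    using assms by (auto simp: piecewise_Q_def)
  from coord_poly_scale[OF this(1), of s] this(2)
  show "\<exists>f. coord_poly p f \<and> (AE x in lebesgue. x \<in> T \<longrightarrow> s * v x = f x)"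
    by (intro exI[of _ "\<lambda>x. s * f x"] conjI) (auto elim: eventually_mono)
qed

lemma piecewise_Q_zero: "(\<lambda>x. 0) \<in> piecewise_Q p \<T>"
proof -
  have "coord_poly p (\<lambda>x. 0)" unfolding coord_poly_def by (intro exI[of _ "\<lambda>_. 0"]) simp
  then show ?thesis unfolding piecewise_Q_def by auto
qed

lemma coarse_zero: "(\<lambda>x. 0) \<in> coarse_space \<T>"
  and coarse_add: "u \<in> coarse_space \<T> \<Longrightarrow> v \<in> coarse_space \<T> \<Longrightarrow> (\<lambda>x. u x + v x) \<in> coarse_space \<T>"
  and coarse_scale: "v \<in> coarse_space \<T> \<Longrightarrow> (\<lambda>x. s * v x) \<in> coarse_space \<T>"
  by (simp_all add: coarse_space_def H1_zero H1_add(1) H1_scale(1) piecewise_Q_zero piecewise_Q_add piecewise_Q_scale)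

section \<open>The error on one element\<close>

locale lod_element = lod +
  fixes m :: nat and T :: "(real ^ 'd) set" and A :: "real ^ 'd \<Rightarrow> real"
    and N :: nat and \<mu> :: "nat \<Rightarrow> real" and Ac :: "nat \<Rightarrow> real ^ 'd \<Rightarrow> real"
  assumes elem: "T \<in> \<T>" and A: "admissible_coeff A" and Ac: "\<And>i. admissible_coeff (Ac i)"
begin

abbreviation "U \<equiv> patch \<T> m T"
abbreviation "C a v \<equiv> corrector \<T> V I m T a v"

lemmas U_sets = patch_sets[OF elem, of m] and U_sub = patch_sub[OF elem, of m] and T_sets = elem_sets[OF elem]
  and T_sub = elem_sub[OF elem] and T_sub_U = elem_sub_patch[OF elem, of m]

lemma psd_U: "admissible_coeff a \<Longrightarrow> psd_form H1_per0 (energy_form a U)"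
  and psd_T: "admissible_coeff a \<Longrightarrow> psd_form H1_per0 (energy_form a T)"
  by (auto intro!: energy_form_psd U_sets U_sub T_sets T_sub admissible_imp_bounded admissible_nonneg)

lemma corrector_spec:
  assumes a: "admissible_coeff a" and v: "v \<in> H1_per0"
  shows "C a v \<in> fine_space_on V I U"
    and "w \<in> fine_space_on V I U \<Longrightarrow> energy_form a U (C a v) w = energy_form a T v w"
proof -
  have "\<exists>\<phi>. \<phi> \<in> fine_space_on V I U \<and> (\<forall>w\<in>fine_space_on V I U. energy_form a U \<phi> w = energy_form a T v w)"
    using corrector_exists[OF patch_closed[OF elem] U_sub T_sets T_sub_U a v] by (simp add: Bex_def)
  from someI_ex[OF this]
  have *: "C a v \<in> fine_space_on V I U \<and> (\<forall>w\<in>fine_space_on V I U. energy_form a U (C a v) w = energy_form a T v w)"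
    unfolding corrector_def energy_form_def .
  then show "C a v \<in> fine_space_on V I U" by simp
  show "w \<in> fine_space_on V I U \<Longrightarrow> energy_form a U (C a v) w = energy_form a T v w" using * by simp
qed

lemma corrector_H1: "admissible_coeff a \<Longrightarrow> v \<in> H1_per0 \<Longrightarrow> C a v \<in> H1_per0"
  using corrector_spec(1) by (rule fine_H1)

lemma corrector_null:
  assumes a: "admissible_coeff a" and v: "v \<in> H1_per0" and z: "AE x in lebesgue. x \<in> T \<longrightarrow> weak_grad v x = 0"
  shows "AE x in lebesgue. x \<in> U \<longrightarrow> weak_grad (C a v) x = 0"
proof (rule energy_form_null[OF U_sets U_sub admissible_imp_bounded[OF a] admissible_pos[OF a] corrector_H1[OF a v]])
  show "energy_form a U (C a v) (C a v) = 0"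
    using corrector_spec(2)[OF a v corrector_spec(1)[OF a v]] energy_form_zero_of_grad_zero[OF z] by simp
qed

text \<open>Only the gradient of the corrector on the patch is unique, so this is the linearity of the corrector
  that can be expected.\<close>

lemma corrector_axpy:
  assumes a: "admissible_coeff a" and u: "u \<in> H1_per0" and v: "v \<in> H1_per0"
  shows "AE x in lebesgue. x \<in> U \<longrightarrow>
    weak_grad (C a (\<lambda>x. u x + s * v x)) x = weak_grad (C a u) x + s *\<^sub>R weak_grad (C a v) x"
proof -
  interpret BT: psd_form H1_per0 "energy_form a T" by (rule psd_T[OF a])
  interpret BU: psd_form H1_per0 "energy_form a U" by (rule psd_U[OF a])
  let ?uv = "\<lambda>x. u x + s * v x"
  have uv: "?uv \<in> H1_per0" by (rule H1_axpy(1)[OF u v])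
  note Cuv = corrector_spec[OF a uv] and Cu = corrector_spec[OF a u] and Cv = corrector_spec[OF a v]
  let ?g = "\<lambda>x. C a u x + s * C a v x"
  let ?d = "\<lambda>x. C a ?uv x - ?g x"
  have gF: "?g \<in> fine_space_on V I U" by (rule fine_add[OF Cu(1) fine_scale[OF Cv(1)]])
  have dF: "?d \<in> fine_space_on V I U" by (rule fine_diff[OF Cuv(1) gF])
  note gH = fine_H1[OF gF] and dH = fine_H1[OF dF]
  have "energy_form a U ?d ?d = energy_form a U (C a ?uv) ?d - energy_form a U ?g ?d"
    using BU.diff_left[OF fine_H1[OF Cuv(1)] gH dH, of 1] by (simp only: mult_1)
  also have "energy_form a U (C a ?uv) ?d = energy_form a T u ?d + s * energy_form a T v ?d"
    using Cuv(2)[OF dF] BT.add_left[OF u BT.scale_mem[OF v, of s] dH] BT.scale_left[OF v dH, of s] by simp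
  also have "energy_form a U ?g ?d = energy_form a T u ?d + s * energy_form a T v ?d"
    using Cu(2)[OF dF] Cv(2)[OF dF] BU.add_left[OF fine_H1[OF Cu(1)] BU.scale_mem[OF fine_H1[OF Cv(1)], of s] dH]
      BU.scale_left[OF fine_H1[OF Cv(1)] dH, of s] by simp
  finally have "energy_form a U ?d ?d = 0" by simp
  from energy_form_null[OF U_sets U_sub admissible_imp_bounded[OF a] admissible_pos[OF a] dH this]
  have 1: "AE x in lebesgue. x \<in> U \<longrightarrow> weak_grad ?d x = 0" .
  have 2: "AE x in lebesgue. weak_grad ?d x = weak_grad (C a ?uv) x - weak_grad ?g x"
    by (rule H1_diff(2)[OF fine_H1[OF Cuv(1)] gH])
  have 3: "AE x in lebesgue. weak_grad ?g x = weak_grad (C a u) x + s *\<^sub>R weak_grad (C a v) x"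
    by (rule H1_axpy(2)[OF fine_H1[OF Cu(1)] fine_H1[OF Cv(1)]])
  show ?thesis using 1 2 3 by eventually_elim auto
qed

lemma energy_form_T_on_U:
  assumes "bounded_coeff a" "v \<in> H1_per0" "w \<in> H1_per0"
  shows "set_integrable lebesgue U (\<lambda>x. indicator T x * (a x * (weak_grad v x \<bullet> weak_grad w x)))"
    and "(LINT x:U|lebesgue. indicator T x * (a x * (weak_grad v x \<bullet> weak_grad w x))) = energy_form a T v w"
proof -
  have eq: "indicator U x *\<^sub>R (indicator T x * (a x * (weak_grad v x \<bullet> weak_grad w x)))
      = indicator T x *\<^sub>R (a x * (weak_grad v x \<bullet> weak_grad w x))" for x
    using T_sub_U by (auto simp: indicator_def)
  show "set_integrable lebesgue U (\<lambda>x. indicator T x * (a x * (weak_grad v x \<bullet> weak_grad w x)))"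
    using energy_form_integrable[OF T_sets T_sub assms] by (simp only: set_integrable_def eq)
  show "(LINT x:U|lebesgue. indicator T x * (a x * (weak_grad v x \<bullet> weak_grad w x))) = energy_form a T v w"
    by (simp only: energy_form_def set_lebesgue_integral_def eq)
qed

lemma elem_form_eq:
  assumes a: "admissible_coeff a" and v: "v \<in> H1_per0" and w: "w \<in> H1_per0"
  shows "elem_form \<T> V I m T a v w = energy_form a T v w - energy_form a U (C a v) w"
proof -
  note ab = admissible_imp_bounded[OF a]
  note i1 = energy_form_T_on_U(1)[OF ab v w]
  note i2 = energy_form_integrable[OF U_sets U_sub ab corrector_H1[OF a v] w]
  have "elem_form \<T> V I m T a v w = (LINT x:U|lebesgue.
      indicator T x * (a x * (weak_grad v x \<bullet> weak_grad w x)) - a x * (weak_grad (C a v) x \<bullet> weak_grad w x))"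
    unfolding elem_form_def by (simp add: inner_diff_left algebra_simps)
  also have "\<dots> = (LINT x:U|lebesgue. indicator T x * (a x * (weak_grad v x \<bullet> weak_grad w x))) - energy_form a U (C a v) w"
    unfolding energy_form_def by (rule set_integral_diff(2)[OF i1 i2])
  finally show ?thesis by (simp only: energy_form_T_on_U(2)[OF ab v w])
qed

text \<open>This is the corrector equation, read as an orthogonality.\<close>

lemma elem_form_fine_zero:
  "admissible_coeff a \<Longrightarrow> v \<in> H1_per0 \<Longrightarrow> w \<in> fine_space_on V I U \<Longrightarrow> elem_form \<T> V I m T a v w = 0"
  by (simp add: elem_form_eq fine_H1 corrector_spec(2))

text \<open>The field in the numerator of the error indicator.\<close>

definition residual :: "(real ^ 'd \<Rightarrow> real) \<Rightarrow> real ^ 'd \<Rightarrow> real ^ 'd" where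
  "residual v x = ((sqrt (A x) - (\<Sum>i=0..N. \<mu> i * Ac i x) / sqrt (A x)) * indicator T x) *\<^sub>R weak_grad v x
        - (\<Sum>i=0..N. (\<mu> i * (sqrt (A x) - Ac i x / sqrt (A x))) *\<^sub>R weak_grad (C (Ac i) v) x)"

lemma coeff_v: "bounded_coeff (\<lambda>x. (sqrt (A x) - (\<Sum>i=0..N. \<mu> i * Ac i x) / sqrt (A x)) * indicator T x)"
proof -
  have "bounded_coeff (\<lambda>x. (sqrt (A x) + (-1) * ((\<Sum>i=0..N. \<mu> i * Ac i x) * inverse (sqrt (A x)))) * indicator T x)"
    by (intro bounded_coeff_mult[OF _ bounded_coeff_indicator[OF T_sets]] bounded_coeff_add[OF bounded_coeff_sqrt[OF A]]
        bounded_coeff_mult[OF bounded_coeff_const] bounded_coeff_mult[OF _ bounded_coeff_inverse_sqrt[OF A]]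
        bounded_coeff_sum) (auto intro: bounded_coeff_mult[OF bounded_coeff_const] admissible_imp_bounded Ac)
  then show ?thesis by (simp add: divide_inverse)
qed

lemma coeff_i: "bounded_coeff (\<lambda>x. \<mu> i * (sqrt (A x) - Ac i x / sqrt (A x)))"
proof -
  have "bounded_coeff (\<lambda>x. \<mu> i * (sqrt (A x) + (-1) * (Ac i x * inverse (sqrt (A x)))))"
    by (intro bounded_coeff_mult[OF bounded_coeff_const] bounded_coeff_add[OF bounded_coeff_sqrt[OF A]]
        bounded_coeff_mult[OF _ bounded_coeff_inverse_sqrt[OF A]] admissible_imp_bounded Ac)
  then show ?thesis by (simp add: divide_inverse)
qed

text \<open>The coefficients are measurable on the cell only, hence the cut-off.\<close>

definition cell_residual :: "(real ^ 'd \<Rightarrow> real) \<Rightarrow> real ^ 'd \<Rightarrow> real ^ 'd" where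
  "cell_residual v x = indicator unit_cell x *\<^sub>R residual v x"

lemma cell_residual_eq: "x \<in> U \<Longrightarrow> cell_residual v x = residual v x"
  using U_sub by (auto simp: cell_residual_def)

lemma cell_residual_square_integrable:
  assumes v: "v \<in> H1_per0" shows "square_integrable_on (cell_residual v) unit_cell"
proof -
  have s1: "square_integrable_on (\<lambda>x. \<Sum>i=0..N. (indicator unit_cell x * (\<mu> i * (sqrt (A x) - Ac i x / sqrt (A x)))) *\<^sub>R weak_grad (C (Ac i) v) x) unit_cell"
    by (intro square_integrable_sum square_integrable_weighted coeff_i H1_per0D(4) corrector_H1 Ac v) auto
  have s0: "square_integrable_on (\<lambda>x. (indicator unit_cell x * ((sqrt (A x) - (\<Sum>i=0..N. \<mu> i * Ac i x) / sqrt (A x)) * indicator T x)) *\<^sub>R weak_grad v x) unit_cell"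
    by (intro square_integrable_weighted coeff_v H1_per0D(4) v)
  have "cell_residual v = (\<lambda>x. (indicator unit_cell x * ((sqrt (A x) - (\<Sum>i=0..N. \<mu> i * Ac i x) / sqrt (A x)) * indicator T x)) *\<^sub>R weak_grad v x
      + (-1) *\<^sub>R (\<Sum>i=0..N. (indicator unit_cell x * (\<mu> i * (sqrt (A x) - Ac i x / sqrt (A x)))) *\<^sub>R weak_grad (C (Ac i) v) x))"
    by (rule ext) (simp add: cell_residual_def residual_def scaleR_diff_right scaleR_sum_right sum_negf)
  then show ?thesis using square_integrable_axpy[OF unit_cell_sets s0 s1, of "-1"] by simp
qed

lemma residual_axpy:
  assumes u: "u \<in> H1_per0" and v: "v \<in> H1_per0"
  shows "AE x in lebesgue. x \<in> U \<longrightarrow> residual (\<lambda>x. u x + s * v x) x = residual u x + s *\<^sub>R residual v x"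
proof -
  have "AE x in lebesgue. \<forall>i. x \<in> U \<longrightarrow>
    weak_grad (C (Ac i) (\<lambda>x. u x + s * v x)) x = weak_grad (C (Ac i) u) x + s *\<^sub>R weak_grad (C (Ac i) v) x"
    unfolding AE_all_countable using corrector_axpy[OF Ac u v] by blast
  then show ?thesis using H1_axpy(2)[OF u v, of s]
  proof eventually_elim
    case (elim x)
    have linear: "\<beta> *\<^sub>R (g + s *\<^sub>R h) - (\<Sum>i=0..N. b i *\<^sub>R (c i + s *\<^sub>R d i))
        = (\<beta> *\<^sub>R g - (\<Sum>i=0..N. b i *\<^sub>R c i)) + s *\<^sub>R (\<beta> *\<^sub>R h - (\<Sum>i=0..N. b i *\<^sub>R d i))"
      for \<beta> b and g h :: "real ^ 'd" and c d
      by (simp add: scaleR_add_right sum.distrib scaleR_sum_right scaleR_diff_right mult.commute)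
    show ?case
    proof
      assume x: "x \<in> U"
      have eq: "weak_grad (C (Ac i) (\<lambda>x. u x + s * v x)) x = weak_grad (C (Ac i) u) x + s *\<^sub>R weak_grad (C (Ac i) v) x" for i
        using elim(1) x by blast
      show "residual (\<lambda>x. u x + s * v x) x = residual u x + s *\<^sub>R residual v x"
        unfolding residual_def elim(2) eq by (rule linear)
    qed
  qed
qed

text \<open>A coarse function of zero energy on \<open>T\<close> has gradient zero there, and then so do all its correctors; thus
  the numerator of the quotient vanishes wherever the denominator does.\<close>

lemma residual_null:
  assumes v: "v \<in> H1_per0" and z: "energy_form A T v v = 0"
  shows "AE x in lebesgue. x \<in> U \<longrightarrow> residual v x = 0"
proof -
  have g: "AE x in lebesgue. x \<in> T \<longrightarrow> weak_grad v x = 0"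
    by (rule energy_form_null[OF T_sets T_sub admissible_imp_bounded[OF A] admissible_pos[OF A] v z])
  have "AE x in lebesgue. \<forall>i. x \<in> U \<longrightarrow> weak_grad (C (Ac i) v) x = 0"
    unfolding AE_all_countable using corrector_null[OF Ac v g] by blast
  then show ?thesis using g by eventually_elim (auto simp: residual_def indicator_def)
qed

definition residual_form :: "(real ^ 'd \<Rightarrow> real) \<Rightarrow> (real ^ 'd \<Rightarrow> real) \<Rightarrow> real" where
  "residual_form u v = (LINT x:U|lebesgue. 1 * (cell_residual u x \<bullet> cell_residual v x))"

lemma residual_form_integrable:
  "u \<in> H1_per0 \<Longrightarrow> v \<in> H1_per0 \<Longrightarrow> set_integrable lebesgue U (\<lambda>x. 1 * (cell_residual u x \<bullet> cell_residual v x))"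
  by (intro weighted_inner_integrable[OF U_sets U_sub bounded_coeff_const] cell_residual_square_integrable)

lemma residual_form_axpy:
  assumes u: "u \<in> H1_per0" and v: "v \<in> H1_per0" and w: "w \<in> H1_per0"
  shows "residual_form (\<lambda>x. u x + s * v x) w = residual_form u w + s * residual_form v w"
proof -
  note i = residual_form_integrable
  note uv = H1_axpy(1)[OF u v, of s]
  have "residual_form (\<lambda>x. u x + s * v x) w
      = (LINT x:U|lebesgue. 1 * (cell_residual u x \<bullet> cell_residual w x) + s * (1 * (cell_residual v x \<bullet> cell_residual w x)))"
    unfolding residual_form_def
  proof (rule set_integral_cong_AE_integrable[OF i[OF uv w] set_integral_add(1)[OF i[OF u w] set_integrable_mult_right[OF i[OF v w]]]])
    show "AE x in lebesgue. x \<in> U \<longrightarrow> 1 * (cell_residual (\<lambda>x. u x + s * v x) x \<bullet> cell_residual w x)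
        = 1 * (cell_residual u x \<bullet> cell_residual w x) + s * (1 * (cell_residual v x \<bullet> cell_residual w x))"
      using residual_axpy[OF u v, of s] by eventually_elim (simp add: cell_residual_eq inner_add_left)
  qed
  also have "\<dots> = residual_form u w + s * residual_form v w"
    unfolding residual_form_def by (subst set_integral_add(2)[OF i[OF u w] set_integrable_mult_right[OF i[OF v w]]]) (simp only: set_integral_mult_right)
  finally show ?thesis .
qed

lemma residual_form_null:
  assumes v: "v \<in> H1_per0" and z: "energy_form A T v v = 0"
  shows "residual_form v w = 0"
proof -
  have "AE x in lebesgue. indicator U x *\<^sub>R (1 * (cell_residual v x \<bullet> cell_residual w x)) = 0"
    using residual_null[OF v z] by eventually_elim (auto simp: indicator_def cell_residual_eq)
  then show ?thesis unfolding residual_form_def set_lebesgue_integral_def by (rule integral_eq_zero_AE)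
qed

lemma residual_form_psd: "psd_form (coarse_space \<T>) residual_form"
proof unfold_locales
  show "residual_form u v = residual_form v u" for u v
    unfolding residual_form_def by (simp only: inner_commute)
  show "residual_form (\<lambda>x. u x + v x) w = residual_form u w + residual_form v w"
    if "u \<in> coarse_space \<T>" "v \<in> coarse_space \<T>" "w \<in> coarse_space \<T>" for u v w
    using residual_form_axpy[OF that[THEN coarse_H1], of 1] by simp
  show "residual_form (\<lambda>x. s * v x) w = s * residual_form v w"
    if "v \<in> coarse_space \<T>" "w \<in> coarse_space \<T>" for s v w
  proof -
    have "energy_form A T (\<lambda>x. 0) (\<lambda>x. 0) = 0"
      by (rule psd_form.zero_left[OF psd_T[OF A] H1_zero])
    then have "residual_form (\<lambda>x. 0) w = 0" by (rule residual_form_null[OF H1_zero])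
    then show ?thesis using residual_form_axpy[OF H1_zero that[THEN coarse_H1], of s] by simp
  qed
  show "0 \<le> residual_form v v" for v
    unfolding residual_form_def set_lebesgue_integral_def by (simp add: integral_nonneg_AE)
qed (simp_all add: coarse_zero coarse_add coarse_scale)

lemma indicator_quotient_eq:
  assumes v: "v \<in> H1_per0"
  shows "indicator_quotient \<T> V I m A N \<mu> Ac T v = residual_form v v / energy_form A T v v"
    and "energy_norm A T v = sqrt (energy_form A T v v)"
proof -
  show e: "energy_norm A T v = sqrt (energy_form A T v v)"
    by (simp add: energy_norm_def energy_form_def power2_norm_eq_inner)
  have "L2_norm U (residual v) = sqrt (residual_form v v)"
    unfolding L2_norm_def residual_form_def set_lebesgue_integral_def
    by (intro arg_cong[of _ _ sqrt] Bochner_Integration.integral_cong refl)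
       (auto simp: indicator_def cell_residual_eq power2_norm_eq_inner)
  moreover have "0 \<le> residual_form v v"
    unfolding residual_form_def set_lebesgue_integral_def by (simp add: integral_nonneg_AE)
  moreover have "0 \<le> energy_form A T v v" by (rule psd_form.nonneg[OF psd_T[OF A] v])
  ultimately show "indicator_quotient \<T> V I m A N \<mu> Ac T v = residual_form v v / energy_form A T v v"
    unfolding indicator_quotient_def e residual_def[symmetric] by simp
qed

text \<open>The greatest quotient exists because a Rayleigh quotient on a finite-dimensional space attains its
  maximum. The bound is multiplied out so that it also covers functions of zero energy on \<open>T\<close>.\<close>

lemma error_indicator_bound:
  shows "error_indicator \<T> V I m A N \<mu> Ac T \<ge> 0"
    and "v \<in> coarse_space \<T> \<Longrightarrow>
      residual_form v v \<le> (error_indicator \<T> V I m A N \<mu> Ac T)\<^sup>2 * energy_form A T v v"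
proof -
  interpret P: psd_form H1_per0 "energy_form A T" by (rule psd_T[OF A])
  interpret Q: psd_form "coarse_space \<T>" residual_form by (rule residual_form_psd)
  let ?E = "error_indicator \<T> V I m A N \<mu> Ac T"
  let ?q = "indicator_quotient \<T> V I m A N \<mu> Ac T"
  let ?S = "{v \<in> coarse_space \<T>. energy_norm A T v \<noteq> 0}"
  have S: "?S = {v \<in> coarse_space \<T>. energy_form A T v v \<noteq> 0}"
    using indicator_quotient_eq(2)[OF coarse_H1] by auto
  have null: "residual_form v v = 0" if "v \<in> coarse_space \<T>" "energy_form A T v v = 0" for v
    by (rule residual_form_null[OF coarse_H1[OF that(1)] that(2)])
  have "0 \<le> ?E \<and> (\<forall>v\<in>coarse_space \<T>. residual_form v v \<le> ?E\<^sup>2 * energy_form A T v v)"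
  proof (cases "?S = {}")
    case True
    then have "?E = 0" by (simp add: error_indicator_def)
    moreover have "residual_form v v = 0" if "v \<in> coarse_space \<T>" for v
      using True null[OF that] that unfolding S by blast
    ultimately show ?thesis by simp
  next
    case False
    then obtain v\<^sub>0 where v0: "v\<^sub>0 \<in> coarse_space \<T>" "energy_form A T v\<^sub>0 v\<^sub>0 \<noteq> 0" unfolding S by blast
    obtain b where b: "piecewise_Q 1 \<T> \<subseteq> ae_span (lebesgue_on unit_cell) b (\<T> \<times> {\<alpha> :: 'd \<Rightarrow> nat. \<forall>j. \<alpha> j \<le> 1})"
      using piecewise_Q_finite_span[OF finite_mesh mesh_cover] by blast
    have Pc: "psd_form (coarse_space \<T>) (energy_form A T)"
    proof (rule P.subspace)
      show "coarse_space \<T> \<subseteq> H1_per0" using coarse_H1 by blast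
    qed (simp_all add: coarse_zero coarse_add coarse_scale)
    have sub: "coarse_space \<T> \<subseteq> ae_span (lebesgue_on unit_cell) b (\<T> \<times> {\<alpha> :: 'd \<Rightarrow> nat. \<forall>j. \<alpha> j \<le> 1})"
      using b by (auto simp: coarse_space_def)
    have nullP: "energy_form A T w w = 0" if "w \<in> coarse_space \<T>" "AE x in lebesgue_on unit_cell. w x = 0" for w
      using H1_AE_zero_grad[OF coarse_H1[OF that(1)] that(2)]
      by (intro energy_form_zero_of_grad_zero) (auto elim: eventually_mono)
    have "\<exists>v\<in>coarse_space \<T>. energy_form A T v v \<noteq> 0 \<and> (\<forall>w\<in>coarse_space \<T>. energy_form A T w w \<noteq> 0 \<longrightarrow>
        residual_form w w / energy_form A T w w \<le> residual_form v v / energy_form A T v v)"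
    proof (rule Rayleigh_quotient_attains_max[where P = "energy_form A T" and Q = residual_form and F = "\<T> \<times> {\<alpha> :: 'd \<Rightarrow> nat. \<forall>j. \<alpha> j \<le> 1}" and p = b
          and M = "lebesgue_on unit_cell" and v\<^sub>0 = v\<^sub>0])
      show "finite (\<T> \<times> {\<alpha> :: 'd \<Rightarrow> nat. \<forall>j. \<alpha> j \<le> 1})"
        by (rule finite_cartesian_product[OF finite_mesh finite_multi_indices])
    qed (fact Pc residual_form_psd sub v0 | rule nullP null; assumption)+
    then obtain v where v: "v \<in> coarse_space \<T>" "energy_form A T v v \<noteq> 0"
      and max: "\<And>w. w \<in> coarse_space \<T> \<Longrightarrow> energy_form A T w w \<noteq> 0 \<Longrightarrow> residual_form w w / energy_form A T w w \<le> residual_form v v / energy_form A T v v"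
      by blast
    have qv: "?q w = residual_form w w / energy_form A T w w" if "w \<in> coarse_space \<T>" for w
      by (rule indicator_quotient_eq(1)[OF coarse_H1[OF that]])
    have "(GREATEST q. q \<in> ?q ` ?S) = ?q v"
    proof (rule Greatest_equality)
      show "?q v \<in> ?q ` ?S" using v unfolding S by blast
      show "y \<le> ?q v" if "y \<in> ?q ` ?S" for y
        using that max unfolding S by (auto simp: qv v(1))
    qed
    moreover have "?q ` ?S \<noteq> {}" using False by (simp only: image_is_empty not_False_eq_True)
    ultimately have E: "?E = sqrt (?q v)" unfolding error_indicator_def Let_def by (simp only: if_False)
    have q0: "0 \<le> ?q v" unfolding qv[OF v(1)] using Q.nonneg[OF v(1)] P.nonneg[OF coarse_H1[OF v(1)]] by simp
    have "residual_form w w \<le> ?E\<^sup>2 * energy_form A T w w" if w: "w \<in> coarse_space \<T>" for w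
    proof (cases "energy_form A T w w = 0")
      case True
      then show ?thesis using null[OF w] by simp
    next
      case False
      then have p: "energy_form A T w w > 0" using P.nonneg[OF coarse_H1[OF w]] by simp
      have "residual_form w w / energy_form A T w w \<le> ?E\<^sup>2"
        using max[OF w False] q0 E qv[OF v(1)] by simp
      then show ?thesis using p by (simp add: field_simps)
    qed
    then show ?thesis using E q0 by simp
  qed
  then show "?E \<ge> 0" "v \<in> coarse_space \<T> \<Longrightarrow> residual_form v v \<le> ?E\<^sup>2 * energy_form A T v v" by auto
qed

definition residual_load :: "(real ^ 'd \<Rightarrow> real) \<Rightarrow> (real ^ 'd \<Rightarrow> real) \<Rightarrow> real" where
  "residual_load v w = (LINT x:U|lebesgue. sqrt (A x) * (cell_residual v x \<bullet> weak_grad w x))"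

lemma residual_load_integrable:
  "v \<in> H1_per0 \<Longrightarrow> w \<in> H1_per0 \<Longrightarrow> set_integrable lebesgue U (\<lambda>x. sqrt (A x) * (cell_residual v x \<bullet> weak_grad w x))"
  by (intro weighted_inner_integrable[OF U_sets U_sub bounded_coeff_sqrt[OF A]] cell_residual_square_integrable H1_per0D(4))

lemma residual_load_bound:
  assumes v: "v \<in> H1_per0" and w: "w \<in> H1_per0"
  shows "\<bar>residual_load v w\<bar> \<le> sqrt (residual_form v v) * sqrt (energy_form A U w w)"
proof -
  note i1 = residual_form_integrable[OF v v] and i2 = residual_load_integrable[OF v w]
    and i3 = energy_form_integrable[OF U_sets U_sub admissible_imp_bounded[OF A] w w]
  have "(residual_load v w)\<^sup>2 \<le> residual_form v v * energy_form A U w w"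
  proof (rule discriminant_le)
    show "0 \<le> energy_form A U w w" by (rule psd_form.nonneg[OF psd_U[OF A] w])
    fix t :: real
    \<comment> \<open>the integral of the squared norm of \<open>cell_residual v x - t * sqrt (A x) * weak_grad w x\<close>\<close>
    have "0 \<le> (LINT x:U|lebesgue. 1 * (cell_residual v x \<bullet> cell_residual v x)
        + ((- 2 * t) * (sqrt (A x) * (cell_residual v x \<bullet> weak_grad w x)) + t\<^sup>2 * (A x * (weak_grad w x \<bullet> weak_grad w x))))"
      unfolding set_lebesgue_integral_def
    proof (rule integral_nonneg_AE)
      show "AE x in lebesgue. 0 \<le> indicator U x *\<^sub>R (1 * (cell_residual v x \<bullet> cell_residual v x)
        + ((- 2 * t) * (sqrt (A x) * (cell_residual v x \<bullet> weak_grad w x)) + t\<^sup>2 * (A x * (weak_grad w x \<bullet> weak_grad w x))))"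
        using admissible_nonneg[OF A]
      proof eventually_elim
        case (elim x)
        show ?case
        proof (cases "x \<in> U")
          case True
          define f where "f = cell_residual v x"
          define g where "g = weak_grad w x"
          define a where "a = sqrt (A x)"
          have a: "A x = a * a" using elim True U_sub by (auto simp: a_def)
          have "0 \<le> (f - (t * a) *\<^sub>R g) \<bullet> (f - (t * a) *\<^sub>R g)" by simp
          also have "\<dots> = 1 * (f \<bullet> f) + ((- 2 * t) * (a * (f \<bullet> g)) + t\<^sup>2 * (A x * (g \<bullet> g)))"
            unfolding a by (simp add: inner_diff_left inner_diff_right inner_commute[of g f] power2_eq_square algebra_simps)
          finally show ?thesis using True by (simp add: f_def g_def a_def)
        qed simp
      qed
    qed
    also have "\<dots> = residual_form v v + ((- 2 * t) * residual_load v w + t\<^sup>2 * energy_form A U w w)"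
      unfolding residual_form_def residual_load_def energy_form_def
      by (subst set_integral_add(2)[OF i1 set_integral_add(1)[OF set_integrable_mult_right[OF i2] set_integrable_mult_right[OF i3]]],
          subst set_integral_add(2)[OF set_integrable_mult_right[OF i2] set_integrable_mult_right[OF i3]])
        (simp only: set_integral_mult_right)
    finally show "0 \<le> residual_form v v - 2 * t * residual_load v w + t\<^sup>2 * energy_form A U w w" by simp
  qed
  then have "sqrt ((residual_load v w)\<^sup>2) \<le> sqrt (residual_form v v * energy_form A U w w)" by (rule real_sqrt_le_mono)
  then show ?thesis by (simp add: real_sqrt_mult)
qed

text \<open>Multiplication by \<open>sqrt A\<close> turns the coefficients of the residual into the differences \<open>A - (\<Sum>i. \<mu> i * Ac i)\<close>
  and \<open>A - Ac i\<close>.\<close>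

lemma residual_load_eq:
  assumes v: "v \<in> H1_per0" and w: "w \<in> H1_per0"
  shows "residual_load v w = energy_form A T v w - (\<Sum>i=0..N. \<mu> i * energy_form (Ac i) T v w)
    - (\<Sum>i=0..N. \<mu> i * (energy_form A U (C (Ac i) v) w - energy_form (Ac i) U (C (Ac i) v) w))"
proof -
  note Ab = admissible_imp_bounded[OF A] and Acb = admissible_imp_bounded[OF Ac]
  note j = energy_form_T_on_U[OF Ab v w] and ji = energy_form_T_on_U[OF Acb v w]
  note k = energy_form_integrable[OF U_sets U_sub Ab corrector_H1[OF Ac v] w]
    and ki = energy_form_integrable[OF U_sets U_sub Acb corrector_H1[OF Ac v] w]
  let ?v = "\<lambda>a x. indicator T x * (a x * (weak_grad v x \<bullet> weak_grad w x))"
  let ?c = "\<lambda>a i x. a x * (weak_grad (C (Ac i) v) x \<bullet> weak_grad w x)"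
  let ?s1 = "\<lambda>x. \<Sum>i=0..N. \<mu> i * ?v (Ac i) x"
  let ?s2 = "\<lambda>x. \<Sum>i=0..N. \<mu> i * (?c A i x - ?c (Ac i) i x)"
  have I1: "set_integrable lebesgue U ?s1" and E1: "(LINT x:U|lebesgue. ?s1 x) = (\<Sum>i=0..N. \<mu> i * energy_form (Ac i) T v w)"
  proof -
    have "set_integrable lebesgue U (\<lambda>x. \<mu> i * ?v (Ac i) x)" for i by (rule set_integrable_mult_right[OF ji(1)])
    then have i: "integrable lebesgue (\<lambda>x. indicator U x *\<^sub>R (\<mu> i * ?v (Ac i) x))" for i by (simp only: set_integrable_def)
    show "set_integrable lebesgue U ?s1"
      unfolding set_integrable_def scaleR_sum_right by (rule Bochner_Integration.integrable_sum[OF i])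
    have "(LINT x:U|lebesgue. ?s1 x) = (\<Sum>i=0..N. (LINT x:U|lebesgue. \<mu> i * ?v (Ac i) x))"
      unfolding set_lebesgue_integral_def scaleR_sum_right by (rule Bochner_Integration.integral_sum[OF i])
    then show "(LINT x:U|lebesgue. ?s1 x) = (\<Sum>i=0..N. \<mu> i * energy_form (Ac i) T v w)"
      by (simp only: set_integral_mult_right ji(2))
  qed
  have I2: "set_integrable lebesgue U ?s2"
    and E2: "(LINT x:U|lebesgue. ?s2 x) = (\<Sum>i=0..N. \<mu> i * (energy_form A U (C (Ac i) v) w - energy_form (Ac i) U (C (Ac i) v) w))"
  proof -
    have "set_integrable lebesgue U (\<lambda>x. \<mu> i * (?c A i x - ?c (Ac i) i x))" for i
      by (rule set_integrable_mult_right[OF set_integral_diff(1)[OF k ki]])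
    then have i: "integrable lebesgue (\<lambda>x. indicator U x *\<^sub>R (\<mu> i * (?c A i x - ?c (Ac i) i x)))" for i by (simp only: set_integrable_def)
    show "set_integrable lebesgue U ?s2"
      unfolding set_integrable_def scaleR_sum_right by (rule Bochner_Integration.integrable_sum[OF i])
    have "(LINT x:U|lebesgue. ?s2 x) = (\<Sum>i=0..N. (LINT x:U|lebesgue. \<mu> i * (?c A i x - ?c (Ac i) i x)))"
      unfolding set_lebesgue_integral_def scaleR_sum_right by (rule Bochner_Integration.integral_sum[OF i])
    then show "(LINT x:U|lebesgue. ?s2 x) = (\<Sum>i=0..N. \<mu> i * (energy_form A U (C (Ac i) v) w - energy_form (Ac i) U (C (Ac i) v) w))"
      by (simp only: set_integral_mult_right set_integral_diff(2)[OF k ki] energy_form_def)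
  qed
  have "residual_load v w = (LINT x:U|lebesgue. ?v A x - ?s1 x - ?s2 x)"
    unfolding residual_load_def
  proof (rule set_integral_cong_AE_integrable[OF residual_load_integrable[OF v w]])
    show "set_integrable lebesgue U (\<lambda>x. ?v A x - ?s1 x - ?s2 x)"
      by (rule set_integral_diff(1)[OF set_integral_diff(1)[OF j(1) I1] I2])
    show "AE x in lebesgue. x \<in> U \<longrightarrow> sqrt (A x) * (cell_residual v x \<bullet> weak_grad w x) = ?v A x - ?s1 x - ?s2 x"
      using admissible_pos[OF A]
    proof eventually_elim
      case (elim x)
      show ?case
      proof
        assume x: "x \<in> U"
        define a where "a = sqrt (A x)"
        have a: "a > 0" "A x = a * a" using elim x U_sub by (auto simp: a_def)
        define G where "G = weak_grad v x \<bullet> weak_grad w x"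
        define H where "H = (\<lambda>i. weak_grad (C (Ac i) v) x \<bullet> weak_grad w x)"
        have distribute: "a * (X * t * G - (\<Sum>i=0..N. \<mu> i * Y i * H i)) = (a * X) * (t * G) - (\<Sum>i=0..N. \<mu> i * ((a * Y i) * H i))"
          for X t Y by (simp add: right_diff_distrib sum_distrib_left mult_ac)
        have "a * (cell_residual v x \<bullet> weak_grad w x)
            = a * ((a - (\<Sum>i=0..N. \<mu> i * Ac i x) / a) * indicator T x * G - (\<Sum>i=0..N. \<mu> i * (a - Ac i x / a) * H i))"
          by (simp add: cell_residual_eq[OF x] residual_def inner_diff_left inner_sum_left a_def G_def H_def)
        also have "\<dots> = (a * (a - (\<Sum>i=0..N. \<mu> i * Ac i x) / a)) * (indicator T x * G) - (\<Sum>i=0..N. \<mu> i * ((a * (a - Ac i x / a)) * H i))"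
          by (rule distribute)
        also have "\<dots> = (A x - (\<Sum>i=0..N. \<mu> i * Ac i x)) * (indicator T x * G) - (\<Sum>i=0..N. \<mu> i * ((A x - Ac i x) * H i))"
        proof -
          have "a * (a - y / a) = A x - y" for y using a by (simp add: field_simps)
          then show ?thesis by (simp only:)
        qed
        also have "\<dots> = indicator T x * (A x * G) - (\<Sum>i=0..N. \<mu> i * (indicator T x * (Ac i x * G)))
            - (\<Sum>i=0..N. \<mu> i * (A x * H i - Ac i x * H i))"
          by (simp add: left_diff_distrib right_diff_distrib sum_distrib_right sum_distrib_left mult_ac)
        finally show "sqrt (A x) * (cell_residual v x \<bullet> weak_grad w x) = ?v A x - ?s1 x - ?s2 x"
          unfolding a_def G_def H_def .
      qed
    qed
  qed
  also have "\<dots> = (LINT x:U|lebesgue. ?v A x) - (LINT x:U|lebesgue. ?s1 x) - (LINT x:U|lebesgue. ?s2 x)"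
    by (simp only: set_integral_diff(2)[OF set_integral_diff(1)[OF j(1) I1] I2] set_integral_diff(2)[OF j(1) I1])
  finally show ?thesis by (simp only: j(2) E1 E2)
qed

text \<open>Let \<open>z\<close> be the exact corrector minus the weighted sum \<open>S\<close> of the offline correctors. The error \<open>?D w\<close> equals the energy
  product of \<open>z\<close> and \<open>w\<close> minus the residual load of \<open>w\<close>. Since all element forms vanish on fine-scale
  functions, \<open>?D z = 0\<close>, which bounds the energy of \<open>z\<close> by the residual. Both terms of \<open>?D w\<close> are then at most the
  norm of the residual times the energy norm of \<open>w\<close>.\<close>

lemma element_error:
  assumes v: "v \<in> coarse_space \<T>" and w: "w \<in> H1_per0"
  shows "\<bar>(\<Sum>i=0..N. \<mu> i * elem_form \<T> V I m T (Ac i) v w) - elem_form \<T> V I m T A v w\<bar>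
    \<le> 2 * error_indicator \<T> V I m A N \<mu> Ac T * sqrt (energy_form A T v v) * sqrt (energy_form A U w w)"
proof -
  interpret BU: psd_form H1_per0 "energy_form A U" by (rule psd_U[OF A])
  have vH: "v \<in> H1_per0" using v by (rule coarse_H1)
  let ?c = "\<lambda>i. C (Ac i) v"
  have cH: "?c i \<in> H1_per0" for i by (rule corrector_H1[OF Ac vH])
  define S where "S = (\<lambda>x. \<Sum>i=0..N. \<mu> i * ?c i x)"
  have SF: "S \<in> fine_space_on V I U"
    unfolding S_def by (rule psd_form.comb_mem[OF fine_psd[OF BU.psd_form_axioms]]) (auto intro: corrector_spec(1)[OF Ac vH])
  define z where "z = (\<lambda>x. C A v x - S x)"
  have zF: "z \<in> fine_space_on V I U" unfolding z_def by (rule fine_diff[OF corrector_spec(1)[OF A vH] SF])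
  have zH: "z \<in> H1_per0" using zF by (rule fine_H1)
  let ?D = "\<lambda>w. (\<Sum>i=0..N. \<mu> i * elem_form \<T> V I m T (Ac i) v w) - elem_form \<T> V I m T A v w"
  have D: "?D w = energy_form A U z w - residual_load v w" if w: "w \<in> H1_per0" for w
  proof -
    have "energy_form A U z w = energy_form A U (C A v) w - (\<Sum>i=0..N. \<mu> i * energy_form A U (?c i) w)"
      using BU.diff_left[OF corrector_H1[OF A vH] fine_H1[OF SF] w, of 1] BU.comb_left[of "{0..N}" ?c w \<mu>] cH w
      by (simp add: z_def S_def)
    then show ?thesis
      unfolding elem_form_eq[OF A vH w] elem_form_eq[OF Ac vH w] residual_load_eq[OF vH w]
      by (simp add: right_diff_distrib sum_subtractf)
  qed
  \<comment> \<open>the element forms vanish on fine-scale functions, for the exact and for all offline coefficients\<close>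
  have "?D z = 0" using elem_form_fine_zero[OF A vH zF] elem_form_fine_zero[OF Ac vH zF] by simp
  then have zz: "energy_form A U z z = residual_load v z" using D[OF zH] by simp
  define R where "R = sqrt (residual_form v v)"
  have R0: "0 \<le> R" unfolding R_def using psd_form.nonneg[OF residual_form_psd v] by simp
  have nz: "sqrt (energy_form A U z z) \<le> R"
  proof (cases "sqrt (energy_form A U z z) = 0")
    case False
    then have p: "sqrt (energy_form A U z z) > 0" using BU.nonneg[OF zH] by (simp add: less_le)
    have "sqrt (energy_form A U z z) * sqrt (energy_form A U z z) = energy_form A U z z"
      using BU.nonneg[OF zH] by simp
    also have "\<dots> \<le> R * sqrt (energy_form A U z z)"
      using residual_load_bound[OF vH zH] zz unfolding R_def by linarith
    finally show ?thesis using p by (rule mult_right_le_imp_le)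
  qed (simp add: R0)
  have "\<bar>energy_form A U z w\<bar> \<le> sqrt (energy_form A U z z) * sqrt (energy_form A U w w)"
    using real_sqrt_le_mono[OF BU.Cauchy_Schwarz[OF zH w]] by (simp add: real_sqrt_mult)
  also have "\<dots> \<le> R * sqrt (energy_form A U w w)" using nz BU.nonneg[OF w] by (intro mult_right_mono) auto
  finally have "\<bar>?D w\<bar> \<le> 2 * R * sqrt (energy_form A U w w)"
    using residual_load_bound[OF vH w] unfolding D[OF w] R_def[symmetric] by linarith
  also have "R \<le> error_indicator \<T> V I m A N \<mu> Ac T * sqrt (energy_form A T v v)"
  proof -
    have "R \<le> sqrt ((error_indicator \<T> V I m A N \<mu> Ac T)\<^sup>2 * energy_form A T v v)"
      unfolding R_def by (rule real_sqrt_le_mono[OF error_indicator_bound(2)[OF v]])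
    then show ?thesis using error_indicator_bound(1) by (simp add: real_sqrt_mult)
  qed
  then have "2 * R * sqrt (energy_form A U w w) \<le> 2 * (error_indicator \<T> V I m A N \<mu> Ac T * sqrt (energy_form A T v v)) * sqrt (energy_form A U w w)"
    using BU.nonneg[OF w] by (intro mult_right_mono mult_left_mono) auto
  finally show ?thesis by (simp add: mult.assoc)
qed

end

section \<open>The global estimate\<close>

lemma defect_set_lebesgue:
  assumes "Q \<in> sets lebesgue" "\<epsilon> \<noteq> 0"
  shows "defect_set \<epsilon> Q k \<in> sets lebesgue"
proof -
  have "defect_set \<epsilon> Q k = (\<lambda>x. inverse \<epsilon> *\<^sub>R x + (- k)) -` Q \<inter> space lebesgue"
  proof (intro set_eqI iffI)
    fix x assume "x \<in> (\<lambda>x. inverse \<epsilon> *\<^sub>R x + (- k)) -` Q \<inter> space lebesgue"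
    then have "inverse \<epsilon> *\<^sub>R x + (- k) \<in> Q" by simp
    moreover have "x = \<epsilon> *\<^sub>R (k + (inverse \<epsilon> *\<^sub>R x + (- k)))" using assms(2) by simp
    ultimately show "x \<in> defect_set \<epsilon> Q k" unfolding defect_set_def by blast
  qed (use assms(2) in \<open>auto simp: defect_set_def\<close>)
  then show ?thesis
    using measurable_sets[OF lebesgue_measurable_affine[of "inverse \<epsilon>" "- k"] assms(1)] assms(2) by simp
qed

lemma offline_coeff_admissible:
  assumes data: "periodic_data \<alpha> \<beta> Aper Bper" and Q: "Q \<in> sets lebesgue" and \<epsilon>: "\<epsilon> > 0"
  shows "admissible_coeff (offline_coeff \<epsilon> Aper Bper Q \<sigma> T i)"
proof -
  have ab: "0 < \<alpha>" and m: "Aper \<in> borel_measurable lebesgue" "Bper \<in> borel_measurable lebesgue"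
    and bA: "AE x in lebesgue. \<alpha> \<le> Aper x \<and> Aper x \<le> \<beta>"
    and bB: "AE x in lebesgue. \<alpha> \<le> Aper x + Bper x \<and> Aper x + Bper x \<le> \<beta>"
    using data by (auto simp: periodic_data_def)
  have e: "inverse \<epsilon> \<noteq> 0" using \<epsilon> by simp
  have bA': "AE x in lebesgue. \<alpha> \<le> Aper (x /\<^sub>R \<epsilon>) \<and> Aper (x /\<^sub>R \<epsilon>) \<le> \<beta>"
    using AE_lebesgue_affine[OF e bA, of 0] by simp
  have bB': "AE x in lebesgue. \<alpha> \<le> Aper (x /\<^sub>R \<epsilon>) + Bper (x /\<^sub>R \<epsilon>) \<and> Aper (x /\<^sub>R \<epsilon>) + Bper (x /\<^sub>R \<epsilon>) \<le> \<beta>"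
    using AE_lebesgue_affine[OF e bB, of 0] by simp
  have m': "(\<lambda>x. Aper (x /\<^sub>R \<epsilon>)) \<in> borel_measurable lebesgue" "(\<lambda>x. Bper (x /\<^sub>R \<epsilon>)) \<in> borel_measurable lebesgue"
    using measurable_compose[OF lebesgue_measurable_affine[OF e, of 0] m(1)]
      measurable_compose[OF lebesgue_measurable_affine[OF e, of 0] m(2)] by simp_all
  let ?D = "defect_set \<epsilon> Q (\<sigma> T i)"
  have D: "?D \<in> sets lebesgue" using defect_set_lebesgue[OF Q] \<epsilon> by simp
  have bounds: "AE x in lebesgue. \<alpha> \<le> offline_coeff \<epsilon> Aper Bper Q \<sigma> T i x \<and> offline_coeff \<epsilon> Aper Bper Q \<sigma> T i x \<le> \<beta>"
    using bA' bB' by eventually_elim (auto simp: offline_coeff_def indicator_def)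
  have meas: "offline_coeff \<epsilon> Aper Bper Q \<sigma> T i \<in> borel_measurable lebesgue"
  proof (cases "i = 0")
    case True
    then have "offline_coeff \<epsilon> Aper Bper Q \<sigma> T i = (\<lambda>x. Aper (x /\<^sub>R \<epsilon>))" by (simp add: offline_coeff_def fun_eq_iff)
    then show ?thesis using m'(1) by simp
  next
    case False
    then have "offline_coeff \<epsilon> Aper Bper Q \<sigma> T i = (\<lambda>x. Aper (x /\<^sub>R \<epsilon>) + indicator ?D x * Bper (x /\<^sub>R \<epsilon>))"
      by (simp add: offline_coeff_def fun_eq_iff)
    moreover have "(\<lambda>x. Aper (x /\<^sub>R \<epsilon>) + indicator ?D x * Bper (x /\<^sub>R \<epsilon>)) \<in> borel_measurable lebesgue"
      using m' D by (intro borel_measurable_add borel_measurable_times borel_measurable_indicator)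
    ultimately show ?thesis by simp
  qed
  have "offline_coeff \<epsilon> Aper Bper Q \<sigma> T i \<in> borel_measurable (lebesgue_on unit_cell)"
    using meas by (rule measurable_restrict_space1)
  moreover have "AE x in lebesgue. x \<in> unit_cell \<longrightarrow> \<alpha> \<le> offline_coeff \<epsilon> Aper Bper Q \<sigma> T i x"
    "AE x in lebesgue. x \<in> unit_cell \<longrightarrow> offline_coeff \<epsilon> Aper Bper Q \<sigma> T i x \<le> \<beta>"
    using bounds by (auto elim: eventually_mono)
  ultimately show ?thesis using ab unfolding admissible_coeff_AE by blast
qed

text \<open>The sum of the indicator functions of the sets is the number of sets that contain the point.\<close>

lemma (in lod) sum_energy_overlap:
  assumes A: "admissible_coeff A" and S: "\<And>T. T \<in> \<T> \<Longrightarrow> S T \<in> sets lebesgue" "\<And>T. T \<in> \<T> \<Longrightarrow> S T \<subseteq> unit_cell"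
    and overlap: "\<And>x. real (card {T \<in> \<T>. x \<in> S T}) \<le> K" and w: "w \<in> H1_per0"
  shows "(\<Sum>T\<in>\<T>. energy_form A (S T) w w) \<le> K * energy_form A unit_cell w w"
proof -
  let ?f = "\<lambda>x. A x * (weak_grad w x \<bullet> weak_grad w x)"
  have i: "integrable lebesgue (\<lambda>x. indicator (S T) x *\<^sub>R ?f x)" if "T \<in> \<T>" for T
    using energy_form_integrable[OF S[OF that] admissible_imp_bounded[OF A] w w] by (simp only: set_integrable_def)
  have ic: "integrable lebesgue (\<lambda>x. K * (indicator unit_cell x *\<^sub>R ?f x))"
    using energy_form_integrable[OF unit_cell_sets subset_refl admissible_imp_bounded[OF A] w w]
    unfolding set_integrable_def by (rule integrable_mult_right)
  have "(\<Sum>T\<in>\<T>. energy_form A (S T) w w) = (LINT x|lebesgue. (\<Sum>T\<in>\<T>. indicator (S T) x *\<^sub>R ?f x))"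
    unfolding energy_form_def set_lebesgue_integral_def
    by (rule Bochner_Integration.integral_sum[symmetric, OF i])
  also have "\<dots> \<le> (LINT x|lebesgue. K * (indicator unit_cell x *\<^sub>R ?f x))"
  proof (rule integral_mono_AE[OF Bochner_Integration.integrable_sum[OF i] ic])
    show "AE x in lebesgue. (\<Sum>T\<in>\<T>. indicator (S T) x *\<^sub>R ?f x) \<le> K * (indicator unit_cell x *\<^sub>R ?f x)"
      using admissible_pos[OF A]
    proof eventually_elim
      case (elim x)
      show ?case
      proof (cases "x \<in> unit_cell")
        case True
        have "(\<Sum>T\<in>\<T>. indicator (S T) x *\<^sub>R ?f x) = (\<Sum>T\<in>\<T>. indicator (S T) x) * ?f x"
          by (simp add: sum_distrib_right)
        also have "(\<Sum>T\<in>\<T>. indicator (S T) x :: real) = real (card {T \<in> \<T>. x \<in> S T})"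
          using finite_mesh by (simp add: indicator_def sum.If_cases Int_def)
        also have "\<dots> * ?f x \<le> K * ?f x"
          using elim True by (intro mult_right_mono[OF overlap]) auto
        finally show ?thesis using True by simp
      next
        case False
        then have "indicator (S T) x = (0::real)" if "T \<in> \<T>" for T using S(2)[OF that] by (auto simp: indicator_def)
        then show ?thesis using False by simp
      qed
    qed
  qed
  also have "\<dots> = K * energy_form A unit_cell w w"
    unfolding energy_form_def set_lebesgue_integral_def by (rule integral_mult_right_zero)
  finally show ?thesis .
qed

text \<open>The elements themselves are patches with \<open>m = 0\<close>, so the overlap bound also serves for the sum of the energies
  of \<open>v\<close>. The factor 2 in \<open>2 / \<gamma>\<close> comes from \<open>m + 1 \<le> 2 m\<close>.\<close>

lemma (in lod) global_error:
  assumes \<gamma>: "\<gamma> > 0" and shape: "shape_regular \<gamma> \<T>" and per: "period_compatible \<epsilon> \<T>" and m: "m \<ge> 1"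
    and A: "admissible_coeff A" and Ac: "\<And>T i. admissible_coeff (Ac T i)"
    and v: "v \<in> coarse_space \<T>" and w: "w \<in> coarse_space \<T>"
  shows "\<bar>combined_form \<T> V I m N \<mu> Ac v w - exact_form \<T> V I m A v w\<bar>
    \<le> 2 * sqrt ((1 / \<gamma>) ^ CARD('d)) * sqrt ((2 / \<gamma>) ^ CARD('d)) * real m powr (real CARD('d) / 2)
      * (MAX T\<in>\<T>. error_indicator \<T> V I m A (N T) (\<mu> T) (Ac T) T)
      * energy_norm A unit_cell v * energy_norm A unit_cell w"
proof -
  let ?E = "\<lambda>T. error_indicator \<T> V I m A (N T) (\<mu> T) (Ac T) T"
  define E where "E = (MAX T\<in>\<T>. ?E T)"
  let ?a = "\<lambda>T. sqrt (energy_form A T v v)"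
  let ?b = "\<lambda>T. sqrt (energy_form A (patch \<T> m T) w w)"
  have vH: "v \<in> H1_per0" and wH: "w \<in> H1_per0" using v w by (auto intro: coarse_H1)
  have el: "lod_element \<T> V C\<^sub>I I T A (Ac T)" if "T \<in> \<T>" for T
    by (intro lod_element.intro lod_axioms lod_element_axioms.intro that A Ac)
  note nnA = admissible_nonneg[OF A]
  have E0: "0 \<le> ?E T" if "T \<in> \<T>" for T by (rule lod_element.error_indicator_bound(1)[OF el[OF that]])
  have EE: "?E T \<le> E" if "T \<in> \<T>" for T
    unfolding E_def using finite_mesh that by (intro Max_ge) auto
  have "(0 :: real ^ 'd) \<in> unit_cell" by (simp add: unit_cell_def mem_box_cart)
  then have "\<T> \<noteq> {}" using mesh_cover by blast
  then have Epos: "0 \<le> E" using E0 EE by (meson ex_in_conv order_trans)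
  have eT: "0 \<le> energy_form A T v v" "0 \<le> energy_form A (patch \<T> m T) w w" if "T \<in> \<T>" for T
    using that by (auto intro!: psd_form.nonneg[OF energy_form_psd[OF _ _ admissible_imp_bounded[OF A] nnA]]
        elem_sets elem_sub patch_sets patch_sub vH wH dest: subsetD[OF patch_sub] subsetD[OF elem_sub])
  have ec: "0 \<le> energy_form A unit_cell u u" if "u \<in> H1_per0" for u
    by (rule psd_form.nonneg[OF energy_form_psd[OF unit_cell_sets subset_refl admissible_imp_bounded[OF A] nnA] that])
  let ?D = "\<lambda>T. (\<Sum>i=0..N T. \<mu> T i * elem_form \<T> V I m T (Ac T i) v w) - elem_form \<T> V I m T A v w"
  have "\<bar>combined_form \<T> V I m N \<mu> Ac v w - exact_form \<T> V I m A v w\<bar> = \<bar>\<Sum>T\<in>\<T>. ?D T\<bar>"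
    by (simp add: combined_form_def exact_form_def sum_subtractf)
  also have "\<dots> \<le> (\<Sum>T\<in>\<T>. \<bar>?D T\<bar>)" by (rule sum_abs)
  also have "\<dots> \<le> (\<Sum>T\<in>\<T>. 2 * E * (?a T * ?b T))"
  proof (rule sum_mono)
    fix T assume T: "T \<in> \<T>"
    have "\<bar>?D T\<bar> \<le> 2 * ?E T * ?a T * ?b T" by (rule lod_element.element_error[OF el[OF T] v wH])
    also have "\<dots> = 2 * ?E T * (?a T * ?b T)" by (simp only: mult.assoc)
    also have "\<dots> \<le> 2 * E * (?a T * ?b T)"
      using EE[OF T] eT[OF T] by (intro mult_right_mono) auto
    finally show "\<bar>?D T\<bar> \<le> 2 * E * (?a T * ?b T)" .
  qed
  also have "\<dots> = 2 * E * (\<Sum>T\<in>\<T>. ?a T * ?b T)" by (rule sum_distrib_left[symmetric])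
  also have "\<dots> \<le> 2 * E * ((sqrt ((1 / \<gamma>) ^ CARD('d)) * energy_norm A unit_cell v)
      * (sqrt ((2 / \<gamma>) ^ CARD('d)) * real m powr (real CARD('d) / 2) * energy_norm A unit_cell w))"
  proof (rule mult_left_mono)
    have en: "energy_norm A unit_cell u = sqrt (energy_form A unit_cell u u)" for u
      by (simp add: energy_norm_def energy_form_def power2_norm_eq_inner)
    have "(\<Sum>T\<in>\<T>. ?a T * ?b T) \<le> sqrt ((\<Sum>T\<in>\<T>. (?a T)\<^sup>2) * (\<Sum>T\<in>\<T>. (?b T)\<^sup>2))"
      by (rule real_le_rsqrt[OF Cauchy_Schwarz_ineq_sum])
    also have "(\<Sum>T\<in>\<T>. (?a T)\<^sup>2) = (\<Sum>T\<in>\<T>. energy_form A T v v)"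
      by (intro sum.cong refl real_sqrt_pow2 eT)
    also have "(\<Sum>T\<in>\<T>. (?b T)\<^sup>2) = (\<Sum>T\<in>\<T>. energy_form A (patch \<T> m T) w w)"
      by (intro sum.cong refl real_sqrt_pow2 eT)
    also have "sqrt ((\<Sum>T\<in>\<T>. energy_form A T v v) * (\<Sum>T\<in>\<T>. energy_form A (patch \<T> m T) w w))
      = sqrt (\<Sum>T\<in>\<T>. energy_form A T v v) * sqrt (\<Sum>T\<in>\<T>. energy_form A (patch \<T> m T) w w)"
      by (rule real_sqrt_mult)
    also have "\<dots> \<le> sqrt ((1 / \<gamma>) ^ CARD('d) * energy_form A unit_cell v v)
        * sqrt ((2 * real m / \<gamma>) ^ CARD('d) * energy_form A unit_cell w w)"
    proof (intro mult_mono real_sqrt_le_mono)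
      show "(\<Sum>T\<in>\<T>. energy_form A T v v) \<le> (1 / \<gamma>) ^ CARD('d) * energy_form A unit_cell v v"
        using patch_overlap[OF \<gamma> shape per, of _ 0] by (intro sum_energy_overlap[OF A elem_sets elem_sub _ vH]) auto
      show "(\<Sum>T\<in>\<T>. energy_form A (patch \<T> m T) w w) \<le> (2 * real m / \<gamma>) ^ CARD('d) * energy_form A unit_cell w w"
      proof (rule sum_energy_overlap[OF A patch_sets patch_sub _ wH])
        fix x
        have "real (card {T \<in> \<T>. x \<in> patch \<T> m T}) \<le> ((real m + 1) / \<gamma>) ^ CARD('d)"
          by (rule patch_overlap[OF \<gamma> shape per])
        also have "\<dots> \<le> (2 * real m / \<gamma>) ^ CARD('d)"
          using m \<gamma> by (intro power_mono divide_right_mono) auto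
        finally show "real (card {T \<in> \<T>. x \<in> patch \<T> m T}) \<le> (2 * real m / \<gamma>) ^ CARD('d)" .
      qed
    qed (use \<gamma> ec[OF vH] in \<open>auto intro!: sum_nonneg eT\<close>)
    also have "(2 * real m / \<gamma>) ^ CARD('d) = (2 / \<gamma>) ^ CARD('d) * real m ^ CARD('d)"
      by (simp add: power_mult_distrib[symmetric])
    also have "sqrt ((2 / \<gamma>) ^ CARD('d) * real m ^ CARD('d) * energy_form A unit_cell w w)
        = sqrt ((2 / \<gamma>) ^ CARD('d)) * real m powr (real CARD('d) / 2) * energy_norm A unit_cell w"
    proof -
      have "sqrt (real m ^ CARD('d)) = real m powr (real CARD('d) / 2)"
        using m by (simp add: powr_half_sqrt[symmetric] powr_realpow[symmetric] powr_powr)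
      then show ?thesis by (simp add: real_sqrt_mult en)
    qed
    also have "sqrt ((1 / \<gamma>) ^ CARD('d) * energy_form A unit_cell v v) = sqrt ((1 / \<gamma>) ^ CARD('d)) * energy_norm A unit_cell v"
      by (simp only: real_sqrt_mult en)
    finally show "(\<Sum>T\<in>\<T>. ?a T * ?b T) \<le> (sqrt ((1 / \<gamma>) ^ CARD('d)) * energy_norm A unit_cell v)
      * (sqrt ((2 / \<gamma>) ^ CARD('d)) * real m powr (real CARD('d) / 2) * energy_norm A unit_cell w)" .
  qed (use Epos in simp)
  also have "\<dots> = 2 * sqrt ((1 / \<gamma>) ^ CARD('d)) * sqrt ((2 / \<gamma>) ^ CARD('d)) * real m powr (real CARD('d) / 2)
      * E * energy_norm A unit_cell v * energy_norm A unit_cell w"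
    by (simp only: mult_ac)
  finally show ?thesis unfolding E_def .
qed

theorem theorem4p2:
  fixes \<gamma> \<kappa> :: real
  assumes "\<gamma> > 0" and "\<kappa> > 0"
  shows "\<exists>C>0. \<forall>(\<T> :: (real ^ 'd) set set) V I C\<^sub>I A Aper Bper Q \<alpha> \<beta> (n::nat) \<epsilon> (m::nat) \<sigma> \<mu> J N Ac.
    quad_mesh \<T> \<and> shape_regular \<gamma> \<T> \<and> quasi_uniform \<kappa> \<T> \<and>
    ansatz_space \<T> V \<and> interpolation \<T> V C\<^sub>I I \<and>
    admissible_coeff A \<and> periodic_data \<alpha> \<beta> Aper Bper \<and>
    n \<ge> 1 \<and> \<epsilon> = 1 / real n \<and> period_compatible \<epsilon> \<T> \<and>
    Q \<subseteq> unit_cell \<and> Q \<in> sets lebesgue \<and> emeasure lebesgue Q > 0 \<and>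
    m \<ge> 1 \<and>
    J = defect_sites \<T> m \<epsilon> Q \<and> N = (\<lambda>T. card (J T)) \<and>
    (\<forall>T\<in>\<T>. bij_betw (\<sigma> T) {1..N T} (J T)) \<and>
    Ac = offline_coeff \<epsilon> Aper Bper Q \<sigma>
    \<longrightarrow> (\<forall>v\<in>coarse_space \<T>. \<forall>w\<in>coarse_space \<T>.
          \<bar>combined_form \<T> V I m N \<mu> Ac v w - exact_form \<T> V I m A v w\<bar>
          \<le> C * real m powr (real CARD('d) / 2)
              * (MAX T\<in>\<T>. error_indicator \<T> V I m A (N T) (\<mu> T) (Ac T) T)
              * energy_norm A unit_cell v * energy_norm A unit_cell w)"
proof (intro exI[of _ "2 * sqrt ((1 / \<gamma>) ^ CARD('d)) * sqrt ((2 / \<gamma>) ^ CARD('d))"] conjI allI impI ballI)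
  show "0 < 2 * sqrt ((1 / \<gamma>) ^ CARD('d)) * sqrt ((2 / \<gamma>) ^ CARD('d))" using assms(1) by simp
  fix \<T> :: "(real ^ 'd) set set" and V I C\<^sub>I and A Aper Bper :: "real ^ 'd \<Rightarrow> real" and Q \<alpha> \<beta>
    and n :: nat and \<epsilon> and m :: nat and \<sigma> \<mu> J N Ac and v w :: "real ^ 'd \<Rightarrow> real"
  assume h: "quad_mesh \<T> \<and> shape_regular \<gamma> \<T> \<and> quasi_uniform \<kappa> \<T> \<and>
    ansatz_space \<T> V \<and> interpolation \<T> V C\<^sub>I I \<and>
    admissible_coeff A \<and> periodic_data \<alpha> \<beta> Aper Bper \<and>
    n \<ge> 1 \<and> \<epsilon> = 1 / real n \<and> period_compatible \<epsilon> \<T> \<and>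
    Q \<subseteq> unit_cell \<and> Q \<in> sets lebesgue \<and> emeasure lebesgue Q > 0 \<and>
    m \<ge> 1 \<and>
    J = defect_sites \<T> m \<epsilon> Q \<and> N = (\<lambda>T. card (J T)) \<and>
    (\<forall>T\<in>\<T>. bij_betw (\<sigma> T) {1..N T} (J T)) \<and>
    Ac = offline_coeff \<epsilon> Aper Bper Q \<sigma>"
    and v: "v \<in> coarse_space \<T>" and w: "w \<in> coarse_space \<T>"
  have shape: "shape_regular \<gamma> \<T>" and A: "admissible_coeff A" and per: "period_compatible \<epsilon> \<T>" and m: "m \<ge> 1"
    and data: "periodic_data \<alpha> \<beta> Aper Bper" and Q: "Q \<in> sets lebesgue"
    and Ac_def: "Ac = offline_coeff \<epsilon> Aper Bper Q \<sigma>" and n: "n \<ge> 1" "\<epsilon> = 1 / real n"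
    and sp: "quad_mesh \<T>" "ansatz_space \<T> V" "interpolation \<T> V C\<^sub>I I"
    using h by blast+
  have \<epsilon>: "\<epsilon> > 0" using n by simp
  have "mesh_size \<T> > 0" using per \<epsilon> by (auto simp: period_compatible_def)
  then interpret lod \<T> V C\<^sub>I I using sp by unfold_locales
  have Ac: "admissible_coeff (Ac T i)" for T i
    unfolding Ac_def by (rule offline_coeff_admissible[OF data Q \<epsilon>])
  show "\<bar>combined_form \<T> V I m N \<mu> Ac v w - exact_form \<T> V I m A v w\<bar>
          \<le> 2 * sqrt ((1 / \<gamma>) ^ CARD('d)) * sqrt ((2 / \<gamma>) ^ CARD('d)) * real m powr (real CARD('d) / 2)
              * (MAX T\<in>\<T>. error_indicator \<T> V I m A (N T) (\<mu> T) (Ac T) T)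
              * energy_norm A unit_cell v * energy_norm A unit_cell w"
    by (rule global_error[OF assms(1) shape per m A Ac v w])
qed

end
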